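(* Let $K$ be a perfect field, $\mathcal{A}$ a commutative domain of essentially finite type over $K$ with Jacobian ideal $\mathfrak{a}_r$, $\mathcal{D}(\mathcal{A})$ the algebra of differential operators on $\mathcal{A}$, and $R$ a subalgebra of $\mathcal{D}(\mathcal{A})$ containing $\mathcal{A}$ which is an essential (left) $\mathcal{A}$-submodule of $\mathcal{D}(\mathcal{A})$. Let $R_i=R\cap\mathcal{D}(\mathcal{A})_i$, and for $i\geq1$ let $\mathfrak{b}_i=\{a\in\mathcal{A}\mid a\mathcal{D}(\mathcal{A})_i\subseteq R_i\}$ and $\mathfrak{c}_i=\{a\in\mathcal{A}\mid \mathcal{D}(\mathcal{A})_ia\subseteq R_i\}$. The following are equivalent: (1) $R$ is a simple algebra. (2) For all $i\geq1$, $\mathcal{D}(\mathcal{A})\mathfrak{a}_r^i\mathcal{D}(\mathcal{A})=\mathcal{D}(\mathcal{A})$ and $R\mathfrak{b}_i\mathfrak{c}_iR=R$. (3) $\mathcal{D}(\mathcal{A})$ is simple and $R\mathfrak{b}_i\mathfrak{c}_iR=R$ for all $i\geq1$. (4) For all $i\geq1$, $\mathcal{D}(\mathcal{A})\mathfrak{a}_r^i\mathcal{D}(\mathcal{A})=\mathcal{D}(\mathcal{A})$; moreover $R\mathfrak{b}_1^2R=R$ and $R\mathfrak{b}_1\cdots\mathfrak{b}_{i-1}\mathfrak{b}_i^2R=R$ for all $i\ge 2$. (5) $\mathcal{D}(\mathcal{A})$ is simple, $R\mathfrak{b}_1^2R=R$ and $R\mathfrak{b}_1\cdots\mathfrak{b}_{i-1}\mathfrak{b}_i^2R=R$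 for all $i\geq2$. (6) For all $i\geq1$, $\mathcal{D}(\mathcal{A})\mathfrak{a}_r^i\mathcal{D}(\mathcal{A})=\mathcal{D}(\mathcal{A})$; moreover $R\mathfrak{c}_1^2R=R$ and $R\mathfrak{c}_1\cdots\mathfrak{c}_{i-1}\mathfrak{c}_i^2R=R$ for all $i\ge2$. (7) $\mathcal{D}(\mathcal{A})$ is simple, $R\mathfrak{c}_1^2R=R$ and $R\mathfrak{c}_1\cdots\mathfrak{c}_{i-1}\mathfrak{c}_i^2R=R$ for all $i\geq2$.
   Context: For a commutative $K$-algebra $R'$, $\mathcal{D}(R')=\bigcup_{i\ge0}\mathcal{D}(R')_i\subseteq\mathrm{End}_K(R')$ with $\mathcal{D}(R')_{-1}=0$, $\mathcal{D}(R')_i=\{u\mid ru-ur\in\mathcal{D}(R')_{i-1}\ \forall r\in R'\}$, and $R'=\mathcal{D}(R')_0$. Essentially finite type: a localization of a finitely generated commutative algebra. Write $\mathcal{A}=S^{-1}(P_n/I)$ with $P_n=K[x_1,\dots,x_n]$, $I=(f_1,\dots,f_m)$ prime; let $\overline{J}=(\overline{\partial f_i/\partial x_j})$ be the Jacobi matrix over $P_n/I$ and $r$ its rank over the fraction field; the Jacobian ideal $\mathfrak{a}_r$ is the ideal of $\mathcal{A}$ generated by all $r\times r$ minors of $\overline{J}$. A submodule is essential if it meets every nonzero submodule nontrivially. *)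

theory Defs
  imports Main "HOL-Library.Poly_Mapping" "HOL-Computational_Algebra.Fraction_Field"
    "Jordan_Normal_Form.DL_Rank" "Jordan_Normal_Form.DL_Submatrix"
begin

definition perfect_field :: "'k::field itself \<Rightarrow> bool" where
  "perfect_field _ \<longleftrightarrow> CHAR('k) = 0 \<or> (\<forall>y::'k. \<exists>z. z ^ CHAR('k) = y)"

definition alg_struct :: "('k::field \<Rightarrow> 'a::comm_ring_1) \<Rightarrow> bool" where
  "alg_struct \<phi> \<longleftrightarrow> \<phi> 1 = 1 \<and> (\<forall>c d. \<phi> (c + d) = \<phi> c + \<phi> d) \<and> (\<forall>c d. \<phi> (c * d) = \<phi> c * \<phi> d)"

type_synonym 'k kpoly = "(nat \<Rightarrow>\<^sub>0 nat) \<Rightarrow>\<^sub>0 'k"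

definition in_Pn :: "nat \<Rightarrow> 'k::zero kpoly \<Rightarrow> bool" where
  "in_Pn n p \<longleftrightarrow> (\<forall>mon \<in> Poly_Mapping.keys p. Poly_Mapping.keys mon \<subseteq> {..<n})"

definition eval_mpoly :: "('k::field \<Rightarrow> 'a::comm_ring_1) \<Rightarrow> (nat \<Rightarrow> 'a) \<Rightarrow> 'k kpoly \<Rightarrow> 'a" where
  "eval_mpoly \<phi> x p = (\<Sum>mon \<in> Poly_Mapping.keys p. \<phi> (Poly_Mapping.lookup p mon) * (\<Prod>j \<in> Poly_Mapping.keys mon. x j ^ Poly_Mapping.lookup mon j))"

definition pderiv_mpoly :: "nat \<Rightarrow> 'k::comm_ring_1 kpoly \<Rightarrow> 'k kpoly" where
  "pderiv_mpoly j p = (\<Sum>mon \<in> Poly_Mapping.keys p.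
      if Poly_Mapping.lookup mon j = 0 then 0
      else Poly_Mapping.single (mon - Poly_Mapping.single j 1) (of_nat (Poly_Mapping.lookup mon j) * Poly_Mapping.lookup p mon))"

inductive_set idl_gen :: "'a::comm_ring_1 set \<Rightarrow> 'a set" for X where
  zero: "0 \<in> idl_gen X"
| gen: "x \<in> X \<Longrightarrow> a * x \<in> idl_gen X"
| add: "u \<in> idl_gen X \<Longrightarrow> v \<in> idl_gen X \<Longrightarrow> u + v \<in> idl_gen X"

definition idl_mult :: "'a::comm_ring_1 set \<Rightarrow> 'a set \<Rightarrow> 'a set" where
  "idl_mult I J = idl_gen {a * b | a b. a \<in> I \<and> b \<in> J}"

definition unit_idl :: "'a::comm_ring_1 set" where
  "unit_idl = UNIV"

fun idl_pow :: "'a::comm_ring_1 set \<Rightarrow> nat \<Rightarrow> 'a set" where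
  "idl_pow I 0 = unit_idl"
| "idl_pow I (Suc i) = idl_mult I (idl_pow I i)"

definition jacobi_mat :: "('k::field \<Rightarrow> 'a::comm_ring_1) \<Rightarrow> (nat \<Rightarrow> 'a) \<Rightarrow> nat \<Rightarrow> nat \<Rightarrow> (nat \<Rightarrow> 'k kpoly) \<Rightarrow> 'a mat" where
  "jacobi_mat \<phi> x n m f = mat m n (\<lambda>(i, j). eval_mpoly \<phi> x (pderiv_mpoly j (f i)))"

definition jacobi_rank :: "('k::field \<Rightarrow> 'a::idom) \<Rightarrow> (nat \<Rightarrow> 'a) \<Rightarrow> nat \<Rightarrow> nat \<Rightarrow> (nat \<Rightarrow> 'k kpoly) \<Rightarrow> nat" where
  "jacobi_rank \<phi> x n m f =
     vec_space.rank m (map_mat (\<lambda>a. Fract a 1) (jacobi_mat \<phi> x n m f))"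

definition jacobian_ideal :: "('k::field \<Rightarrow> 'a::idom) \<Rightarrow> (nat \<Rightarrow> 'a) \<Rightarrow> nat \<Rightarrow> nat \<Rightarrow> (nat \<Rightarrow> 'k kpoly) \<Rightarrow> 'a set" where
  "jacobian_ideal \<phi> x n m f =
     (let r = jacobi_rank \<phi> x n m f in
      idl_gen {det (submatrix (jacobi_mat \<phi> x n m f) I J) | I J.
                 I \<subseteq> {..<m} \<and> J \<subseteq> {..<n} \<and> card I = r \<and> card J = r})"

definition lmult :: "'a::comm_ring_1 \<Rightarrow> 'a \<Rightarrow> 'a" where
  "lmult a = (\<lambda>y. a * y)"

definition op_zero :: "'a::comm_ring_1 \<Rightarrow> 'a" where
  "op_zero = (\<lambda>y. 0)"

definition op_add :: "('a::comm_ring_1 \<Rightarrow> 'a) \<Rightarrow> ('a \<Rightarrow> 'a) \<Rightarrow> 'a \<Rightarrow> 'a" where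
  "op_add u v = (\<lambda>y. u y + v y)"

definition op_neg :: "('a::comm_ring_1 \<Rightarrow> 'a) \<Rightarrow> 'a \<Rightarrow> 'a" where
  "op_neg u = (\<lambda>y. - u y)"

definition EndK :: "('k::field \<Rightarrow> 'a::comm_ring_1) \<Rightarrow> ('a \<Rightarrow> 'a) set" where
  "EndK \<phi> = {u. (\<forall>y z. u (y + z) = u y + u z) \<and> (\<forall>c y. u (\<phi> c * y) = \<phi> c * u y)}"

definition commut :: "'a::comm_ring_1 \<Rightarrow> ('a \<Rightarrow> 'a) \<Rightarrow> 'a \<Rightarrow> 'a" where
  "commut r u = (\<lambda>y. r * u y - u (r * y))"

text \<open>Dops phi i is D(A)_i (with D(A)_{-1} = 0).\<close>
fun Dops :: "('k::field \<Rightarrow> 'a::comm_ring_1) \<Rightarrow> nat \<Rightarrow> ('a \<Rightarrow> 'a) set" where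
  "Dops \<phi> 0 = {u \<in> EndK \<phi>. \<forall>r. commut r u = op_zero}"
| "Dops \<phi> (Suc i) = {u \<in> EndK \<phi>. \<forall>r. commut r u \<in> Dops \<phi> i}"

definition Dalg :: "('k::field \<Rightarrow> 'a::comm_ring_1) \<Rightarrow> ('a \<Rightarrow> 'a) set" where
  "Dalg \<phi> = (\<Union>i. Dops \<phi> i)"

definition subalg_containing_A :: "('k::field \<Rightarrow> 'a::comm_ring_1) \<Rightarrow> ('a \<Rightarrow> 'a) set \<Rightarrow> bool" where
  "subalg_containing_A \<phi> R \<longleftrightarrow> R \<subseteq> Dalg \<phi> \<and> (\<forall>a. lmult a \<in> R)
     \<and> (\<forall>u\<in>R. \<forall>v\<in>R. op_add u v \<in> R \<and> u \<circ> v \<in> R)"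

definition left_A_submodule :: "('a::comm_ring_1 \<Rightarrow> 'a) set \<Rightarrow> ('a \<Rightarrow> 'a) set \<Rightarrow> bool" where
  "left_A_submodule M N \<longleftrightarrow> N \<subseteq> M \<and> op_zero \<in> N
     \<and> (\<forall>u\<in>N. \<forall>v\<in>N. op_add u v \<in> N) \<and> (\<forall>a. \<forall>u\<in>N. lmult a \<circ> u \<in> N)"

definition essential_left_A_submodule :: "('a::comm_ring_1 \<Rightarrow> 'a) set \<Rightarrow> ('a \<Rightarrow> 'a) set \<Rightarrow> bool" where
  "essential_left_A_submodule M R \<longleftrightarrow> left_A_submodule M R \<and>
     (\<forall>N. left_A_submodule M N \<and> N \<noteq> {op_zero} \<longrightarrow> N \<inter> R \<noteq> {op_zero})"

definition two_sided_ideal :: "('a::comm_ring_1 \<Rightarrow> 'a) set \<Rightarrow> ('a \<Rightarrow> 'a) set \<Rightarrow> bool" where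
  "two_sided_ideal R J \<longleftrightarrow> J \<subseteq> R \<and> op_zero \<in> J
     \<and> (\<forall>u\<in>J. \<forall>v\<in>J. op_add u v \<in> J) \<and> (\<forall>u\<in>J. op_neg u \<in> J)
     \<and> (\<forall>r\<in>R. \<forall>u\<in>J. r \<circ> u \<in> J \<and> u \<circ> r \<in> J)"

definition simple_ring :: "('a::comm_ring_1 \<Rightarrow> 'a) set \<Rightarrow> bool" where
  "simple_ring R \<longleftrightarrow> R \<noteq> {op_zero} \<and> (\<forall>J. two_sided_ideal R J \<longrightarrow> J = {op_zero} \<or> J = R)"

inductive_set sandwich :: "('a::comm_ring_1 \<Rightarrow> 'a) set \<Rightarrow> 'a set \<Rightarrow> ('a \<Rightarrow> 'a) set" for R J where
  zero: "op_zero \<in> sandwich R J"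
| gen: "r \<in> R \<Longrightarrow> r' \<in> R \<Longrightarrow> a \<in> J \<Longrightarrow> r \<circ> lmult a \<circ> r' \<in> sandwich R J"
| add: "u \<in> sandwich R J \<Longrightarrow> v \<in> sandwich R J \<Longrightarrow> op_add u v \<in> sandwich R J"

definition Rlev :: "('k::field \<Rightarrow> 'a::comm_ring_1) \<Rightarrow> ('a \<Rightarrow> 'a) set \<Rightarrow> nat \<Rightarrow> ('a \<Rightarrow> 'a) set" where
  "Rlev \<phi> R i = R \<inter> Dops \<phi> i"

definition bideal :: "('k::field \<Rightarrow> 'a::comm_ring_1) \<Rightarrow> ('a \<Rightarrow> 'a) set \<Rightarrow> nat \<Rightarrow> 'a set" where
  "bideal \<phi> R i = {a. \<forall>u \<in> Dops \<phi> i. lmult a \<circ> u \<in> Rlev \<phi> R i}"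

definition cideal :: "('k::field \<Rightarrow> 'a::comm_ring_1) \<Rightarrow> ('a \<Rightarrow> 'a) set \<Rightarrow> nat \<Rightarrow> 'a set" where
  "cideal \<phi> R i = {a. \<forall>u \<in> Dops \<phi> i. u \<circ> lmult a \<in> Rlev \<phi> R i}"

definition chain_prod :: "(nat \<Rightarrow> 'a::comm_ring_1 set) \<Rightarrow> nat \<Rightarrow> 'a set" where
  "chain_prod I i = foldr idl_mult (map I [1..<i]) (idl_pow (I i) 2)"

end

theory Submission
  imports Defs "HOL-Computational_Algebra.Formal_Power_Series" "Jordan_Normal_Form.DL_Rank_Submatrix"
begin

text \<open>
  The equivalences between the conditions on \<open>R\<close> are formal: an essential submodule meets every
  nonzero ideal of \<open>D = D(A)\<close>, a nonzero ideal of \<open>R\<close> meets \<open>A\<close> by taking commutators, and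
  \<open>1 = \<Sum>u a v\<close> in \<open>D\<close> becomes \<open>b c = \<Sum>(b u) a (v c)\<close> in \<open>R\<close>; moreover
  \<open>\<bb>\<^sub>1\<dots>\<bb>\<^sub>i \<subseteq> \<cc>\<^sub>i\<close> and \<open>\<cc>\<^sub>1\<dots>\<cc>\<^sub>i \<subseteq> \<bb>\<^sub>i\<close>.  The ideals \<open>\<bb>\<^sub>i\<close> are nonzero because an operator of order
  \<open>i\<close> is determined by its values on the monomials of degree at most \<open>i\<close>.

  It remains to see that every nonzero ideal of \<open>D\<close> contains a power of each nonzero
  \<open>r \<times> r\<close> minor \<open>\<Delta>\<close> of the Jacobi matrix.  The coordinates \<open>t\<^sub>k\<close> outside the columns of \<open>\<Delta>\<close> are
  algebraically independent since \<open>K\<close> is perfect, and the fraction field is separable algebraic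
  over \<open>K(t)\<close>: otherwise some nonzero derivation would kill all \<open>t\<^sub>k\<close>, which \<open>\<Delta> \<noteq> 0\<close> excludes.
  Hence each translation \<open>t\<^sub>k \<mapsto> t\<^sub>k + \<Delta>\<^sup>2\<epsilon>\<close> extends to a ring homomorphism from \<open>A\<close> to
  \<open>A[[\<epsilon>]]\<close>, whose coefficients are differential operators.  A nonzero ideal of \<open>D\<close> contains
  a nonzero element of \<open>K[t]\<close>, and these operators extract its leading coefficients up to powers of
  \<open>\<Delta>\<close>.
\<close>

section \<open>Operators and their order\<close>

text \<open>Derivations alone do not suffice in characteristic p: a d-fold derivative multiplies a
  leading coefficient by d!, which may vanish. The coefficients of a homomorphism into power series
  behave like divided powers and return the leading coefficient itself. The translation is by
  \<open>\<Delta>\<^sup>2\<close> rather than \<Delta> for the reason known from Tougeron's form of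
  Newton's method. The coefficients of the dependent coordinates solve systems with determinant
  \<Delta>, and Cramer's rule costs one factor \<Delta>. A right hand side divisible by
  \<open>\<Delta>\<^sup>2\<close> leaves a solution divisible by \<Delta>, and the quadratic Taylor
  terms of such solutions are again divisible by \<open>\<Delta>\<^sup>2\<close>, so the induction
  closes. The extension theory stays inside the type of A: intermediate rings are subsets,
  homomorphisms are total functions constrained on a subset, and minimal polynomials may have any
  leading coefficient. Only the target grows, to dual numbers or power series over the fraction
  field, and one abstract Hensel property serves both.\<close>

lemma op_zero_apply: "op_zero y = 0"
  by (simp add: op_zero_def)

lemma op_add_apply: "op_add u v y = u y + v y"
  by (simp add: op_add_def)

lemma op_neg_apply: "op_neg u y = - u y"
  by (simp add: op_neg_def)

lemma lmult_apply: "lmult a y = a * y"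
  by (simp add: lmult_def)

lemma commut_apply: "commut r u y = r * u y - u (r * y)"
  by (simp add: commut_def)

declare o_apply [simp del]

lemmas op_simps = op_zero_apply op_add_apply op_neg_apply lmult_apply commut_apply o_apply fun_eq_iff

text \<open>Subalgebras are axiomatised by \<open>op_add\<close>, composition and multiplications,
  so the difference is spelled with \<open>lmult (- 1)\<close>; closure of ideals under commutators
  then follows from their closure properties.\<close>

lemma commut_eq_op: "commut r u = op_add (lmult r \<circ> u) (lmult (- 1) \<circ> (u \<circ> lmult r))"
  by (auto simp: op_simps)

lemma lmult_comp_lmult: "lmult a \<circ> lmult b = lmult (a * b)"
  by (auto simp: op_simps mult.assoc)

lemma lmult_eq_zero_iff: "lmult a = op_zero \<longleftrightarrow> a = 0"
proof
  assume "lmult a = op_zero"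
  then have "lmult a 1 = op_zero 1" by (rule fun_cong)
  then show "a = 0" by (simp add: op_simps)
qed (simp add: op_simps)

lemma EndK_add: "u \<in> EndK \<phi> \<Longrightarrow> u (y + z) = u y + u z"
  by (simp add: EndK_def)

lemma EndK_zero: "u \<in> EndK \<phi> \<Longrightarrow> u 0 = 0"
  using EndK_add[of u \<phi> 0 0] by simp

lemma EndK_diff: "u \<in> EndK \<phi> \<Longrightarrow> u (y - z) = u y - u z"
  using EndK_add[of u \<phi> "y - z" z] by (simp add: eq_diff_eq)

declare Dops.simps [simp del]

lemma Dops_0_iff: "u \<in> Dops \<phi> 0 \<longleftrightarrow> u \<in> EndK \<phi> \<and> (\<forall>r. commut r u = op_zero)"
  by (simp add: Dops.simps(1))

lemma Dops_Suc_iff: "u \<in> Dops \<phi> (Suc i) \<longleftrightarrow> u \<in> EndK \<phi> \<and> (\<forall>r. commut r u \<in> Dops \<phi> i)"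
  by (simp add: Dops.simps(2))

lemma Dops_EndK: "u \<in> Dops \<phi> i \<Longrightarrow> u \<in> EndK \<phi>"
  by (cases i) (auto simp: Dops_Suc_iff Dops_0_iff)

lemma op_zero_in_EndK: "op_zero \<in> EndK \<phi>"
  by (auto simp: EndK_def op_simps)

lemma op_add_in_EndK: "u \<in> EndK \<phi> \<Longrightarrow> v \<in> EndK \<phi> \<Longrightarrow> op_add u v \<in> EndK \<phi>"
  by (auto simp: EndK_def op_simps algebra_simps)

lemma comp_in_EndK: "u \<in> EndK \<phi> \<Longrightarrow> v \<in> EndK \<phi> \<Longrightarrow> u \<circ> v \<in> EndK \<phi>"
  by (auto simp: EndK_def op_simps)

lemma lmult_in_EndK: "lmult a \<in> EndK \<phi>"
  by (auto simp: EndK_def op_simps algebra_simps)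

lemma op_zero_in_Dops: "op_zero \<in> Dops \<phi> i"
proof (induction i)
  case 0
  have "commut r op_zero = op_zero" for r :: 'a by (auto simp: op_simps)
  then show ?case by (simp add: Dops_0_iff op_zero_in_EndK)
next
  case (Suc i)
  have "commut r op_zero = op_zero" for r :: 'a by (auto simp: op_simps)
  with Suc show ?case by (auto simp: Dops_Suc_iff op_zero_in_EndK)
qed

lemma op_add_in_Dops: "u \<in> Dops \<phi> i \<Longrightarrow> v \<in> Dops \<phi> i \<Longrightarrow> op_add u v \<in> Dops \<phi> i"
proof (induction i arbitrary: u v)
  case 0
  have "commut r (op_add u v) = op_add (commut r u) (commut r v)" for r
    by (auto simp: op_simps algebra_simps)
  moreover have "op_add op_zero op_zero = op_zero" by (auto simp: op_simps)
  ultimately show ?case using 0 by (simp add: Dops_0_iff op_add_in_EndK)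
next
  case (Suc i)
  have "commut r (op_add u v) = op_add (commut r u) (commut r v)" for r
    by (auto simp: op_simps algebra_simps)
  with Suc show ?case by (auto simp: Dops_Suc_iff op_add_in_EndK)
qed

lemma lmult_comp_in_Dops: "u \<in> Dops \<phi> i \<Longrightarrow> lmult a \<circ> u \<in> Dops \<phi> i"
proof (induction i arbitrary: u)
  case 0
  have "commut r (lmult a \<circ> u) = lmult a \<circ> commut r u" for r
    by (auto simp: op_simps algebra_simps)
  moreover have "lmult a \<circ> op_zero = op_zero" "op_zero \<circ> lmult a = op_zero" by (auto simp: op_simps)
  ultimately show ?case using 0 by (simp add: Dops_0_iff comp_in_EndK lmult_in_EndK)
next
  case (Suc i)
  have "commut r (lmult a \<circ> u) = lmult a \<circ> commut r u" for r
    by (auto simp: op_simps algebra_simps)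
  with Suc show ?case by (auto simp: Dops_Suc_iff comp_in_EndK lmult_in_EndK)
qed

lemma comp_lmult_in_Dops: "u \<in> Dops \<phi> i \<Longrightarrow> u \<circ> lmult a \<in> Dops \<phi> i"
proof (induction i arbitrary: u)
  case 0
  have "commut r (u \<circ> lmult a) = commut r u \<circ> lmult a" for r
    by (auto simp: op_simps mult.left_commute)
  moreover have "lmult a \<circ> op_zero = op_zero" "op_zero \<circ> lmult a = op_zero" by (auto simp: op_simps)
  ultimately show ?case using 0 by (simp add: Dops_0_iff comp_in_EndK lmult_in_EndK)
next
  case (Suc i)
  have "commut r (u \<circ> lmult a) = commut r u \<circ> lmult a" for r
    by (auto simp: op_simps mult.left_commute)
  with Suc show ?case by (auto simp: Dops_Suc_iff comp_in_EndK lmult_in_EndK)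
qed

lemma lmult_in_Dops_0: "lmult a \<in> Dops \<phi> 0"
  unfolding Dops_0_iff by (auto simp: lmult_in_EndK) (auto simp: op_simps algebra_simps)

text \<open>The commutator with \<open>y\<close>, evaluated at 1, reads
  \<open>y * u 1 = u y\<close>.\<close>

lemma commuting_eq_lmult:
  assumes "\<And>r. commut r u = op_zero"
  shows "u = lmult (u 1)"
proof
  fix y
  have "commut y u 1 = op_zero 1" by (simp only: assms)
  then show "u y = lmult (u 1) y" by (simp add: op_simps mult.commute)
qed

lemma Dops_0_eq_lmult: "u \<in> Dops \<phi> 0 \<Longrightarrow> u = lmult (u 1)"
  by (rule commuting_eq_lmult) (simp add: Dops_0_iff)

lemma Dops_Suc_mono: "u \<in> Dops \<phi> i \<Longrightarrow> u \<in> Dops \<phi> (Suc i)"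
proof (induction i arbitrary: u)
  case 0
  then show ?case using op_zero_in_Dops[of \<phi> 0] by (simp add: Dops_Suc_iff Dops_0_iff)
next
  case (Suc i)
  then show ?case by (auto simp only: Dops_Suc_iff[of _ _ "Suc i"] Dops_Suc_iff[of _ _ i])
qed

lemma Dops_mono: "i \<le> j \<Longrightarrow> u \<in> Dops \<phi> i \<Longrightarrow> u \<in> Dops \<phi> j"
  by (induction j) (auto simp: le_Suc_eq Dops_Suc_mono)

lemma lmult_in_Dops: "lmult a \<in> Dops \<phi> i"
  using Dops_mono[OF _ lmult_in_Dops_0] by blast

lemma commut_in_Dops: "u \<in> Dops \<phi> (Suc i) \<Longrightarrow> commut r u \<in> Dops \<phi> i"
  by (simp add: Dops_Suc_iff)

text \<open>The commutator with \<open>r\<close> is a derivation for composition, so it lowers the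
  total order \<open>i + j\<close>, the induction measure. Factors of order 0 are treated apart
  because the recursion has no level below 0.\<close>

lemma comp_in_Dops: "u \<in> Dops \<phi> i \<Longrightarrow> v \<in> Dops \<phi> j \<Longrightarrow> u \<circ> v \<in> Dops \<phi> (i + j)"
proof (induction "i + j" arbitrary: i j u v rule: less_induct)
  case less
  show ?case
  proof (cases i)
    case 0
    then show ?thesis
      using less.prems Dops_0_eq_lmult[of u \<phi>] lmult_comp_in_Dops[OF less.prems(2), of "u 1"] by force
  next
    case i: (Suc i')
    show ?thesis
    proof (cases j)
      case 0
      then show ?thesis
        using less.prems Dops_0_eq_lmult[of v \<phi>] comp_lmult_in_Dops[OF less.prems(1), of "v 1"] by force
    next
      case j: (Suc j')
      have "commut r (u \<circ> v) \<in> Dops \<phi> (i' + j)" for r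
      proof -
        have "commut r (u \<circ> v) = op_add (commut r u \<circ> v) (u \<circ> commut r v)"
          using EndK_diff[OF Dops_EndK[OF less.prems(1)]] by (auto simp: op_simps)
        moreover have "commut r u \<circ> v \<in> Dops \<phi> (i' + j)"
          using less.hyps[of i' j] less.prems i commut_in_Dops by force
        moreover have "u \<circ> commut r v \<in> Dops \<phi> (i' + j)"
          using less.hyps[of i j'] less.prems i j commut_in_Dops by fastforce
        ultimately show ?thesis by (simp add: op_add_in_Dops)
      qed
      then show ?thesis
        using i less.prems by (simp add: Dops_Suc_iff comp_in_EndK Dops_EndK)
    qed
  qed
qed

lemma Dops_subset_Dalg: "Dops \<phi> i \<subseteq> Dalg \<phi>"
  by (auto simp: Dalg_def)

lemma subalg_Dalg: "subalg_containing_A \<phi> (Dalg \<phi>)"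
  unfolding subalg_containing_A_def
proof (intro conjI ballI allI)
  show "lmult a \<in> Dalg \<phi>" for a using lmult_in_Dops Dops_subset_Dalg by blast
  fix u v assume "u \<in> Dalg \<phi>" "v \<in> Dalg \<phi>"
  then obtain i j where ij: "u \<in> Dops \<phi> i" "v \<in> Dops \<phi> j" by (auto simp: Dalg_def)
  then have "u \<in> Dops \<phi> (i + j)" "v \<in> Dops \<phi> (i + j)" by (meson Dops_mono le_add1 le_add2)+
  then show "op_add u v \<in> Dalg \<phi>" using op_add_in_Dops Dops_subset_Dalg by blast
  show "u \<circ> v \<in> Dalg \<phi>" using comp_in_Dops[OF ij] Dops_subset_Dalg by blast
qed simp

lemma Dalg_EndK: "u \<in> Dalg \<phi> \<Longrightarrow> u \<in> EndK \<phi>"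
  by (auto simp: Dalg_def Dops_EndK)

section \<open>Two-sided ideals of an algebra between A and D(A)\<close>

context
  fixes \<phi> :: "'k::field \<Rightarrow> 'a::idom" and R
  assumes R: "subalg_containing_A \<phi> R"
begin

lemma subalg_lmult: "lmult a \<in> R"
  and subalg_add: "u \<in> R \<Longrightarrow> v \<in> R \<Longrightarrow> op_add u v \<in> R"
  and subalg_comp: "u \<in> R \<Longrightarrow> v \<in> R \<Longrightarrow> u \<circ> v \<in> R"
  and subalg_sub: "u \<in> R \<Longrightarrow> u \<in> Dalg \<phi>"
  using R by (auto simp: subalg_containing_A_def)

lemma subalg_EndK: "u \<in> R \<Longrightarrow> u \<in> EndK \<phi>"
  by (simp add: Dalg_EndK subalg_sub)

lemma ideal_eq_if_one:
  assumes "two_sided_ideal R L" "lmult 1 \<in> L"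
  shows "L = R"
proof -
  have "r \<in> L" if "r \<in> R" for r
  proof -
    have "r \<circ> lmult 1 \<in> L" using assms that by (auto simp: two_sided_ideal_def)
    also have "r \<circ> lmult 1 = r" by (auto simp: op_simps)
    finally show ?thesis .
  qed
  then show ?thesis using assms(1) by (auto simp: two_sided_ideal_def)
qed

lemma sandwich_ideal: "two_sided_ideal R (sandwich R X)"
proof -
  have S: "sandwich R X \<subseteq> R"
  proof
    fix u assume "u \<in> sandwich R X"
    then show "u \<in> R"
    proof induction
      case zero
      show ?case using subalg_lmult[of 0] lmult_eq_zero_iff by metis
    qed (auto intro: subalg_comp subalg_lmult subalg_add)
  qed
  have L: "r \<circ> u \<in> sandwich R X" if "r \<in> R" "u \<in> sandwich R X" for r u
    using that(2)
  proof induction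
    case zero
    have "r \<circ> op_zero = op_zero" using EndK_zero[OF subalg_EndK[OF that(1)]] by (auto simp: op_simps)
    then show ?case by (simp add: sandwich.zero)
  next
    case (gen s s' a)
    then show ?case using sandwich.gen[of "r \<circ> s" R s' a X] that by (auto simp: comp_assoc subalg_comp)
  next
    case (add u v)
    have "r \<circ> op_add u v = op_add (r \<circ> u) (r \<circ> v)"
      using EndK_add[OF subalg_EndK[OF that(1)]] by (auto simp: op_simps)
    then show ?case using add by (simp add: sandwich.add)
  qed
  have Rt: "u \<circ> r \<in> sandwich R X" if "r \<in> R" "u \<in> sandwich R X" for r u
    using that(2)
  proof induction
    case zero
    have "op_zero \<circ> r = op_zero" by (auto simp: op_simps)
    then show ?case by (simp add: sandwich.zero)
  next
    case (gen s s' a)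
    then show ?case using sandwich.gen[of s R "s' \<circ> r" a X] that by (auto simp: comp_assoc subalg_comp)
  next
    case (add u v)
    have "op_add u v \<circ> r = op_add (u \<circ> r) (v \<circ> r)" by (auto simp: op_simps)
    then show ?case using add by (simp add: sandwich.add)
  qed
  have "op_neg u \<in> sandwich R X" if "u \<in> sandwich R X" for u
  proof -
    have "op_neg u = lmult (- 1) \<circ> u" by (auto simp: op_simps)
    then show ?thesis using L[OF subalg_lmult that] by simp
  qed
  then show ?thesis
    unfolding two_sided_ideal_def using S L Rt sandwich.zero sandwich.add by metis
qed

lemma sandwich_least:
  assumes L: "two_sided_ideal R L" and X: "\<And>a. a \<in> X \<Longrightarrow> lmult a \<in> L"
  shows "sandwich R X \<subseteq> L"
proof
  fix u assume "u \<in> sandwich R X"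
  then show "u \<in> L"
    using L X by induction (auto simp: two_sided_ideal_def)
qed

lemma lmult_in_sandwich:
  assumes "a \<in> X"
  shows "lmult a \<in> sandwich R X"
proof -
  have "lmult 1 \<circ> lmult a \<circ> lmult 1 \<in> sandwich R X"
    by (intro sandwich.gen subalg_lmult assms)
  also have "lmult 1 \<circ> lmult a \<circ> lmult 1 = lmult a" by (auto simp: op_simps)
  finally show ?thesis .
qed

lemma simple_sandwich:
  assumes "simple_ring R" "a \<in> X" "a \<noteq> 0"
  shows "sandwich R X = R"
  using assms lmult_in_sandwich[OF assms(2)] sandwich_ideal[of X] lmult_eq_zero_iff[of a]
  unfolding simple_ring_def by blast

lemma ideal_eq_if_sandwich:
  assumes "two_sided_ideal R L" "sandwich R X = R" "\<And>a. a \<in> X \<Longrightarrow> lmult a \<in> L"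
  shows "L = R"
  using sandwich_least[OF assms(1,3)] assms(1,2) unfolding two_sided_ideal_def by blast

lemma simple_ringI:
  assumes "\<And>L. two_sided_ideal R L \<Longrightarrow> L \<noteq> {op_zero} \<Longrightarrow> L = R"
  shows "simple_ring R"
proof -
  have "lmult 1 \<in> R" by (rule subalg_lmult)
  then have "R \<noteq> {op_zero}" using lmult_eq_zero_iff[of "1 :: 'a"] by auto
  then show ?thesis using assms by (auto simp: simple_ring_def)
qed

text \<open>Commutators with elements of the base ring lower the order, so a nonzero operator of
  least order in the ideal commutes with everything.\<close>

lemma ideal_contains_lmult:
  assumes L: "two_sided_ideal R L" and "L \<noteq> {op_zero}"
  obtains a where "a \<noteq> 0" "lmult a \<in> L"
proof -
  have main: "\<exists>a. a \<noteq> 0 \<and> lmult a \<in> L" if "u \<in> L" "u \<noteq> op_zero" "u \<in> Dops \<phi> i" for u i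
    using that
  proof (induction i arbitrary: u)
    case 0
    then have "u = lmult (u 1)" using Dops_0_eq_lmult by blast
    then show ?case using 0 lmult_eq_zero_iff[of "u 1"] by auto
  next
    case (Suc i)
    show ?case
    proof (cases "\<exists>r. commut r u \<noteq> op_zero")
      case True
      then obtain r where r: "commut r u \<noteq> op_zero" ..
      have *: "p \<circ> w \<in> L" "w \<circ> p \<in> L" if "p \<in> R" "w \<in> L" for p w
        using L that by (auto simp: two_sided_ideal_def)
      have "commut r u \<in> L"
        unfolding commut_eq_op using L Suc.prems * subalg_lmult
        by (simp add: two_sided_ideal_def)
      then show ?thesis using Suc.IH[OF _ r commut_in_Dops[OF Suc.prems(3)]] by blast
    next
      case False
      then have "u = lmult (u 1)" using commuting_eq_lmult by blast
      then show ?thesis using Suc.prems lmult_eq_zero_iff[of "u 1"] by auto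
    qed
  qed
  obtain u where u: "u \<in> L" "u \<noteq> op_zero"
    using assms unfolding two_sided_ideal_def by blast
  then have "u \<in> Dalg \<phi>" using L subalg_sub unfolding two_sided_ideal_def by blast
  then obtain i where "u \<in> Dops \<phi> i" unfolding Dalg_def by blast
  with main u show ?thesis using that by blast
qed

end

section \<open>Products of ideals and the criterion for simplicity\<close>

lemma idl_gen_mult: "z \<in> idl_gen X \<Longrightarrow> a * z \<in> idl_gen X"
proof (induction rule: idl_gen.induct)
  case (gen x b)
  then show ?case using idl_gen.gen[of x X "a * b"] by (simp add: mult.assoc)
qed (auto intro: idl_gen.intros simp: distrib_left)

lemma idl_gen_base: "z \<in> X \<Longrightarrow> z \<in> idl_gen X"
  using idl_gen.gen[of z X 1] by simp

definition is_ideal :: "'a::comm_ring_1 set \<Rightarrow> bool" where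
  "is_ideal L \<longleftrightarrow> 0 \<in> L \<and> (\<forall>u\<in>L. \<forall>v\<in>L. u + v \<in> L) \<and> (\<forall>a. \<forall>u\<in>L. a * u \<in> L)"

lemma is_idealI:
  "0 \<in> L \<Longrightarrow> (\<And>u v. u \<in> L \<Longrightarrow> v \<in> L \<Longrightarrow> u + v \<in> L) \<Longrightarrow> (\<And>a u. u \<in> L \<Longrightarrow> a * u \<in> L) \<Longrightarrow> is_ideal L"
  by (simp add: is_ideal_def)

lemma is_ideal_idl_gen: "is_ideal (idl_gen X)"
  by (intro is_idealI idl_gen.zero idl_gen.add idl_gen_mult)

lemma idl_gen_least: "is_ideal L \<Longrightarrow> X \<subseteq> L \<Longrightarrow> idl_gen X \<subseteq> L"
proof
  fix z assume "is_ideal L" "X \<subseteq> L" "z \<in> idl_gen X"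
  from this(3,1,2) show "z \<in> L" by induction (auto simp: is_ideal_def)
qed

lemma is_ideal_quotient: "is_ideal L \<Longrightarrow> is_ideal {z. a * z \<in> L}"
  by (auto simp: is_ideal_def distrib_left mult.left_commute)

text \<open>This is the trace of \<open>L\<close> on the base ring. It moves questions about
  operators into commutative ideal theory: the saturation and pigeonhole arguments for the minors
  both run inside such a trace.\<close>

lemma ideal_lmult_preimage:
  assumes R: "subalg_containing_A \<phi> R" and L: "two_sided_ideal R L"
  shows "is_ideal {a :: 'a::idom. lmult a \<in> L}"
proof (rule is_idealI)
  have "lmult (0 :: 'a) = op_zero" by (simp add: lmult_eq_zero_iff)
  then show "0 \<in> {z. lmult z \<in> L}" using L by (simp add: two_sided_ideal_def)
  fix u v assume *: "u \<in> {z. lmult z \<in> L}"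
  have "lmult (c * u) = lmult c \<circ> lmult u" for c by (simp add: lmult_comp_lmult)
  then show "c * u \<in> {z. lmult z \<in> L}" for c
    using * L subalg_lmult[OF R, of c] by (auto simp: two_sided_ideal_def)
  assume "v \<in> {z. lmult z \<in> L}"
  moreover have "lmult (u + v) = op_add (lmult u) (lmult v)" by (auto simp: op_simps distrib_right)
  ultimately show "u + v \<in> {z. lmult z \<in> L}" using L * by (simp add: two_sided_ideal_def)
qed

lemma idl_mult_prod: "a \<in> I \<Longrightarrow> b \<in> J \<Longrightarrow> a * b \<in> idl_mult I J"
  unfolding idl_mult_def by (rule idl_gen_base) auto

text \<open>Peeling off a first factor \<open>p\<close> replaces \<open>L\<close> by the quotient
  ideal \<open>{z. p * z \<in> L}\<close>, which is why \<open>L\<close> varies in the induction.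
  Inclusions of products of ideals can thus be tested on products of elements.\<close>

lemma foldr_idl_mult_least:
  assumes "is_ideal L"
    and "\<And>ps q. list_all2 (\<in>) ps Is \<Longrightarrow> q \<in> K \<Longrightarrow> prod_list ps * q \<in> L"
  shows "foldr idl_mult Is K \<subseteq> L"
  using assms
proof (induction Is arbitrary: L)
  case Nil
  then show ?case by force
next
  case (Cons I Is)
  have "foldr idl_mult Is K \<subseteq> {z. p * z \<in> L}" if p: "p \<in> I" for p
  proof (rule Cons.IH)
    show "is_ideal {z. p * z \<in> L}" using Cons.prems(1) by (rule is_ideal_quotient)
    fix ps q assume "list_all2 (\<in>) ps Is" "q \<in> K"
    then show "prod_list ps * q \<in> {z. p * z \<in> L}"
      using Cons.prems(2)[of "p # ps" q] p by (simp add: mult.assoc)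
  qed
  then have "{a * b |a b. a \<in> I \<and> b \<in> foldr idl_mult Is K} \<subseteq> L" by auto
  then show ?case using idl_gen_least[OF Cons.prems(1)] by (simp add: idl_mult_def[of I] o_apply)
qed

lemma idl_pow_2_least:
  assumes "is_ideal L" "\<And>a b. a \<in> I \<Longrightarrow> b \<in> I \<Longrightarrow> a * b \<in> L"
  shows "idl_pow I 2 \<subseteq> L"
proof -
  \<comment> \<open>The recursion of \<open>idl_pow\<close> ends in the unit ideal, so an arbitrary
    factor \<open>q\<close> trails every product.\<close>
  have "idl_pow I 2 = foldr idl_mult [I, I] UNIV"
    by (simp add: numeral_2_eq_2 unit_idl_def o_apply)
  also have "\<dots> \<subseteq> L"
  proof (rule foldr_idl_mult_least[OF assms(1)])
    fix ps q assume "list_all2 (\<in>) ps [I, I]"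
    then obtain a b where "ps = [a, b]" "a \<in> I" "b \<in> I"
      by (auto simp: list_all2_Cons2)
    then have "q * (a * b) \<in> L" using assms by (auto simp: is_ideal_def)
    then show "prod_list ps * q \<in> L" using \<open>ps = [a, b]\<close> by (simp add: mult_ac)
  qed
  finally show ?thesis .
qed

lemma chain_prod_least:
  assumes "is_ideal L"
    and "\<And>ps a b. list_all2 (\<in>) ps (map I [1..<i]) \<Longrightarrow> a \<in> I i \<Longrightarrow> b \<in> I i \<Longrightarrow> prod_list ps * (a * b) \<in> L"
  shows "chain_prod I i \<subseteq> L"
  unfolding chain_prod_def
proof (rule foldr_idl_mult_least[OF assms(1)])
  fix ps q assume ps: "list_all2 (\<in>) ps (map I [1..<i])" and q: "q \<in> idl_pow (I i) 2"
  have "idl_pow (I i) 2 \<subseteq> {z. prod_list ps * z \<in> L}"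
    using assms(2)[OF ps] by (intro idl_pow_2_least is_ideal_quotient assms(1)) auto
  then show "prod_list ps * q \<in> L" using q by auto
qed

lemma idl_mult_commute: "idl_mult I J = idl_mult J I"
proof -
  have "{a * b |a b. a \<in> I \<and> b \<in> J} = {b * a |b a. b \<in> J \<and> a \<in> I}" using mult.commute by blast
  then show ?thesis by (simp add: idl_mult_def)
qed

text \<open>Of the two factors taken from \<open>I i\<close>, one completes the chain and carries it
  into \<open>K i\<close>, the other stays behind in \<open>I i\<close>. The families
  \<open>I\<close> and \<open>K\<close> will be the b- and c-ideals, in either order.\<close>

lemma chain_prod_subset_mult:
  assumes one: "1 \<in> K 0" and step: "\<And>i p b. p \<in> K i \<Longrightarrow> b \<in> I (Suc i) \<Longrightarrow> p * b \<in> K (Suc i)" and "i \<ge> 1"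
  shows "chain_prod I i \<subseteq> idl_mult (I i) (K i)"
proof (rule chain_prod_least)
  have K: "list_all2 (\<in>) ps (map I [1..<Suc i]) \<Longrightarrow> prod_list ps \<in> K i" for ps i
  proof (induction i arbitrary: ps)
    case 0
    then show ?case using one by simp
  next
    case (Suc i)
    then obtain qs b where "ps = qs @ [b]" "b \<in> I (Suc i)" "list_all2 (\<in>) qs (map I [1..<Suc i])"
      by (auto simp: list_all2_append2 list_all2_Cons2)
    then show ?case using Suc.IH step by simp
  qed
  show "is_ideal (idl_mult (I i) (K i))" by (simp add: idl_mult_def is_ideal_idl_gen)
  fix ps a b assume "list_all2 (\<in>) ps (map I [1..<i])" and ab: "a \<in> I i" "b \<in> I i"
  then have "list_all2 (\<in>) (ps @ [b]) (map I [1..<Suc i])"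
    using assms(3) by (simp add: list_all2_appendI)
  then have "a * prod_list (ps @ [b]) \<in> idl_mult (I i) (K i)" using ab(1) by (intro idl_mult_prod K)
  then show "prod_list ps * (a * b) \<in> idl_mult (I i) (K i)" by (simp add: mult_ac)
qed

lemma idl_mult_nonzero:
  assumes "\<exists>a\<in>I. a \<noteq> (0::'a::idom)" "\<exists>b\<in>J. b \<noteq> 0"
  shows "\<exists>z\<in>idl_mult I J. z \<noteq> 0"
  using assms idl_mult_prod by (metis mult_eq_0_iff)

lemma idl_pow_nonzero:
  assumes "\<exists>a\<in>I. a \<noteq> (0::'a::idom)"
  shows "\<exists>z\<in>idl_pow I i. z \<noteq> 0"
  using assms by (induction i) (auto simp: unit_idl_def intro!: idl_mult_nonzero exI[of _ 1])

lemma chain_prod_nonzero: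
  assumes "\<And>j. \<exists>a\<in>I j. a \<noteq> (0::'a::idom)"
  shows "\<exists>z\<in>chain_prod I i. z \<noteq> 0"
proof -
  have "\<exists>z\<in>foldr idl_mult (map I js) (idl_pow (I i) 2). z \<noteq> 0" for js
    using assms by (induction js) (auto simp: o_apply intro!: idl_mult_nonzero idl_pow_nonzero)
  then show ?thesis by (simp add: chain_prod_def)
qed

text \<open>This puts the power \<open>Suc i\<close> of an element of \<open>\<bb>\<^sub>i\<close> into \<open>\<cc>\<^sub>i\<close>.\<close>

lemma Dops_comp_lmult_power:
  assumes "u \<in> Dops \<phi> i"
  shows "\<exists>w\<in>Dops \<phi> i. u \<circ> lmult (a ^ Suc i) = lmult a \<circ> w"
  using assms
proof (induction i arbitrary: u)
  case 0
  have "u \<circ> lmult (a ^ Suc 0) = lmult a \<circ> u"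
    by (subst (1 2) Dops_0_eq_lmult[OF 0]) (auto simp: op_simps mult_ac)
  then show ?case using 0 by blast
next
  case (Suc i)
  obtain w where w: "w \<in> Dops \<phi> i" "commut a u \<circ> lmult (a ^ Suc i) = lmult a \<circ> w"
    using Suc.IH[OF commut_in_Dops[OF Suc.prems]] by blast
  \<comment> \<open>One factor \<open>a\<close> is moved to the left of \<open>u\<close>. The
    commutator has order \<open>i\<close> and still carries \<open>a ^ Suc i\<close> on its right,
    so the induction hypothesis extracts an \<open>a\<close> from it as well.\<close>
  have "u (a * z) = a * u z - commut a u z" for z by (simp add: op_simps)
  then have "u \<circ> lmult (a ^ Suc (Suc i)) =
      op_add (lmult a \<circ> (u \<circ> lmult (a ^ Suc i))) (lmult (- 1) \<circ> (commut a u \<circ> lmult (a ^ Suc i)))"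
    by (auto simp: op_simps mult.assoc)
  also have "\<dots> = lmult a \<circ> op_add (u \<circ> lmult (a ^ Suc i)) (lmult (- 1) \<circ> w)"
    unfolding w(2) by (auto simp: op_simps algebra_simps)
  finally show ?case
    using op_add_in_Dops lmult_comp_in_Dops comp_lmult_in_Dops Suc.prems Dops_Suc_mono[OF w(1)]
    by blast
qed

section \<open>The ideals b_i and c_i, and simplicity of R versus D(A)\<close>

context
  fixes \<phi> :: "'k::field \<Rightarrow> 'a::idom" and R
  assumes R: "subalg_containing_A \<phi> R"
begin

lemma bideal_iff: "a \<in> bideal \<phi> R i \<longleftrightarrow> (\<forall>u\<in>Dops \<phi> i. lmult a \<circ> u \<in> R)"
  by (auto simp: bideal_def Rlev_def lmult_comp_in_Dops)

lemma cideal_iff: "a \<in> cideal \<phi> R i \<longleftrightarrow> (\<forall>u\<in>Dops \<phi> i. u \<circ> lmult a \<in> R)"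
  by (auto simp: cideal_def Rlev_def comp_lmult_in_Dops)

lemma cideal_nonzero_if_bideal_nonzero:
  assumes "a \<in> bideal \<phi> R i" "a \<noteq> 0"
  shows "\<exists>b\<in>cideal \<phi> R i. b \<noteq> 0"
proof -
  have "a ^ Suc i \<in> cideal \<phi> R i"
    unfolding cideal_iff using Dops_comp_lmult_power[of _ \<phi> i a] assms(1) by (metis bideal_iff)
  then show ?thesis using assms(2) by (metis power_not_zero)
qed

text \<open>Write \<open>v p b = (b v) p - [b, v] p\<close>. The choice of \<open>b\<close> puts
  \<open>b v\<close> into \<open>R\<close>; the commutator has order \<open>i\<close>, so
  \<open>p\<close> takes care of it. Iteration carries a product of elements of the first
  \<open>i\<close> b-ideals into the \<open>i\<close>-th c-ideal.\<close>

lemma cideal_step: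
  assumes p: "p \<in> cideal \<phi> R i" and b: "b \<in> bideal \<phi> R (Suc i)"
  shows "p * b \<in> cideal \<phi> R (Suc i)"
  unfolding cideal_iff
proof
  fix v assume v: "v \<in> Dops \<phi> (Suc i)"
  have "v (b * z) = b * v z - commut b v z" for z by (simp add: op_simps)
  then have "v \<circ> lmult (p * b) =
      op_add (lmult b \<circ> v \<circ> lmult p) (lmult (- 1) \<circ> (commut b v \<circ> lmult p))"
    by (simp add: op_simps mult_ac)
  moreover have "lmult b \<circ> v \<in> R" "commut b v \<circ> lmult p \<in> R"
    using b p v commut_in_Dops[OF v] by (auto simp: bideal_iff cideal_iff)
  ultimately show "v \<circ> lmult (p * b) \<in> R"
    by (metis subalg_comp[OF R] subalg_lmult[OF R] subalg_add[OF R])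
qed

text \<open>The mirror image, from \<open>p b v = p (v b) + p [b, v]\<close>.\<close>

lemma bideal_step:
  assumes p: "p \<in> bideal \<phi> R i" and b: "b \<in> cideal \<phi> R (Suc i)"
  shows "p * b \<in> bideal \<phi> R (Suc i)"
  unfolding bideal_iff
proof
  fix v assume v: "v \<in> Dops \<phi> (Suc i)"
  have "lmult (p * b) \<circ> v = op_add (lmult p \<circ> (v \<circ> lmult b)) (lmult p \<circ> commut b v)"
    by (simp add: op_simps algebra_simps)
  moreover have "v \<circ> lmult b \<in> R" "lmult p \<circ> commut b v \<in> R"
    using b p v commut_in_Dops[OF v] by (auto simp: bideal_iff cideal_iff)
  ultimately show "lmult (p * b) \<circ> v \<in> R"
    by (metis subalg_comp[OF R] subalg_lmult[OF R] subalg_add[OF R])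
qed

text \<open>Operators of order 0 are multiplications and lie in \<open>R\<close>. Index 0 serves as
  the starting point for iterating the two preceding steps.\<close>

lemma one_in_ideals_0: "1 \<in> cideal \<phi> R 0" "1 \<in> bideal \<phi> R 0"
  unfolding bideal_iff cideal_iff
  by (metis Dops_0_eq_lmult lmult_comp_lmult subalg_lmult[OF R])+

lemma chain_prod_bideal_subset:
  "i \<ge> 1 \<Longrightarrow> chain_prod (bideal \<phi> R) i \<subseteq> idl_mult (bideal \<phi> R i) (cideal \<phi> R i)"
  by (rule chain_prod_subset_mult[OF one_in_ideals_0(1) cideal_step])

lemma chain_prod_cideal_subset:
  "i \<ge> 1 \<Longrightarrow> chain_prod (cideal \<phi> R) i \<subseteq> idl_mult (bideal \<phi> R i) (cideal \<phi> R i)"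
  unfolding idl_mult_commute[of "bideal \<phi> R i"]
  by (rule chain_prod_subset_mult[OF one_in_ideals_0(2) bideal_step])

text \<open>The finitely many factors occurring in \<open>w\<close> have bounded order. From the
  bound on, \<open>b\<close> and \<open>c\<close> absorb them into \<open>R\<close>, and
  \<open>(b u) a (v c)\<close> lies in \<open>L\<close>. The bound is stated for all later
  \<open>j\<close> so that two summands can share an index.\<close>

lemma sandwich_Dalg_into_ideal:
  assumes L: "two_sided_ideal R L" and a: "lmult a \<in> L"
    and "w \<in> sandwich (Dalg \<phi>) {a}"
  shows "\<exists>i. \<forall>j\<ge>i. \<forall>b\<in>bideal \<phi> R j. \<forall>c\<in>cideal \<phi> R j. lmult b \<circ> w \<circ> lmult c \<in> L"
  using assms(3)
proof induction
  case zero
  have "lmult b \<circ> op_zero \<circ> lmult c = op_zero" for b c :: 'a by (auto simp: op_simps)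
  then show ?case using L by (auto simp: two_sided_ideal_def)
next
  case (gen u v a')
  obtain k l where kl: "u \<in> Dops \<phi> k" "v \<in> Dops \<phi> l" using gen by (auto simp: Dalg_def)
  have "lmult b \<circ> (u \<circ> lmult a' \<circ> v) \<circ> lmult c \<in> L"
    if j: "j \<ge> max k l" and b: "b \<in> bideal \<phi> R j" and c: "c \<in> cideal \<phi> R j" for j b c
  proof -
    have "u \<in> Dops \<phi> j" "v \<in> Dops \<phi> j" using kl Dops_mono j by fastforce+
    then have "lmult b \<circ> u \<in> R" "v \<circ> lmult c \<in> R" using b c by (auto simp: bideal_iff cideal_iff)
    then have "(lmult b \<circ> u) \<circ> lmult a' \<circ> (v \<circ> lmult c) \<in> L"
      using L a gen(3) unfolding two_sided_ideal_def by blast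
    then show ?thesis by (simp add: comp_assoc)
  qed
  then show ?case by blast
next
  case (add u v)
  then obtain i i' where
    i: "\<forall>j\<ge>i. \<forall>b\<in>bideal \<phi> R j. \<forall>c\<in>cideal \<phi> R j. lmult b \<circ> u \<circ> lmult c \<in> L" and
    i': "\<forall>j\<ge>i'. \<forall>b\<in>bideal \<phi> R j. \<forall>c\<in>cideal \<phi> R j. lmult b \<circ> v \<circ> lmult c \<in> L" by blast
  have "lmult b \<circ> op_add u v \<circ> lmult c = op_add (lmult b \<circ> u \<circ> lmult c) (lmult b \<circ> v \<circ> lmult c)"
    for b c by (auto simp: op_simps distrib_left)
  then show ?case using i i' L unfolding two_sided_ideal_def
    by (intro exI[of _ "max i i'"]) auto
qed

text \<open>With \<open>w = 1\<close> the preceding lemma places every product \<open>b c\<close> of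
  a late index in \<open>L\<close>. The family \<open>X\<close> is abstract so that the argument
  covers the products of b- and c-ideals and both kinds of chains.\<close>

lemma simple_if_Dalg_simple:
  assumes D: "simple_ring (Dalg \<phi>)"
    and X: "\<And>i. i \<ge> 1 \<Longrightarrow> sandwich R (X i) = R"
    and Xsub: "\<And>i. i \<ge> 1 \<Longrightarrow> X i \<subseteq> idl_mult (bideal \<phi> R i) (cideal \<phi> R i)"
  shows "simple_ring R"
proof (rule simple_ringI[OF R])
  fix L assume L: "two_sided_ideal R L" and "L \<noteq> {op_zero}"
  then obtain a where a: "a \<noteq> 0" "lmult a \<in> L" using ideal_contains_lmult[OF R] by blast
  have "sandwich (Dalg \<phi>) {a} = Dalg \<phi>"
    using simple_sandwich[OF subalg_Dalg D] a by blast
  then have "lmult 1 \<in> sandwich (Dalg \<phi>) {a}" using subalg_lmult[OF subalg_Dalg] by blast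
  from sandwich_Dalg_into_ideal[OF L a(2) this] obtain i where
    i: "\<And>j b c. j \<ge> i \<Longrightarrow> b \<in> bideal \<phi> R j \<Longrightarrow> c \<in> cideal \<phi> R j \<Longrightarrow> lmult b \<circ> lmult 1 \<circ> lmult c \<in> L"
    by blast
  \<comment> \<open>The hypotheses on \<open>X\<close> start at index 1, whereas the bound
    \<open>i\<close> may be 0.\<close>
  define j where "j = Suc i"
  have "is_ideal {z. lmult z \<in> L}" by (rule ideal_lmult_preimage[OF R L])
  moreover have "{b * c |b c. b \<in> bideal \<phi> R j \<and> c \<in> cideal \<phi> R j} \<subseteq> {z. lmult z \<in> L}"
    using i[of j] by (auto simp: j_def lmult_comp_lmult)
  ultimately have "idl_mult (bideal \<phi> R j) (cideal \<phi> R j) \<subseteq> {z. lmult z \<in> L}"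
    unfolding idl_mult_def by (rule idl_gen_least)
  then have "X j \<subseteq> {z. lmult z \<in> L}" using Xsub[of j] by (simp add: j_def)
  then show "L = R" using ideal_eq_if_sandwich[OF R L X[of j]] by (auto simp: j_def)
qed

lemma Dalg_simple_if_simple:
  assumes ess: "essential_left_A_submodule (Dalg \<phi>) R" and "simple_ring R"
  shows "simple_ring (Dalg \<phi>)"
proof (rule simple_ringI[OF subalg_Dalg])
  fix L assume L: "two_sided_ideal (Dalg \<phi>) L" and "L \<noteq> {op_zero}"
  have "left_A_submodule (Dalg \<phi>) L"
    using L subalg_lmult[OF subalg_Dalg] unfolding two_sided_ideal_def left_A_submodule_def by blast
  then have "L \<inter> R \<noteq> {op_zero}"
    using ess \<open>L \<noteq> {op_zero}\<close> by (auto simp: essential_left_A_submodule_def)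
  moreover have "two_sided_ideal R (L \<inter> R)"
  proof -
    have "op_neg u = lmult (- 1) \<circ> u" for u :: "'a \<Rightarrow> 'a" by (auto simp: op_simps)
    then have "op_neg u \<in> R" if "u \<in> R" for u
      using that subalg_lmult[OF R] subalg_comp[OF R] by metis
    moreover have "op_zero \<in> R" using ess by (simp add: essential_left_A_submodule_def left_A_submodule_def)
    ultimately show ?thesis
      using L subalg_sub[OF R] subalg_add[OF R] subalg_comp[OF R] unfolding two_sided_ideal_def by auto
  qed
  ultimately have "L \<inter> R = R" using assms(2) by (auto simp: simple_ring_def)
  then have "lmult 1 \<in> L" using subalg_lmult[OF R] by blast
  then show "L = Dalg \<phi>" using ideal_eq_if_one[OF subalg_Dalg L] by blast
qed

end

section \<open>Subrings and homomorphisms defined on them\<close>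

definition subring_set :: "'a::comm_ring_1 set \<Rightarrow> bool" where
  "subring_set S \<longleftrightarrow> 1 \<in> S \<and> (\<forall>a\<in>S. - a \<in> S) \<and> (\<forall>a\<in>S. \<forall>b\<in>S. a + b \<in> S \<and> a * b \<in> S)"

text \<open>The function is total and constrained only on \<open>S\<close>. A homomorphism can thus
  be extended step by step through subrings of one fixed domain without a type for each intermediate
  ring.\<close>

definition hom_on :: "'a::comm_ring_1 set \<Rightarrow> ('a \<Rightarrow> 'b::comm_ring_1) \<Rightarrow> bool" where
  "hom_on S h \<longleftrightarrow> h 1 = 1 \<and> (\<forall>a\<in>S. \<forall>b\<in>S. h (a + b) = h a + h b \<and> h (a * b) = h a * h b)"

lemma subring_setD:
  assumes "subring_set S"
  shows "1 \<in> S" "0 \<in> S" "a \<in> S \<Longrightarrow> - a \<in> S" "a \<in> S \<Longrightarrow> b \<in> S \<Longrightarrow> a + b \<in> S"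
    "a \<in> S \<Longrightarrow> b \<in> S \<Longrightarrow> a - b \<in> S" "a \<in> S \<Longrightarrow> b \<in> S \<Longrightarrow> a * b \<in> S"
proof -
  have *: "1 \<in> S" "\<And>a. a \<in> S \<Longrightarrow> - a \<in> S" "\<And>a b. a \<in> S \<Longrightarrow> b \<in> S \<Longrightarrow> a + b \<in> S"
      "\<And>a b. a \<in> S \<Longrightarrow> b \<in> S \<Longrightarrow> a * b \<in> S"
    using assms by (auto simp: subring_set_def)
  then show "1 \<in> S" "a \<in> S \<Longrightarrow> - a \<in> S" "a \<in> S \<Longrightarrow> b \<in> S \<Longrightarrow> a + b \<in> S"
     "a \<in> S \<Longrightarrow> b \<in> S \<Longrightarrow> a * b \<in> S" by auto
  show "0 \<in> S" using *(3)[OF *(1) *(2)[OF *(1)]] by simp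
  show "a \<in> S \<Longrightarrow> b \<in> S \<Longrightarrow> a - b \<in> S" using *(3)[OF _ *(2), of a b] by simp
qed

lemma subring_sum: "subring_set S \<Longrightarrow> (\<And>i. i \<in> I \<Longrightarrow> g i \<in> S) \<Longrightarrow> sum g I \<in> S"
  by (induction I rule: infinite_finite_induct) (auto intro: subring_setD)

lemma subring_prod: "subring_set S \<Longrightarrow> (\<And>i. i \<in> I \<Longrightarrow> g i \<in> S) \<Longrightarrow> prod g I \<in> S"
  by (induction I rule: infinite_finite_induct) (auto intro: subring_setD)

lemma subring_power: "subring_set S \<Longrightarrow> a \<in> S \<Longrightarrow> a ^ k \<in> S"
  by (induction k) (auto intro: subring_setD)

lemma hom_onD:
  assumes "hom_on S h"
  shows "h 1 = 1" "a \<in> S \<Longrightarrow> b \<in> S \<Longrightarrow> h (a + b) = h a + h b"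
    "a \<in> S \<Longrightarrow> b \<in> S \<Longrightarrow> h (a * b) = h a * h b"
  using assms by (auto simp: hom_on_def)

lemma hom_on_0: "subring_set S \<Longrightarrow> hom_on S h \<Longrightarrow> h 0 = 0"
  using hom_onD(2)[of S h 0 0] by (simp add: subring_setD)

lemma hom_on_sum:
  assumes "subring_set S" "hom_on S h" "\<And>i. i \<in> I \<Longrightarrow> g i \<in> S"
  shows "h (sum g I) = (\<Sum>i\<in>I. h (g i))"
  using assms(3)
  by (induction I rule: infinite_finite_induct)
    (auto simp: hom_on_0[OF assms(1,2)] hom_onD[OF assms(2)] subring_sum[OF assms(1)])

lemma hom_on_prod:
  assumes "subring_set S" "hom_on S h" "\<And>i. i \<in> I \<Longrightarrow> g i \<in> S"
  shows "h (prod g I) = (\<Prod>i\<in>I. h (g i))"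
  using assms(3)
  by (induction I rule: infinite_finite_induct)
    (auto simp: hom_onD[OF assms(2)] subring_prod[OF assms(1)])

lemma hom_on_power:
  assumes "subring_set S" "hom_on S h" "a \<in> S"
  shows "h (a ^ k) = h a ^ k"
  by (induction k) (auto simp: hom_onD[OF assms(2)] assms subring_power)

lemma alg_struct_hom_on: "alg_struct \<phi> \<Longrightarrow> hom_on UNIV \<phi>"
  by (auto simp: alg_struct_def hom_on_def)

lemma subring_UNIV: "subring_set UNIV"
  by (simp add: subring_set_def)

lemmas alg_structD = hom_onD[OF alg_struct_hom_on, simplified] hom_on_0[OF subring_UNIV alg_struct_hom_on]

lemma alg_struct_of_nat: "alg_struct \<phi> \<Longrightarrow> \<phi> (of_nat k) = of_nat k"
  by (induction k) (auto simp: alg_structD)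

lemma alg_struct_eq_0_iff:
  assumes "alg_struct (\<phi> :: 'k::field \<Rightarrow> 'a::comm_ring_1)" "(1 :: 'a) \<noteq> 0"
  shows "\<phi> c = 0 \<longleftrightarrow> c = 0"
proof
  assume "\<phi> c = 0"
  show "c = 0"
  proof (rule ccontr)
    assume "c \<noteq> 0"
    then have "\<phi> c * \<phi> (inverse c) = 1" using assms(1) by (simp add: alg_structD flip: alg_structD(3))
    with \<open>\<phi> c = 0\<close> assms(2) show False by simp
  qed
qed (simp add: alg_structD[OF assms(1)])

lemma alg_struct_comp: "alg_struct \<phi> \<Longrightarrow> hom_on UNIV h \<Longrightarrow> alg_struct (\<lambda>c. h (\<phi> c))"
  by (simp add: alg_struct_def hom_on_def)

section \<open>Evaluation of multivariate polynomials\<close>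

abbreviation "lookup \<equiv> Poly_Mapping.lookup"
abbreviation "keys \<equiv> Poly_Mapping.keys"
abbreviation "single \<equiv> Poly_Mapping.single"

definition mono_val :: "(nat \<Rightarrow> 'a::comm_ring_1) \<Rightarrow> (nat \<Rightarrow>\<^sub>0 nat) \<Rightarrow> 'a" where
  "mono_val x t = (\<Prod>j\<in>keys t. x j ^ lookup t j)"

lemma mono_val_superset:
  assumes "finite V" "keys t \<subseteq> V"
  shows "mono_val x t = (\<Prod>j\<in>V. x j ^ lookup t j)"
  unfolding mono_val_def
  by (rule prod.mono_neutral_left) (use assms in \<open>auto simp: in_keys_iff\<close>)

lemma mono_val_0 [simp]: "mono_val x 0 = 1"
  by (simp add: mono_val_def)

lemma mono_val_add: "mono_val x (a + b) = mono_val x a * mono_val x b"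
proof -
  let ?V = "keys a \<union> keys b"
  have "keys (a + b) \<subseteq> ?V" by (rule keys_add)
  then show ?thesis
    by (simp add: mono_val_superset[of ?V] lookup_add power_add prod.distrib)
qed

text \<open>Variable sets other than initial segments are needed for polynomials in the free
  coordinates.\<close>

definition poly_vars_in :: "nat set \<Rightarrow> 'k::zero kpoly \<Rightarrow> bool" where
  "poly_vars_in V p \<longleftrightarrow> (\<forall>t\<in>keys p. keys t \<subseteq> V)"

lemma in_Pn_iff: "in_Pn n p \<longleftrightarrow> poly_vars_in {..<n} p"
  by (simp add: in_Pn_def poly_vars_in_def)

lemma poly_vars_in_mono: "V \<subseteq> W \<Longrightarrow> poly_vars_in V p \<Longrightarrow> poly_vars_in W p"
  by (auto simp: poly_vars_in_def)

lemma poly_vars_in_single: "keys t \<subseteq> V \<Longrightarrow> poly_vars_in V (single t c)"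
  by (simp add: poly_vars_in_def)

lemma poly_vars_in_add: "poly_vars_in V p \<Longrightarrow> poly_vars_in V q \<Longrightarrow> poly_vars_in V (p + q)"
  unfolding poly_vars_in_def using keys_add[of p q] by (meson UnE subsetD)

lemma poly_vars_in_0: "poly_vars_in V 0"
  by (simp add: poly_vars_in_def)

lemma poly_vars_in_1: "poly_vars_in V (1 :: 'k::comm_ring_1 kpoly)"
  by (simp add: poly_vars_in_def)

lemma poly_vars_in_uminus: "poly_vars_in V p \<Longrightarrow> poly_vars_in V (- p :: 'k::comm_ring_1 kpoly)"
  by (simp add: poly_vars_in_def)

lemma poly_vars_in_mult:
  "poly_vars_in V p \<Longrightarrow> poly_vars_in V q \<Longrightarrow> poly_vars_in V (p * q :: 'k::comm_ring_1 kpoly)"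
  unfolding poly_vars_in_def
proof
  fix t assume pq: "\<forall>m\<in>keys p. keys m \<subseteq> V" "\<forall>m\<in>keys q. keys m \<subseteq> V"
    and "t \<in> keys (p * q)"
  then obtain a b where "t = a + b" "a \<in> keys p" "b \<in> keys q"
    using keys_mult[of p q] by auto
  then show "keys t \<subseteq> V" using pq keys_add[of a b] by blast
qed

lemma poly_vars_in_sum: "(\<And>i. i \<in> I \<Longrightarrow> poly_vars_in V (g i)) \<Longrightarrow> poly_vars_in V (sum g I)"
  by (induction I rule: infinite_finite_induct) (auto simp: poly_vars_in_0 poly_vars_in_add)

lemma eval_mpoly_superset:
  assumes "alg_struct \<phi>" "finite M" "keys p \<subseteq> M"
  shows "eval_mpoly \<phi> x p = (\<Sum>t\<in>M. \<phi> (lookup p t) * mono_val x t)"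
  unfolding eval_mpoly_def mono_val_def
  by (rule sum.mono_neutral_left) (use assms in \<open>auto simp: in_keys_iff alg_structD\<close>)

lemma eval_mpoly_eq: "eval_mpoly \<phi> x p = (\<Sum>t\<in>keys p. \<phi> (lookup p t) * mono_val x t)"
  by (simp add: eval_mpoly_def mono_val_def)

lemma poly_eq_sum_single: "p = (\<Sum>t\<in>keys p. single t (lookup p t))"
proof (rule poly_mapping_eqI)
  fix k
  have "lookup p k = (\<Sum>t\<in>keys p. if t = k then lookup p t else 0)"
    by (simp add: in_keys_iff)
  then show "lookup p k =
      lookup (\<Sum>t\<in>keys p. single t (lookup p t)) k"
    by (simp add: lookup_sum lookup_single when_def)
qed

context
  fixes \<phi> :: "'k::field \<Rightarrow> 'a::comm_ring_1"
  assumes alg: "alg_struct \<phi>"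
begin

lemma eval_0: "eval_mpoly \<phi> x 0 = 0"
  by (simp add: eval_mpoly_def)

lemma eval_single: "eval_mpoly \<phi> x (single t c) = \<phi> c * mono_val x t"
  by (cases "c = 0") (auto simp: eval_mpoly_eq alg_structD[OF alg])

lemma eval_1: "eval_mpoly \<phi> x 1 = 1"
  using eval_single[of x 0 1] by (simp add: alg_structD[OF alg])

lemma eval_add: "eval_mpoly \<phi> x (p + q) = eval_mpoly \<phi> x p + eval_mpoly \<phi> x q"
proof -
  let ?M = "keys p \<union> keys q"
  have "keys (p + q) \<subseteq> ?M" by (rule keys_add)
  then show ?thesis
    by (simp add: eval_mpoly_superset[OF alg, of ?M] lookup_add alg_structD[OF alg] distrib_right sum.distrib)
qed

lemma eval_sum: "eval_mpoly \<phi> x (sum g I) = (\<Sum>i\<in>I. eval_mpoly \<phi> x (g i))"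
  by (induction I rule: infinite_finite_induct) (auto simp: eval_0 eval_add)

lemma eval_mult: "eval_mpoly \<phi> x (p * q) = eval_mpoly \<phi> x p * eval_mpoly \<phi> x q"
proof -
  let ?s = "\<lambda>p m. single m (lookup p m) :: 'k kpoly"
  have "eval_mpoly \<phi> x (?s p m * ?s q l) = eval_mpoly \<phi> x (?s p m) * eval_mpoly \<phi> x (?s q l)" for m l
    by (simp add: mult_single eval_single mono_val_add alg_structD[OF alg] mult_ac)
  then have "eval_mpoly \<phi> x ((\<Sum>m\<in>keys p. ?s p m) * (\<Sum>l\<in>keys q. ?s q l)) =
     eval_mpoly \<phi> x (\<Sum>m\<in>keys p. ?s p m) * eval_mpoly \<phi> x (\<Sum>l\<in>keys q. ?s q l)"
    by (simp add: sum_product eval_sum)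
  then show ?thesis by (simp flip: poly_eq_sum_single)
qed

lemma eval_uminus: "eval_mpoly \<phi> x (- p) = - eval_mpoly \<phi> x p"
  using eval_add[of x p "- p"] eval_0[of x] by (simp add: eq_neg_iff_add_eq_0 add.commute)

lemma eval_diff: "eval_mpoly \<phi> x (p - q) = eval_mpoly \<phi> x p - eval_mpoly \<phi> x q"
  using eval_add[of x p "- q"] by (simp add: eval_uminus)

lemma eval_cong: "(\<And>j. j \<in> V \<Longrightarrow> x j = y j) \<Longrightarrow> poly_vars_in V p \<Longrightarrow> eval_mpoly \<phi> x p = eval_mpoly \<phi> y p"
  unfolding eval_mpoly_def poly_vars_in_def
  by (intro sum.cong refl arg_cong2[of _ _ _ _ "(*)"] prod.cong arg_cong2[of _ _ _ _ "(^)"]) blast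

lemma eval_in_subring:
  assumes "subring_set S" "\<And>c. \<phi> c \<in> S" "\<And>j. j \<in> V \<Longrightarrow> x j \<in> S" "poly_vars_in V p"
  shows "eval_mpoly \<phi> x p \<in> S"
  unfolding eval_mpoly_def using assms(4)
  by (intro subring_sum subring_setD subring_prod subring_power assms) (auto simp: poly_vars_in_def)

lemma eval_var: "eval_mpoly \<phi> x (single (single j (Suc 0)) 1) = x j"
  by (simp add: eval_single mono_val_def alg_structD[OF alg])

lemma eval_hom_on:
  assumes S: "subring_set S" "\<And>c. \<phi> c \<in> S" "\<And>j. j \<in> V \<Longrightarrow> x j \<in> S" "poly_vars_in V p"
    and h: "hom_on S h"
  shows "h (eval_mpoly \<phi> x p) = eval_mpoly (\<lambda>c. h (\<phi> c)) (\<lambda>j. h (x j)) p"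
proof -
  have x: "x j \<in> S" if "t \<in> keys p" "j \<in> keys t" for t j
    using that S by (auto simp: poly_vars_in_def)
  have "h (eval_mpoly \<phi> x p) = (\<Sum>t\<in>keys p. h (\<phi> (lookup p t) *
      (\<Prod>j\<in>keys t. x j ^ lookup t j)))"
    unfolding eval_mpoly_def
    by (rule hom_on_sum[OF S(1) h]) (intro subring_setD subring_prod subring_power S x)
  also have "\<dots> = eval_mpoly (\<lambda>c. h (\<phi> c)) (\<lambda>j. h (x j)) p"
    unfolding eval_mpoly_def
  proof (rule sum.cong)
    fix t assume t: "t \<in> keys p"
    have "h (\<Prod>j\<in>keys t. x j ^ lookup t j) =
        (\<Prod>j\<in>keys t. h (x j) ^ lookup t j)"
      by (subst hom_on_prod[OF S(1) h])
        (auto intro!: subring_power S(1) x[OF t] prod.cong simp: hom_on_power[OF S(1) h x[OF t]])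
    moreover have "(\<Prod>j\<in>keys t. x j ^ lookup t j) \<in> S"
      by (intro subring_prod subring_power S x[OF t])
    ultimately show "h (\<phi> (lookup p t) * (\<Prod>j\<in>keys t. x j ^ lookup t j)) =
      h (\<phi> (lookup p t)) * (\<Prod>j\<in>keys t. h (x j) ^ lookup t j)"
      by (simp add: hom_onD(3)[OF h] S(2))
  qed simp
  finally show ?thesis .
qed

lemma eval_hom: "hom_on UNIV h \<Longrightarrow> h (eval_mpoly \<phi> x p) = eval_mpoly (\<lambda>c. h (\<phi> c)) (\<lambda>j. h (x j)) p"
  using eval_hom_on[OF subring_UNIV, of UNIV] by (simp add: poly_vars_in_def)

end

section \<open>Taylor expansion to first order\<close>

lemma power_taylor:
  fixes u :: "'a::comm_ring_1"
  shows "\<exists>w. (u + e * y) ^ k = u ^ k + e * (of_nat k * u ^ (k - 1) * y) + e\<^sup>2 * w"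
proof (induction k)
  case 0
  show ?case by (auto intro: exI[of _ 0])
next
  case (Suc k)
  then obtain w where w: "(u + e * y) ^ k = u ^ k + e * (of_nat k * u ^ (k - 1) * y) + e\<^sup>2 * w" by blast
  \<comment> \<open>For \<open>k = 0\<close> the truncated exponent does no harm because the
    coefficient vanishes.\<close>
  have *: "of_nat k * u ^ (k - 1) * u = of_nat k * u ^ k" by (cases k) auto
  have "(u + e * y) ^ Suc k = u ^ Suc k + e * (u ^ k * y + (of_nat k * u ^ (k - 1) * u) * y)
     + e\<^sup>2 * (of_nat k * u ^ (k - 1) * y * y + w * (u + e * y))"
    unfolding power_Suc w by (simp add: algebra_simps power2_eq_square)
  moreover have "u ^ k * y + of_nat k * u ^ k * y = of_nat (Suc k) * u ^ (Suc k - 1) * y"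
    by (simp add: algebra_simps)
  ultimately show ?case unfolding * by metis
qed

lemma prod_taylor:
  fixes A B w :: "nat \<Rightarrow> 'a::comm_ring_1"
  assumes "finite V"
  shows "\<exists>v. (\<Prod>j\<in>V. A j + e * B j + e\<^sup>2 * w j) = prod A V + e * (\<Sum>j\<in>V. B j * prod A (V - {j})) + e\<^sup>2 * v"
  using assms
proof induction
  case empty
  show ?case by (auto intro: exI[of _ 0])
next
  case (insert i V)
  then obtain v where v: "(\<Prod>j\<in>V. A j + e * B j + e\<^sup>2 * w j) =
     prod A V + e * (\<Sum>j\<in>V. B j * prod A (V - {j})) + e\<^sup>2 * v" by blast
  have "prod A (insert i V - {j}) = A i * prod A (V - {j})" if "j \<in> V" for j
  proof -
    have "insert i V - {j} = insert i (V - {j})" using that insert by auto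
    then show ?thesis using insert by simp
  qed
  then have s: "(\<Sum>j\<in>insert i V. B j * prod A (insert i V - {j})) =
     B i * prod A V + A i * (\<Sum>j\<in>V. B j * prod A (V - {j}))"
    using insert by (simp add: sum_distrib_left mult_ac)
  have "(\<Prod>j\<in>insert i V. A j + e * B j + e\<^sup>2 * w j) =
     prod A (insert i V) + e * (B i * prod A V + A i * (\<Sum>j\<in>V. B j * prod A (V - {j}))) +
     e\<^sup>2 * (w i * (\<Prod>j\<in>V. A j + e * B j + e\<^sup>2 * w j) + A i * v + B i * (\<Sum>j\<in>V. B j * prod A (V - {j})) + e * B i * v)"
    using insert unfolding prod.insert[OF insert(1,2)] v by (simp add: algebra_simps power2_eq_square)
  then show ?case unfolding s by blast
qed

lemma mono_val_minus_single:
  assumes "finite V" "keys t \<subseteq> V" "j \<in> V" 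
  shows "mono_val u (t - single j 1) =
    u j ^ (lookup t j - 1) * (\<Prod>i\<in>V - {j}. u i ^ lookup t i)"
proof -
  have "keys (t - single j 1) \<subseteq> V"
    using assms(2) by (auto simp: in_keys_iff lookup_minus)
  then have "mono_val u (t - single j 1) =
      (\<Prod>i\<in>V. u i ^ lookup (t - single j 1) i)"
    using assms(1) by (intro mono_val_superset)
  also have "\<dots> = u j ^ (lookup t j - 1) *
      (\<Prod>i\<in>V - {j}. u i ^ lookup (t - single j 1) i)"
    using assms by (subst prod.remove[of V j]) (auto simp: lookup_minus)
  also have "(\<Prod>i\<in>V - {j}. u i ^ lookup (t - single j 1) i) =
      (\<Prod>i\<in>V - {j}. u i ^ lookup t i)"
    by (rule prod.cong) (auto simp: lookup_minus lookup_single when_def)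
  finally show ?thesis .
qed

lemma eval_pderiv:
  assumes "alg_struct \<phi>" "finite V" "poly_vars_in V p" "j \<in> V"
  shows "eval_mpoly \<phi> u (pderiv_mpoly j p) = (\<Sum>t\<in>keys p. \<phi> (lookup p t) *
     (of_nat (lookup t j) * u j ^ (lookup t j - 1) *
       (\<Prod>i\<in>V - {j}. u i ^ lookup t i)))"
  unfolding pderiv_mpoly_def eval_sum[OF assms(1)]
proof (rule sum.cong)
  fix t assume "t \<in> keys p"
  then have "keys t \<subseteq> V" using assms by (auto simp: poly_vars_in_def)
  note mono_val_minus_single[OF assms(2) this assms(4), of u, simplified]
  then show "eval_mpoly \<phi> u (if lookup t j = 0 then 0
      else single (t - single j 1) (of_nat (lookup t j) * lookup p t)) =
     \<phi> (lookup p t) * (of_nat (lookup t j) * u j ^ (lookup t j - 1) *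
       (\<Prod>i\<in>V - {j}. u i ^ lookup t i))"
    by (simp add: eval_0[OF assms(1)] eval_single[OF assms(1)] alg_structD[OF assms(1)] alg_struct_of_nat[OF assms(1)] mult_ac)
qed simp

text \<open>Only divisibility of the remainder by the square of \<open>e\<close> matters, so it
  stays existential. The increment \<open>e\<close> is an arbitrary ring element: later the dual
  unit, the constant series \<Delta>, and a power of the series variable.\<close>

lemma eval_taylor:
  fixes u :: "nat \<Rightarrow> 'a::comm_ring_1"
  assumes "alg_struct \<phi>" "finite V" "poly_vars_in V p"
  shows "\<exists>w. eval_mpoly \<phi> (\<lambda>j. u j + e * y j) p =
    eval_mpoly \<phi> u p + e * (\<Sum>j\<in>V. eval_mpoly \<phi> u (pderiv_mpoly j p) * y j) + e\<^sup>2 * w"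
proof -
  let ?d = "\<lambda>j t. of_nat (lookup t j) * u j ^ (lookup t j - 1) * (\<Prod>i\<in>V - {j}. u i ^ lookup t i)"
  have t: "\<exists>w. mono_val (\<lambda>j. u j + e * y j) t = mono_val u t + e * (\<Sum>j\<in>V. ?d j t * y j) + e\<^sup>2 * w"
    if "t \<in> keys p" for t
  proof -
    have V: "keys t \<subseteq> V" using that assms(3) by (auto simp: poly_vars_in_def)
    define A B where "A = (\<lambda>j. u j ^ lookup t j)"
      and "B = (\<lambda>j. of_nat (lookup t j) * u j ^ (lookup t j - 1) * y j)"
    have "\<forall>j. \<exists>w. (u j + e * y j) ^ lookup t j = A j + e * B j + e\<^sup>2 * w"
      using power_taylor unfolding A_def B_def by blast
    then obtain w where "\<And>j. (u j + e * y j) ^ lookup t j = A j + e * B j + e\<^sup>2 * w j" by metis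
    then have "mono_val (\<lambda>j. u j + e * y j) t = (\<Prod>j\<in>V. A j + e * B j + e\<^sup>2 * w j)"
      by (simp add: mono_val_superset[OF assms(2) V])
    moreover obtain v where "(\<Prod>j\<in>V. A j + e * B j + e\<^sup>2 * w j) =
       prod A V + e * (\<Sum>j\<in>V. B j * prod A (V - {j})) + e\<^sup>2 * v"
      using prod_taylor[OF assms(2)] by blast
    moreover have "prod A V = mono_val u t" by (simp add: A_def mono_val_superset[OF assms(2) V])
    ultimately show ?thesis by (auto simp: A_def B_def mult_ac)
  qed
  then have "\<forall>t\<in>keys p. \<exists>w. mono_val (\<lambda>j. u j + e * y j) t = mono_val u t + e * (\<Sum>j\<in>V. ?d j t * y j) + e\<^sup>2 * w" by blast
  from bchoice[OF this] obtain w where w: "\<And>t. t \<in> keys p \<Longrightarrow> mono_val (\<lambda>j. u j + e * y j) t = mono_val u t + e * (\<Sum>j\<in>V. ?d j t * y j) + e\<^sup>2 * w t" by blast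
  have expand: "eval_mpoly \<phi> (\<lambda>j. u j + e * y j) p = (\<Sum>t\<in>keys p. \<phi> (lookup p t) * mono_val u t)
    + e * (\<Sum>t\<in>keys p. \<Sum>j\<in>V. \<phi> (lookup p t) * ?d j t * y j)
    + e\<^sup>2 * (\<Sum>t\<in>keys p. \<phi> (lookup p t) * w t)"
    unfolding eval_mpoly_eq
    by (simp add: w sum_distrib_left sum.distrib distrib_left mult_ac)
  have swap: "(\<Sum>t\<in>keys p. \<Sum>j\<in>V. \<phi> (lookup p t) * ?d j t * y j) =
     (\<Sum>j\<in>V. eval_mpoly \<phi> u (pderiv_mpoly j p) * y j)"
    by (subst sum.swap) (simp add: eval_pderiv[OF assms(1-3)] sum_distrib_right)
  from expand[unfolded swap] show ?thesis unfolding eval_mpoly_eq[of \<phi> u p] by (rule exI)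
qed

section \<open>Nonvanishing of the ideals\<close>

text \<open>Essentiality is tested on the cyclic submodule generated by \<open>u\<close>; for
  \<open>u\<close> zero that submodule is trivial and any multiplier works.\<close>

lemma essential_multiple:
  assumes ess: "essential_left_A_submodule (Dalg \<phi>) R" and u: "u \<in> Dalg \<phi>"
  shows "\<exists>a. a \<noteq> (0 :: 'a::idom) \<and> lmult a \<circ> u \<in> R"
proof (cases "u = op_zero")
  case True
  have "lmult 1 \<circ> u = op_zero" using True by (auto simp: op_simps)
  then show ?thesis using ess unfolding essential_left_A_submodule_def left_A_submodule_def
    by (metis zero_neq_one)
next
  case False
  let ?N = "range (\<lambda>a. lmult a \<circ> u)"
  have 0: "lmult 0 \<circ> u = op_zero" by (auto simp: op_simps)
  have "left_A_submodule (Dalg \<phi>) ?N"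
    unfolding left_A_submodule_def
  proof (intro conjI ballI allI)
    show "?N \<subseteq> Dalg \<phi>"
      using u subalg_lmult[OF subalg_Dalg] subalg_comp[OF subalg_Dalg] by blast
    show "op_zero \<in> ?N" using 0 by (metis rangeI)
  next
    fix v w assume "v \<in> ?N" "w \<in> ?N"
    then obtain a b where "v = lmult a \<circ> u" "w = lmult b \<circ> u" by blast
    then have "op_add v w = lmult (a + b) \<circ> u" by (auto simp: op_simps distrib_right)
    then show "op_add v w \<in> ?N" by blast
  next
    fix a v assume "v \<in> ?N"
    then obtain b where "v = lmult b \<circ> u" by blast
    then have "lmult a \<circ> v = lmult (a * b) \<circ> u" by (auto simp: op_simps mult.assoc)
    then show "lmult a \<circ> v \<in> ?N" by blast
  qed
  moreover have "lmult 1 \<circ> u = u" by (auto simp: op_simps)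
  then have "?N \<noteq> {op_zero}" using False by (metis rangeI singletonD)
  ultimately have "?N \<inter> R \<noteq> {op_zero}" using ess by (simp add: essential_left_A_submodule_def)
  moreover have "op_zero \<in> ?N \<inter> R"
    using 0 ess unfolding essential_left_A_submodule_def left_A_submodule_def by (metis IntI rangeI)
  ultimately obtain a where "lmult a \<circ> u \<in> R" "lmult a \<circ> u \<noteq> op_zero" by blast
  then show ?thesis using 0 by metis
qed

text \<open>Gaussian elimination on the values at the finitely many points of \<open>B\<close>.\<close>

lemma common_denominator:
  assumes R: "subalg_containing_A \<phi> R" and ess: "essential_left_A_submodule (Dalg \<phi>) R"
    and "finite B" and "left_A_submodule (Dalg \<phi>) M"
    and "\<And>u. u \<in> M \<Longrightarrow> \<forall>b\<in>B. u b = 0 \<Longrightarrow> u = op_zero"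
  shows "\<exists>a. a \<noteq> (0 :: 'a::idom) \<and> (\<forall>u\<in>M. lmult a \<circ> u \<in> R)"
  using assms(3-)
proof (induction B arbitrary: M)
  case empty
  have "lmult 1 \<circ> op_zero = (op_zero :: 'a \<Rightarrow> 'a)" by (auto simp: op_simps)
  moreover have "op_zero \<in> R" using ess by (simp add: essential_left_A_submodule_def left_A_submodule_def)
  ultimately have "lmult 1 \<circ> u \<in> R" if "u \<in> M" for u
    using empty(2)[OF that] by (simp only: ball_simps)
  then show ?case by (intro exI[of _ 1]) simp
next
  case (insert b B)
  have M: "M \<subseteq> Dalg \<phi>" "op_zero \<in> M" "\<And>u v. u \<in> M \<Longrightarrow> v \<in> M \<Longrightarrow> op_add u v \<in> M"
     "\<And>a u. u \<in> M \<Longrightarrow> lmult a \<circ> u \<in> M"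
    using insert(4) by (auto simp: left_A_submodule_def)
  define N where "N = {u \<in> M. u b = 0}"
  have "left_A_submodule (Dalg \<phi>) N"
    unfolding left_A_submodule_def N_def using M by (auto simp: op_simps)
  moreover have "u = op_zero" if "u \<in> N" "\<forall>b\<in>B. u b = 0" for u
    using that insert(5)[of u] by (auto simp: N_def)
  ultimately obtain a where a: "a \<noteq> 0" "\<And>u. u \<in> N \<Longrightarrow> lmult a \<circ> u \<in> R"
    using insert.IH by blast
  show ?case
  proof (cases "N = M")
    case True
    then show ?thesis using a by blast
  next
    case False
    then obtain v where v: "v \<in> M" "v b \<noteq> 0" by (auto simp: N_def)
    obtain c where c: "c \<noteq> 0" "lmult c \<circ> v \<in> R" using essential_multiple[OF ess] v(1) M(1) by blast
    \<comment> \<open>Here \<open>a\<close> serves the operators vanishing at \<open>b\<close>,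
      \<open>v b\<close> is the pivot, and \<open>c\<close> brings the pivot operator
      \<open>v\<close> into \<open>R\<close>. The combination \<open>?w\<close> cancels the value at
      \<open>b\<close>.\<close>
    have "lmult (a * v b * c) \<circ> u \<in> R" if u: "u \<in> M" for u
    proof -
      let ?w = "op_add (lmult (v b) \<circ> u) (lmult (- u b) \<circ> v)"
      have "?w \<in> M" using M u v(1) by blast
      moreover have "?w b = 0" by (simp add: op_simps)
      ultimately have "lmult a \<circ> ?w \<in> R" using a(2) by (simp add: N_def)
      moreover have "lmult (a * v b * c) \<circ> u =
          op_add (lmult c \<circ> (lmult a \<circ> ?w)) (lmult (a * u b) \<circ> (lmult c \<circ> v))"
        by (auto simp: op_simps algebra_simps)
      ultimately show ?thesis
        using c(2) subalg_lmult[OF R] subalg_comp[OF R] subalg_add[OF R] by metis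
    qed
    moreover have "a * v b * c \<noteq> 0" using a(1) c(1) v(2) by simp
    ultimately show ?thesis by blast
  qed
qed

fun monomials_upto :: "(nat \<Rightarrow> 'a::comm_ring_1) \<Rightarrow> nat \<Rightarrow> nat \<Rightarrow> 'a set" where
  "monomials_upto x n 0 = {1}"
| "monomials_upto x n (Suc i) = monomials_upto x n i \<union> (\<Union>j<n. (\<lambda>y. x j * y) ` monomials_upto x n i)"

lemma finite_monomials_upto: "finite (monomials_upto x n i)"
  by (induction i) auto

lemma one_in_monomials_upto: "1 \<in> monomials_upto x n i"
  by (induction i) auto

text \<open>The commutator of \<open>u\<close> with a coordinate has lower order and vanishes on the
  shorter monomials, hence is zero. So \<open>u\<close> commutes with coordinates, then with
  polynomials, then with fractions by cancelling a unit denominator, and is multiplication by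
  \<open>u 1 = 0\<close>.\<close>

lemma Dops_eq_zero_if_monomials:
  fixes \<phi> :: "'k::field \<Rightarrow> 'a::idom"
  assumes alg: "alg_struct \<phi>"
    and loc: "\<forall>a. \<exists>p q. in_Pn n p \<and> in_Pn n q \<and> (\<exists>v. eval_mpoly \<phi> x q * v = 1)
                          \<and> a * eval_mpoly \<phi> x q = eval_mpoly \<phi> x p"
  shows "u \<in> Dops \<phi> i \<Longrightarrow> \<forall>b\<in>monomials_upto x n i. u b = 0 \<Longrightarrow> u = op_zero"
proof (induction i arbitrary: u)
  case 0
  then have "u = lmult (u 1)" "u 1 = 0" using Dops_0_eq_lmult[of u \<phi>] by auto
  then show ?case using lmult_eq_zero_iff by metis
next
  case (Suc i)
  have u: "u \<in> EndK \<phi>" using Suc.prems(1) by (rule Dops_EndK)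
  have comm_x: "x j * u y = u (x j * y)" if "j < n" for j y
  proof -
    have "commut (x j) u = op_zero"
    proof (rule Suc.IH)
      show "commut (x j) u \<in> Dops \<phi> i" using Suc.prems(1) by (rule commut_in_Dops)
      show "\<forall>b\<in>monomials_upto x n i. commut (x j) u b = 0"
      proof
        fix b assume "b \<in> monomials_upto x n i"
        then have "b \<in> monomials_upto x n (Suc i)" "x j * b \<in> monomials_upto x n (Suc i)"
          using that by auto
        then show "commut (x j) u b = 0" using Suc.prems(2) by (simp add: op_simps)
      qed
    qed
    then show ?thesis by (auto simp: op_simps)
  qed
  let ?C = "{a. \<forall>y. a * u y = u (a * y)}"
  have "subring_set ?C"
    using EndK_add[OF u] EndK_diff[OF u, of 0] EndK_zero[OF u]
    by (auto simp: subring_set_def distrib_right mult.assoc)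
  then have P: "eval_mpoly \<phi> x p \<in> ?C" if "in_Pn n p" for p
    by (rule eval_in_subring[OF alg]) (use u comm_x that in \<open>auto simp: EndK_def in_Pn_iff\<close>)
  have "a * u y = u (a * y)" for a y
  proof -
    obtain p q v where pq: "in_Pn n p" "in_Pn n q" "eval_mpoly \<phi> x q * v = 1"
        "a * eval_mpoly \<phi> x q = eval_mpoly \<phi> x p" using loc by metis
    have "eval_mpoly \<phi> x q * u (a * y) = u (eval_mpoly \<phi> x p * y)"
    proof -
      have "eval_mpoly \<phi> x q * u (a * y) = u (eval_mpoly \<phi> x q * (a * y))" using P[OF pq(2)] by simp
      also have "eval_mpoly \<phi> x q * (a * y) = eval_mpoly \<phi> x p * y"
        by (simp add: pq(4)[symmetric] mult_ac)
      finally show ?thesis .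
    qed
    also have "\<dots> = eval_mpoly \<phi> x q * (a * u y)" using P[OF pq(1)] by (simp add: pq(4)[symmetric] mult_ac)
    finally show ?thesis using pq(3) by auto
  qed
  then have "commut a u = op_zero" for a by (auto simp: op_simps)
  then have "u = lmult (u 1)" by (rule commuting_eq_lmult)
  moreover have "u 1 = 0" using Suc.prems(2) one_in_monomials_upto by blast
  ultimately show ?case using lmult_eq_zero_iff by metis
qed

lemma bideal_nonzero:
  fixes \<phi> :: "'k::field \<Rightarrow> 'a::idom"
  assumes alg: "alg_struct \<phi>"
    and loc: "\<forall>a. \<exists>p q. in_Pn n p \<and> in_Pn n q \<and> (\<exists>v. eval_mpoly \<phi> x q * v = 1)
                          \<and> a * eval_mpoly \<phi> x q = eval_mpoly \<phi> x p"
    and R: "subalg_containing_A \<phi> R" and ess: "essential_left_A_submodule (Dalg \<phi>) R"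
  shows "\<exists>a\<in>bideal \<phi> R i. a \<noteq> 0"
proof -
  have "left_A_submodule (Dalg \<phi>) (Dops \<phi> i)"
    by (simp add: left_A_submodule_def Dops_subset_Dalg op_zero_in_Dops op_add_in_Dops lmult_comp_in_Dops)
  from common_denominator[OF R ess finite_monomials_upto[of x n i] this] Dops_eq_zero_if_monomials[OF alg loc]
  show ?thesis unfolding bideal_iff[OF R] Bex_def by metis
qed

section \<open>Minors and rank\<close>

lemma bij_betw_pick:
  assumes "finite I"
  shows "bij_betw (pick I) {..<card I} I"
proof -
  have inj: "inj_on (pick I) {..<card I}"
    using card_pick_le by (intro inj_on_inverseI[of _ "\<lambda>i. card {a \<in> I. a < i}"]) auto
  have "pick I ` {..<card I} \<subseteq> I" using pick_in_set_le by auto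
  then have "pick I ` {..<card I} = I"
    using assms inj by (simp add: card_image card_subset_eq)
  with inj show ?thesis by (simp add: bij_betw_def)
qed

lemma submatrix_carrier_index:
  assumes A: "A \<in> carrier_mat m n" and I: "I \<subseteq> {..<m}" and J: "J \<subseteq> {..<n}"
  shows "submatrix A I J \<in> carrier_mat (card I) (card J)"
    and "k < card I \<Longrightarrow> l < card J \<Longrightarrow> submatrix A I J $$ (k, l) = A $$ (pick I k, pick J l)"
proof -
  have c: "{i. i < dim_row A \<and> i \<in> I} = I" "{j. j < dim_col A \<and> j \<in> J} = J"
    using A I J by auto
  show "submatrix A I J \<in> carrier_mat (card I) (card J)"
    by (rule carrier_matI) (simp_all add: dim_submatrix c)
  show "k < card I \<Longrightarrow> l < card J \<Longrightarrow> submatrix A I J $$ (k, l) = A $$ (pick I k, pick J l)"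
    by (rule submatrix_index) (simp_all add: c)
qed

text \<open>The adjugate identities, carried from positions inside the submatrix to the row and
  column indices of \<open>A\<close>, so that later sums run over \<open>I\<close> and
  \<open>J\<close> directly.\<close>

lemma minor_cofactors:
  fixes A :: "'a::comm_ring_1 mat"
  assumes A: "A \<in> carrier_mat m n" and I: "I \<subseteq> {..<m}" and J: "J \<subseteq> {..<n}" and c: "card I = card J"
  shows "\<exists>C. (\<forall>j\<in>J. \<forall>l\<in>J. (\<Sum>i\<in>I. C j i * A $$ (i, l)) = (if j = l then det (submatrix A I J) else 0))
    \<and> (\<forall>i\<in>I. \<forall>k\<in>I. (\<Sum>l\<in>J. A $$ (i, l) * C l k) = (if i = k then det (submatrix A I J) else 0))"
proof -
  define r where "r = card I"
  have fin: "finite I" "finite J" using I J finite_subset by blast+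
  let ?S = "submatrix A I J"
  have S: "?S \<in> carrier_mat r r" using submatrix_carrier_index(1)[OF A I J] c by (simp add: r_def)
  have bI: "bij_betw (pick I) {..<r} I" and bJ: "bij_betw (pick J) {..<r} J"
    using bij_betw_pick[OF fin(1)] bij_betw_pick[OF fin(2)] c by (simp_all add: r_def)
  define pI pJ where "pI = inv_into {..<r} (pick I)" and "pJ = inv_into {..<r} (pick J)"
  have pI: "\<And>k. k < r \<Longrightarrow> pI (pick I k) = k" "\<And>i. i \<in> I \<Longrightarrow> pI i < r" "\<And>i. i \<in> I \<Longrightarrow> pick I (pI i) = i"
    using bij_betw_inv_into_left[OF bI] bij_betw_inv_into_right[OF bI]
      bij_betwE[OF bij_betw_inv_into[OF bI]] by (auto simp: pI_def)
  have pJ: "\<And>k. k < r \<Longrightarrow> pJ (pick J k) = k" "\<And>i. i \<in> J \<Longrightarrow> pJ i < r" "\<And>i. i \<in> J \<Longrightarrow> pick J (pJ i) = i"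
    using bij_betw_inv_into_left[OF bJ] bij_betw_inv_into_right[OF bJ]
      bij_betwE[OF bij_betw_inv_into[OF bJ]] by (auto simp: pJ_def)
  define C where "C = (\<lambda>j i. adj_mat ?S $$ (pJ j, pI i))"
  note adj = adj_mat[OF S]
  have entry: "A $$ (i, j) = ?S $$ (pI i, pJ j)" if "i \<in> I" "j \<in> J" for i j
    using submatrix_carrier_index(2)[OF A I J, of "pI i" "pJ j"] pI pJ that c by (simp add: r_def)
  have "(\<Sum>i\<in>I. C j i * A $$ (i, l)) = (if j = l then det ?S else 0)" if "j \<in> J" "l \<in> J" for j l
  proof -
    have "(\<Sum>i\<in>I. C j i * A $$ (i, l)) = (\<Sum>i\<in>I. adj_mat ?S $$ (pJ j, pI i) * ?S $$ (pI i, pJ l))"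
      using that by (simp add: C_def entry)
    also have "\<dots> = (\<Sum>k<r. adj_mat ?S $$ (pJ j, k) * ?S $$ (k, pJ l))"
      by (rule sum.reindex_bij_betw[OF bij_betw_inv_into[OF bI], folded pI_def])
    also have "\<dots> = (adj_mat ?S * ?S) $$ (pJ j, pJ l)"
      using adj(1) S pJ(2) that
      by (subst index_mult_mat) (auto simp: scalar_prod_def lessThan_atLeast0 intro!: sum.cong)
    also have "\<dots> = (if pJ j = pJ l then det ?S else 0)"
      unfolding adj(3) using pJ(2) that by simp
    also have "pJ j = pJ l \<longleftrightarrow> j = l" using pJ(3) that by metis
    finally show ?thesis .
  qed
  moreover have "(\<Sum>l\<in>J. A $$ (i, l) * C l k) = (if i = k then det ?S else 0)" if "i \<in> I" "k \<in> I" for i k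
  proof -
    have "(\<Sum>l\<in>J. A $$ (i, l) * C l k) = (\<Sum>l\<in>J. ?S $$ (pI i, pJ l) * adj_mat ?S $$ (pJ l, pI k))"
      using that by (simp add: C_def entry)
    also have "\<dots> = (\<Sum>j<r. ?S $$ (pI i, j) * adj_mat ?S $$ (j, pI k))"
      by (rule sum.reindex_bij_betw[OF bij_betw_inv_into[OF bJ], folded pJ_def])
    also have "\<dots> = (?S * adj_mat ?S) $$ (pI i, pI k)"
      using adj(1) S pI(2) that
      by (subst index_mult_mat) (auto simp: scalar_prod_def lessThan_atLeast0 intro!: sum.cong)
    also have "\<dots> = (if pI i = pI k then det ?S else 0)"
      unfolding adj(2) using pI(2) that by simp
    also have "pI i = pI k \<longleftrightarrow> i = k" using pI(3) that by metis
    finally show ?thesis .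
  qed
  ultimately show ?thesis by blast
qed

lemma zero_minor_kernel:
  fixes A :: "'a::field mat"
  assumes A: "A \<in> carrier_mat m n" and I: "I \<subseteq> {..<m}" and J: "J \<subseteq> {..<n}" and c: "card I = card J"
    and det: "det (submatrix A I J) = 0"
  shows "\<exists>z. (\<exists>j\<in>J. z j \<noteq> 0) \<and> (\<forall>i\<in>I. (\<Sum>j\<in>J. A $$ (i, j) * z j) = 0)"
proof -
  define r where "r = card I"
  have fin: "finite I" "finite J" using I J finite_subset by blast+
  let ?S = "submatrix A I J"
  have S: "?S \<in> carrier_mat r r" using submatrix_carrier_index(1)[OF A I J] c by (simp add: r_def)
  have bI: "bij_betw (pick I) {..<r} I" and bJ: "bij_betw (pick J) {..<r} J"
    using bij_betw_pick[OF fin(1)] bij_betw_pick[OF fin(2)] c by (simp_all add: r_def)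
  obtain v where v: "v \<in> carrier_vec r" "v \<noteq> 0\<^sub>v r" "?S *\<^sub>v v = 0\<^sub>v r"
    using det det_0_iff_vec_prod_zero_field[OF S] by blast
  define z where "z = (\<lambda>j. v $ inv_into {..<r} (pick J) j)"
  have z: "z (pick J l) = v $ l" if "l < r" for l
    using bij_betw_inv_into_left[OF bJ] that by (simp add: z_def)
  obtain l where l: "l < r" "v $ l \<noteq> 0" using v(1,2) by (metis carrier_vecD eq_vecI index_zero_vec)
  have "pick J l \<in> J" using bij_betwE[OF bJ] l(1) by auto
  then have "\<exists>j\<in>J. z j \<noteq> 0" using l z by metis
  moreover have "(\<Sum>j\<in>J. A $$ (i, j) * z j) = 0" if "i \<in> I" for i
  proof -
    have "i \<in> pick I ` {..<r}" by (simp only: bij_betw_imp_surj_on[OF bI] that)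
    then obtain k where k: "k < r" "i = pick I k" by (elim imageE) simp
    have "(\<Sum>j\<in>J. A $$ (i, j) * z j) = (\<Sum>l<r. A $$ (i, pick J l) * z (pick J l))"
      by (rule sum.reindex_bij_betw[OF bJ, symmetric])
    also have "\<dots> = (\<Sum>l<r. ?S $$ (k, l) * v $ l)"
      using submatrix_carrier_index(2)[OF A I J] c k z by (intro sum.cong) (auto simp: r_def)
    also have "\<dots> = (?S *\<^sub>v v) $ k"
      using S v(1) k by (auto simp: scalar_prod_def lessThan_atLeast0 intro!: sum.cong)
    finally show ?thesis using v(3) k by simp
  qed
  ultimately show ?thesis by blast
qed

text \<open>Cramer's rule on the rows \<open>I\<close> fixes the coefficients \<open>q\<close>. For
  a further row \<open>i\<close>, the vanishing bordered minor yields a kernel vector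
  \<open>z\<close> on \<open>insert j J\<close>; the rows \<open>I\<close> force
  \<open>z l = - q l * z j\<close>, so \<open>z j\<close> is nonzero and the same \<open>q\<close>
  fits row \<open>i\<close>.\<close>

lemma columns_in_span_of_minor:
  fixes A :: "'a::field mat"
  assumes A: "A \<in> carrier_mat m n" and I: "I \<subseteq> {..<m}" and J: "J \<subseteq> {..<n}" and c: "card I = card J"
    and det: "det (submatrix A I J) \<noteq> 0"
    and border: "\<And>i j. i < m \<Longrightarrow> i \<notin> I \<Longrightarrow> j < n \<Longrightarrow> j \<notin> J \<Longrightarrow> det (submatrix A (insert i I) (insert j J)) = 0"
    and j: "j < n"
  shows "\<exists>q. \<forall>i<m. A $$ (i, j) = (\<Sum>l\<in>J. A $$ (i, l) * q l)"
proof (cases "j \<in> J")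
  case True
  have "finite J" using J finite_subset by blast
  have "\<forall>i<m. A $$ (i, j) = (\<Sum>l\<in>J. A $$ (i, l) * (if l = j then 1 else 0))"
    using True \<open>finite J\<close> by (simp add: if_distrib cong: if_cong)
  then show ?thesis by (intro exI[of _ "\<lambda>l. if l = j then 1 else 0"])
next
  case False
  let ?d = "det (submatrix A I J)"
  have fin: "finite I" "finite J" using I J finite_subset by blast+
  obtain C where C1: "\<And>j l. j \<in> J \<Longrightarrow> l \<in> J \<Longrightarrow> (\<Sum>i\<in>I. C j i * A $$ (i, l)) = (if j = l then ?d else 0)"
    and C2: "\<And>i k. i \<in> I \<Longrightarrow> k \<in> I \<Longrightarrow> (\<Sum>l\<in>J. A $$ (i, l) * C l k) = (if i = k then ?d else 0)"
    using minor_cofactors[OF A I J c] by blast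
  have uniq: "?d * z l = (\<Sum>i\<in>I. C l i * (\<Sum>j\<in>J. A $$ (i, j) * z j))" if "l \<in> J" for z l
  proof -
    have "(\<Sum>i\<in>I. C l i * (\<Sum>j\<in>J. A $$ (i, j) * z j)) = (\<Sum>j\<in>J. (\<Sum>i\<in>I. C l i * A $$ (i, j)) * z j)"
      by (simp add: sum_distrib_left sum_distrib_right mult_ac sum.swap[of _ I])
    also have "\<dots> = ?d * z l"
      using that fin by (simp add: C1 if_distrib[of "\<lambda>u. u * _"] cong: if_cong)
    finally show ?thesis by simp
  qed
  define q where "q = (\<lambda>l. (\<Sum>k\<in>I. C l k * A $$ (k, j)) / ?d)"
  have "A $$ (i, j) = (\<Sum>l\<in>J. A $$ (i, l) * q l)" if i: "i < m" for i
  proof (cases "i \<in> I")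
    case True
    have "(\<Sum>l\<in>J. A $$ (i, l) * q l) = (\<Sum>k\<in>I. (\<Sum>l\<in>J. A $$ (i, l) * C l k) * A $$ (k, j)) / ?d"
      by (simp add: q_def sum_distrib_left sum_distrib_right sum_divide_distrib mult_ac sum.swap[of _ I])
    also have "\<dots> = ?d * A $$ (i, j) / ?d"
      using True fin by (simp add: C2 if_distrib[of "\<lambda>u. u * _"] cong: if_cong)
    finally show ?thesis using det by simp
  next
    case iI: False
    have "insert i I \<subseteq> {..<m}" "insert j J \<subseteq> {..<n}" "card (insert i I) = card (insert j J)"
      using i j I J c iI False fin by auto
    from zero_minor_kernel[OF A this border[OF i iI j False]]
    obtain z where z0: "\<exists>l\<in>insert j J. z l \<noteq> 0"
      and z: "\<And>k. k \<in> insert i I \<Longrightarrow> (\<Sum>l\<in>insert j J. A $$ (k, l) * z l) = 0" by blast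
    have z': "A $$ (k, j) * z j = - (\<Sum>l\<in>J. A $$ (k, l) * z l)" if "k \<in> insert i I" for k
      using z[OF that] False fin by (simp add: eq_neg_iff_add_eq_0)
    have zl: "z l = - q l * z j" if "l \<in> J" for l
    proof -
      have "?d * z l = (\<Sum>k\<in>I. C l k * (- (A $$ (k, j) * z j)))"
        unfolding uniq[OF that] using z' by (intro sum.cong) auto
      also have "\<dots> = - (\<Sum>k\<in>I. C l k * A $$ (k, j)) * z j"
        by (simp add: sum_distrib_right sum_negf mult.assoc)
      finally show ?thesis using det by (simp add: q_def field_simps)
    qed
    then have "z j \<noteq> 0" using z0 by auto
    have "A $$ (i, j) * z j = (\<Sum>l\<in>J. A $$ (i, l) * q l) * z j"
      using z'[of i] zl by (simp add: sum_distrib_right sum_negf mult.assoc)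
    then show ?thesis using \<open>z j \<noteq> 0\<close> by simp
  qed
  then show ?thesis by blast
qed

lemma (in vec_space) rank_le_spanning_columns:
  assumes A: "A \<in> carrier_mat n nc" and J: "J \<subseteq> {..<nc}"
    and span: "\<And>j. j < nc \<Longrightarrow> \<exists>q. \<forall>i<n. A $$ (i, j) = (\<Sum>l\<in>J. A $$ (i, l) * q l)"
  shows "rank A \<le> card J"
proof -
  have fin: "finite J" using J finite_subset by blast
  let ?U = "col A ` J"
  have U: "?U \<subseteq> carrier_vec n" using A J by auto
  have comb: "vec n (\<lambda>i. \<Sum>l\<in>J'. A $$ (i, l) * q l) \<in> span ?U" if "J' \<subseteq> J" for q J'
    using finite_subset[OF that fin] that
  proof induction
    case empty
    have "vec n (\<lambda>i. \<Sum>l\<in>{}. A $$ (i, l) * q l) = 0\<^sub>v n" by auto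
    also have "0\<^sub>v n = lincomb (\<lambda>_. 0) {}" by simp
    also have "\<dots> \<in> span ?U" unfolding span_def by blast
    finally show ?case .
  next
    case (insert l J')
    have "vec n (\<lambda>i. \<Sum>l\<in>insert l J'. A $$ (i, l) * q l) =
       q l \<cdot>\<^sub>v col A l + vec n (\<lambda>i. \<Sum>l\<in>J'. A $$ (i, l) * q l)"
      using insert A J by (intro eq_vecI) (auto simp: mult.commute)
    moreover have "q l \<cdot>\<^sub>v col A l \<in> span ?U"
      using insert(4) U by (intro smult_in_span span_mem) auto
    ultimately show ?case using insert U by (simp add: span_add1)
  qed
  have "set (cols A) \<subseteq> span ?U"
  proof
    fix v assume "v \<in> set (cols A)"
    then obtain j where j: "j < nc" "v = col A j" using A by (auto simp: cols_def)
    obtain q where "\<forall>i<n. A $$ (i, j) = (\<Sum>l\<in>J. A $$ (i, l) * q l)" using span[OF j(1)] by blast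
    then have "v = vec n (\<lambda>i. \<Sum>l\<in>J. A $$ (i, l) * q l)" using A j by (intro eq_vecI) auto
    then show "v \<in> span ?U" using comb[of J q] by simp
  qed
  moreover have UA: "?U \<subseteq> set (cols A)" using A J by (auto simp: cols_def)
  ultimately have "span (set (cols A)) = span ?U"
    using U by (meson span_is_monotone span_is_submodule span_is_subset subset_antisym)
  moreover obtain W where W: "finite W" "maximal W (\<lambda>T. T \<subseteq> ?U \<and> lin_indpt T)"
    using maximal_exists_superset[of ?U "\<lambda>T. T \<subseteq> ?U \<and> lin_indpt T" "{}"] fin by (auto simp: lin_dep_def)
  ultimately have "rank A = card W" using dim_span[OF U] fin by (simp add: rank_def)
  also have "\<dots> \<le> card ?U" using W fin by (intro card_mono) (auto simp: maximal_def)
  also have "\<dots> \<le> card J" using fin by (rule card_image_le)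
  finally show ?thesis .
qed

text \<open>A nonzero minor of maximal size has the size of the rank, because bordering it
  shows that its columns span.\<close>

lemma rank_minor:
  fixes A :: "'a::field mat"
  assumes A: "A \<in> carrier_mat m n"
  obtains I J where "I \<subseteq> {..<m}" "J \<subseteq> {..<n}" "card I = vec_space.rank m A" "card J = vec_space.rank m A"
    "det (submatrix A I J) \<noteq> 0"
proof -
  define P where "P s \<longleftrightarrow> (\<exists>I J. I \<subseteq> {..<m} \<and> J \<subseteq> {..<n} \<and> card I = s \<and> card J = s \<and> det (submatrix A I J) \<noteq> 0)" for s
  \<comment> \<open>The empty minor has determinant 1, so a largest size with a nonzero minor exists
    even for the zero matrix.\<close>
  have "submatrix A {} {} \<in> carrier_mat 0 0" using submatrix_carrier_index(1)[OF A, of "{}" "{}"] by simp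
  then have "det (submatrix A {} {}) = 1" by (rule det_dim_zero)
  then have "P 0" unfolding P_def by (intro exI[of _ "{}"]) simp
  moreover have bound: "s \<le> m" if "P s" for s
    using that card_mono[of "{..<m}"] by (auto simp: P_def)
  ultimately obtain s where s: "P s" "\<And>t. P t \<Longrightarrow> t \<le> s"
    using Greatest_le_nat[of P _ m] GreatestI_nat[of P 0 m] by blast
  then obtain I J where IJ: "I \<subseteq> {..<m}" "J \<subseteq> {..<n}" "card I = s" "card J = s" "det (submatrix A I J) \<noteq> 0"
    by (auto simp: P_def)
  have fin: "finite I" "finite J" using IJ finite_subset by blast+
  have border: "det (submatrix A (insert i I) (insert j J)) = 0" if "i < m" "i \<notin> I" "j < n" "j \<notin> J" for i j
  proof (rule ccontr)
    assume "det (submatrix A (insert i I) (insert j J)) \<noteq> 0"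
    then have "P (Suc s)" unfolding P_def using that IJ fin
      by (intro exI[of _ "insert i I"] exI[of _ "insert j J"]) auto
    then show False using s(2)[of "Suc s"] by simp
  qed
  have "vec_space.rank m A \<le> card J"
    using columns_in_span_of_minor[OF A IJ(1,2) _ IJ(5) border] IJ
    by (intro vec_space.rank_le_spanning_columns[OF A]) auto
  moreover have "{j. j < n \<and> j \<in> J} = J" using IJ(2) by auto
  then have "card J \<le> vec_space.rank m A" using vec_space.rank_gt_minor[OF A IJ(5)] by simp
  ultimately show ?thesis using that IJ by simp
qed

text \<open>A nonzero bordered minor would exceed the rank. This applies to every nonzero generator
  of the Jacobian ideal, not only to one chosen minor.\<close>

lemma columns_in_span_of_rank_minor:
  fixes A :: "'a::field mat"
  assumes A: "A \<in> carrier_mat m n" and I: "I \<subseteq> {..<m}" and J: "J \<subseteq> {..<n}"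
    and c: "card I = vec_space.rank m A" "card J = vec_space.rank m A"
    and det: "det (submatrix A I J) \<noteq> 0" and j: "j < n"
  shows "\<exists>q. \<forall>i<m. A $$ (i, j) = (\<Sum>l\<in>J. A $$ (i, l) * q l)"
proof (rule columns_in_span_of_minor[OF A I J _ det _ j])
  fix i j assume ij: "i < m" "i \<notin> I" "j < n" "j \<notin> J"
  show "det (submatrix A (insert i I) (insert j J)) = 0"
  proof (rule ccontr)
    assume "det (submatrix A (insert i I) (insert j J)) \<noteq> 0"
    from vec_space.rank_gt_minor[OF A this]
    have "card {k. k < n \<and> k \<in> insert j J} \<le> vec_space.rank m A" .
    moreover have "{k. k < n \<and> k \<in> insert j J} = insert j J" using J ij by auto
    moreover have "finite J" using J finite_subset by blast
    ultimately show False using c ij by simp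
  qed
qed (use c in simp)

section \<open>Polynomials over a subring\<close>

definition poly_over :: "'a::idom set \<Rightarrow> 'a poly \<Rightarrow> bool" where
  "poly_over S p \<longleftrightarrow> (\<forall>i. coeff p i \<in> S)"

lemma poly_over_pCons: "poly_over S (pCons a p) \<longleftrightarrow> a \<in> S \<and> poly_over S p"
  unfolding poly_over_def by (metis coeff_pCons_0 coeff_pCons_Suc not0_implies_Suc)

context
  fixes S :: "'a::idom set"
  assumes S: "subring_set S"
begin

lemma poly_over_0: "poly_over S 0"
  by (simp add: poly_over_def subring_setD[OF S])

lemma poly_over_add: "poly_over S p \<Longrightarrow> poly_over S q \<Longrightarrow> poly_over S (p + q)"
  by (simp add: poly_over_def subring_setD[OF S])

lemma poly_over_diff: "poly_over S p \<Longrightarrow> poly_over S q \<Longrightarrow> poly_over S (p - q)"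
  by (simp add: poly_over_def subring_setD[OF S])

lemma poly_over_smult: "a \<in> S \<Longrightarrow> poly_over S p \<Longrightarrow> poly_over S (Polynomial.smult a p)"
  by (simp add: poly_over_def subring_setD[OF S])

lemma poly_over_const: "a \<in> S \<Longrightarrow> poly_over S [:a:]"
  by (simp add: poly_over_pCons poly_over_0)

lemma poly_over_mult: "poly_over S p \<Longrightarrow> poly_over S q \<Longrightarrow> poly_over S (p * q)"
  by (induction p)
    (auto simp: poly_over_pCons poly_over_0 subring_setD[OF S] intro!: poly_over_add poly_over_smult)

lemma poly_over_pderiv: "poly_over S p \<Longrightarrow> poly_over S (pderiv p)"
  by (induction p)
    (auto simp: poly_over_pCons poly_over_0 pderiv_pCons subring_setD[OF S] intro!: poly_over_add)

text \<open>Long division with the leading coefficient of \<open>g\<close> multiplied in at each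
  step, as its inverse need not lie in \<open>S\<close>. The measure puts the zero polynomial
  strictly below the nonzero constants, which have degree 0 too.\<close>

lemma pseudo_division_over:
  assumes g: "poly_over S g" "g \<noteq> 0"
  shows "poly_over S p \<Longrightarrow> \<exists>k q r. poly_over S q \<and> poly_over S r \<and>
    Polynomial.smult (lead_coeff g ^ k) p = q * g + r \<and> (r = 0 \<or> degree r < degree g)"
proof (induction "if p = 0 then 0 else Suc (degree p)" arbitrary: p rule: less_induct)
  case less
  show ?case
  proof (cases "p = 0 \<or> degree p < degree g")
    case True
    then show ?thesis
      by (intro exI[of _ 0] exI[of _ p]) (use less.prems poly_over_0 in auto)
  next
    case False
    define l where "l = lead_coeff g"
    define t where "t = monom (lead_coeff p) (degree p - degree g)"
    define p' where "p' = Polynomial.smult l p - t * g"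
    have l: "l \<in> S" "l \<noteq> 0" using g by (auto simp: l_def poly_over_def)
    have t: "poly_over S t" using less.prems by (auto simp: t_def poly_over_def subring_setD[OF S])
    have p': "poly_over S p'"
      unfolding p'_def using less.prems l t g by (intro poly_over_diff poly_over_smult poly_over_mult)
    have "lead_coeff p \<noteq> 0" using False by simp
    then have "t \<noteq> 0" "degree t = degree p - degree g"
      unfolding t_def by (simp_all add: degree_monom_eq monom_eq_0_iff del: leading_coeff_0_iff)
    then have dt: "degree (t * g) = degree p"
      using False g by (simp add: degree_mult_eq)
    have "degree p' \<le> degree p"
      unfolding p'_def using dt degree_diff_le[of "Polynomial.smult l p" "degree p" "t * g"] degree_smult_le[of l p] by simp
    moreover have "coeff p' (degree p) = 0"
    proof -
      have "coeff (t * g) (degree p) = lead_coeff (t * g)" by (simp add: dt)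
      also have "\<dots> = lead_coeff p * l" by (simp only: lead_coeff_mult t_def l_def lead_coeff_monom)
      finally show ?thesis by (simp add: p'_def)
    qed
    ultimately have "p' = 0 \<or> degree p' < degree p"
      by (metis le_neq_implies_less leading_coeff_0_iff)
    then have "(if p' = 0 then 0 else Suc (degree p')) < (if p = 0 then 0 else Suc (degree p))"
      using False by auto
    from less.hyps[OF this p'] obtain k q r where qr: "poly_over S q" "poly_over S r"
        "Polynomial.smult (lead_coeff g ^ k) p' = q * g + r" "r = 0 \<or> degree r < degree g"
      by blast
    have "Polynomial.smult (lead_coeff g ^ Suc k) p = Polynomial.smult (l ^ k) (Polynomial.smult l p)" by (simp add: l_def mult.commute)
    also have "Polynomial.smult l p = p' + t * g" by (simp add: p'_def)
    also have "Polynomial.smult (l ^ k) (p' + t * g) = (q + Polynomial.smult (l ^ k) t) * g + r"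
      using qr(3) by (simp add: l_def smult_add_right distrib_right)
    finally have "Polynomial.smult (lead_coeff g ^ Suc k) p = (q + Polynomial.smult (l ^ k) t) * g + r" .
    moreover have "poly_over S (q + Polynomial.smult (l ^ k) t)"
      using qr(1) t l subring_power[OF S] by (intro poly_over_add poly_over_smult)
    ultimately show ?thesis using qr by blast
  qed
qed

definition adjoin :: "'a \<Rightarrow> 'a set" where
  "adjoin x = {poly p x |p. poly_over S p}"

lemma adjoin_base: "s \<in> S \<Longrightarrow> s \<in> adjoin x"
  unfolding adjoin_def using poly_over_const[of s] by force

lemma adjoin_self: "x \<in> adjoin x"
proof -
  have "poly_over S [:0, 1:]" by (simp add: poly_over_pCons poly_over_0 subring_setD[OF S])
  then show ?thesis unfolding adjoin_def by (force intro: exI[of _ "[:0, 1:]"])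
qed

lemma subring_adjoin: "subring_set (adjoin x)"
  unfolding subring_set_def
proof (intro conjI ballI)
  show "1 \<in> adjoin x" by (simp add: adjoin_base subring_setD[OF S])
  show "- a \<in> adjoin x" if "a \<in> adjoin x" for a
    using that poly_over_diff[OF poly_over_0] unfolding adjoin_def
    by (smt (verit) diff_0 mem_Collect_eq poly_minus)
  fix a b assume "a \<in> adjoin x" "b \<in> adjoin x"
  then obtain p q where pq: "poly_over S p" "poly_over S q" "a = poly p x" "b = poly q x"
    by (auto simp: adjoin_def)
  have "a + b = poly (p + q) x" "a * b = poly (p * q) x" using pq by simp_all
  then show "a + b \<in> adjoin x" "a * b \<in> adjoin x"
    unfolding adjoin_def using poly_over_add poly_over_mult pq by blast+
qed

end

lemma adjoin_eq: "subring_set S \<Longrightarrow> adjoin S x = {poly p x |p. poly_over S p}"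
  by (rule adjoin_def)

definition ext_poly :: "('a::idom \<Rightarrow> 'b::comm_ring_1) \<Rightarrow> 'b \<Rightarrow> 'a poly \<Rightarrow> 'b" where
  "ext_poly h y p = poly (map_poly h p) y"

context
  fixes S :: "'a::idom set" and h :: "'a \<Rightarrow> 'b::comm_ring_1"
  assumes S: "subring_set S" and h: "hom_on S h"
begin

lemma ext_poly_0: "ext_poly h y 0 = 0"
  by (simp add: ext_poly_def)

lemma ext_poly_pCons: "ext_poly h y (pCons a p) = h a + y * ext_poly h y p"
  by (simp add: ext_poly_def map_poly_pCons hom_on_0[OF S h])

lemma ext_poly_add: "poly_over S p \<Longrightarrow> poly_over S q \<Longrightarrow> ext_poly h y (p + q) = ext_poly h y p + ext_poly h y q"
proof (induction p arbitrary: q)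
  case 0
  then show ?case by (simp add: ext_poly_0)
next
  case (pCons a p)
  obtain b q' where q: "q = pCons b q'" by (cases q)
  have "ext_poly h y (p + q') = ext_poly h y p + ext_poly h y q'"
    using pCons.prems by (intro pCons.IH) (auto simp: q poly_over_pCons)
  then show ?case
    using pCons.prems by (simp add: q poly_over_pCons ext_poly_pCons hom_onD[OF h] algebra_simps)
qed

lemma ext_poly_smult: "a \<in> S \<Longrightarrow> poly_over S p \<Longrightarrow> ext_poly h y (Polynomial.smult a p) = h a * ext_poly h y p"
  by (induction p) (auto simp: ext_poly_0 ext_poly_pCons poly_over_pCons hom_onD[OF h] algebra_simps)

lemma ext_poly_mult: "poly_over S p \<Longrightarrow> poly_over S q \<Longrightarrow> ext_poly h y (p * q) = ext_poly h y p * ext_poly h y q"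
proof (induction p)
  case 0
  then show ?case by (simp add: ext_poly_0)
next
  case (pCons a p)
  then have "poly_over S (Polynomial.smult a q)" "poly_over S (pCons 0 (p * q))"
    by (auto simp: poly_over_pCons subring_setD[OF S] intro!: poly_over_smult[OF S] poly_over_mult[OF S])
  then show ?case
    using pCons by (simp add: poly_over_pCons ext_poly_add ext_poly_smult ext_poly_pCons hom_on_0[OF S h] algebra_simps)
qed

text \<open>This supplies the expansions demanded by the Hensel property, for
  \<open>ext_poly h\<close> as a function of the point.\<close>

lemma ext_poly_taylor:
  "poly_over S p \<Longrightarrow> \<exists>w. ext_poly h (y + z) p = ext_poly h y p + z * ext_poly h y (pderiv p) + z * z * w"
proof (induction p)
  case 0
  show ?case by (auto simp: ext_poly_0 intro: exI[of _ 0])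
next
  case (pCons a p)
  then obtain w where w: "ext_poly h (y + z) p = ext_poly h y p + z * ext_poly h y (pderiv p) + z * z * w"
    by (auto simp: poly_over_pCons)
  have "poly_over S p" "poly_over S (pCons 0 (pderiv p))"
    using pCons(3) by (auto simp: poly_over_pCons subring_setD[OF S] intro: poly_over_pderiv[OF S])
  then have "ext_poly h y (pderiv (pCons a p)) = ext_poly h y p + y * ext_poly h y (pderiv p)"
    by (simp add: pderiv_pCons ext_poly_add ext_poly_pCons hom_on_0[OF S h])
  then have "ext_poly h (y + z) (pCons a p) = ext_poly h y (pCons a p) +
      z * ext_poly h y (pderiv (pCons a p)) + z * z * (ext_poly h y (pderiv p) + (y + z) * w)"
    by (simp add: ext_poly_pCons w algebra_simps)
  then show ?case by blast
qed

text \<open>Two representations \<open>poly p x\<close> of one element differ by a relation of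
  \<open>x\<close>, which \<open>y\<close> satisfies by assumption. The value of the extension
  therefore does not depend on the chosen representation.\<close>

lemma hom_on_adjoin:
  assumes y: "\<And>p. poly_over S p \<Longrightarrow> poly p x = 0 \<Longrightarrow> ext_poly h y p = 0"
  shows "\<exists>h'. hom_on (adjoin S x) h' \<and> (\<forall>p. poly_over S p \<longrightarrow> h' (poly p x) = ext_poly h y p)
    \<and> (\<forall>s\<in>S. h' s = h s) \<and> h' x = y"
proof -
  define h' where "h' = (\<lambda>z. ext_poly h y (SOME p. poly_over S p \<and> poly p x = z))"
  have main: "h' (poly p x) = ext_poly h y p" if p: "poly_over S p" for p
  proof -
    define q where "q = (SOME q. poly_over S q \<and> poly q x = poly p x)"
    have q: "poly_over S q \<and> poly q x = poly p x"
      unfolding q_def using p by (rule_tac someI[of _ p]) simp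
    have d: "poly_over S (p - q)" using p q poly_over_diff[OF S] by blast
    have "ext_poly h y (p - q) = 0" using q by (intro y d) simp
    moreover have "ext_poly h y p = ext_poly h y (p - q) + ext_poly h y q"
      using ext_poly_add[OF d, of q y] q by simp
    ultimately show ?thesis by (simp add: h'_def q_def)
  qed
  have base: "h' s = h s" if "s \<in> S" for s
    using main[OF poly_over_const[OF S that]] by (simp add: ext_poly_pCons ext_poly_0)
  have "h' x = y"
    using main[of "[:0, 1:]"] hom_onD(1)[OF h]
    by (simp add: ext_poly_pCons ext_poly_0 poly_over_pCons poly_over_0[OF S] subring_setD[OF S] hom_on_0[OF S h])
  moreover have "hom_on (adjoin S x) h'"
    unfolding hom_on_def
  proof (intro conjI ballI)
    show "h' 1 = 1" using base subring_setD[OF S] hom_onD[OF h] by metis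
    fix a b assume "a \<in> adjoin S x" "b \<in> adjoin S x"
    then obtain p q where pq: "poly_over S p" "poly_over S q" "a = poly p x" "b = poly q x"
      by (auto simp: adjoin_eq[OF S])
    show "h' (a + b) = h' a + h' b"
      using main[OF poly_over_add[OF S pq(1,2)]] main pq ext_poly_add by simp
    show "h' (a * b) = h' a * h' b"
      using main[OF poly_over_mult[OF S pq(1,2)]] main pq ext_poly_mult by simp
  qed
  ultimately show ?thesis using main base by blast
qed

end

section \<open>Separable towers\<close>

text \<open>No monic normalisation, since leading coefficients need not be invertible in
  \<open>S\<close>. Up to a scalar this is the minimal polynomial over the fraction field of
  \<open>S\<close>.\<close>

definition min_poly_over :: "'a::idom set \<Rightarrow> 'a \<Rightarrow> 'a poly \<Rightarrow> bool" where
  "min_poly_over S x P \<longleftrightarrow> poly_over S P \<and> P \<noteq> 0 \<and> poly P x = 0 \<and>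
     (\<forall>g. poly_over S g \<and> g \<noteq> 0 \<and> poly g x = 0 \<longrightarrow> degree P \<le> degree g)"

text \<open>Algebraicity is included: a transcendental \<open>x\<close> has no \<open>P\<close> at
  all and counts as not separable.\<close>

definition separable_over :: "'a::idom set \<Rightarrow> 'a \<Rightarrow> bool" where
  "separable_over S x \<longleftrightarrow> (\<exists>P. min_poly_over S x P \<and> poly (pderiv P) x \<noteq> 0)"

lemma min_poly_over_exists:
  assumes "poly_over S g" "g \<noteq> 0" "poly g x = 0"
  shows "\<exists>P. min_poly_over S x P"
proof -
  let ?Q = "\<lambda>g. poly_over S g \<and> g \<noteq> 0 \<and> poly g x = 0"
  have "?Q (arg_min degree ?Q)" "\<forall>g. ?Q g \<longrightarrow> degree (arg_min degree ?Q) \<le> degree g"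
    using arg_min_nat_lemma[of ?Q g degree] assms by blast+
  then show ?thesis unfolding min_poly_over_def by blast
qed

text \<open>The pseudo-remainder vanishes at \<open>x\<close> and has smaller degree than
  \<open>P\<close>, so minimality makes it zero.\<close>

lemma min_poly_over_dvd:
  assumes S: "subring_set S" and P: "min_poly_over S x P" and g: "poly_over S g" "poly g x = 0"
  shows "\<exists>k q. poly_over S q \<and> Polynomial.smult (lead_coeff P ^ k) g = q * P"
proof -
  have P': "poly_over S P" "P \<noteq> 0" "poly P x = 0" using P by (auto simp: min_poly_over_def)
  obtain k q r where qr: "poly_over S q" "poly_over S r" "Polynomial.smult (lead_coeff P ^ k) g = q * P + r"
      "r = 0 \<or> degree r < degree P"
    using pseudo_division_over[OF S P'(1,2) g(1)] by blast
  have "poly r x = poly (Polynomial.smult (lead_coeff P ^ k) g) x" unfolding qr(3) using P'(3) by simp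
  then have "poly r x = 0" using g(2) by simp
  then have "r = 0" using P qr(2,4) unfolding min_poly_over_def by (meson not_less)
  then show ?thesis using qr by auto
qed

text \<open>Take \<open>g\<close> of least degree whose value at \<open>x\<close> is a nonzero
  multiple of \<open>a\<close>. If \<open>g\<close> were not constant, pseudo-division of
  \<open>P\<close> by \<open>g\<close> would leave a remainder whose value is again a multiple of
  \<open>a\<close>, hence zero. Then the quotient vanishes at \<open>x\<close> although its degree
  is below that of \<open>P\<close>. So \<open>g\<close> is constant and its value lies in
  \<open>S\<close>.\<close>

lemma separable_multiple:
  assumes S: "subring_set S" and sep: "separable_over S x" and a: "a \<in> adjoin S x" "a \<noteq> 0"
  shows "\<exists>w\<in>adjoin S x. w * a \<in> S \<and> w * a \<noteq> 0"
proof -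
  obtain P where P: "min_poly_over S x P" using sep by (auto simp: separable_over_def)
  have P': "poly_over S P" "P \<noteq> 0" "poly P x = 0" using P by (auto simp: min_poly_over_def)
  let ?Q = "\<lambda>g. poly_over S g \<and> poly g x \<noteq> 0 \<and> (\<exists>w\<in>adjoin S x. poly g x = w * a)"
  obtain g0 where g0: "poly_over S g0" "a = poly g0 x" using a(1) by (auto simp: adjoin_eq[OF S])
  have poly_adj: "poly p x \<in> adjoin S x" if "poly_over S p" for p using that by (auto simp: adjoin_eq[OF S])
  note adj = subring_setD[OF subring_adjoin[OF S]]
  have "?Q g0" using g0 a adj(1) by (intro conjI bexI[of _ 1]) auto
  define g where "g = arg_min degree ?Q"
  have "?Q g" and min: "\<And>g'. ?Q g' \<Longrightarrow> degree g \<le> degree g'"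
    using arg_min_nat_lemma[of ?Q g0 degree] \<open>?Q g0\<close> unfolding g_def by blast+
  then obtain w where g: "poly_over S g" "poly g x \<noteq> 0" "w \<in> adjoin S x" "poly g x = w * a" by blast
  have "g \<noteq> 0" using g by auto
  have smaller: "degree g < degree P"
  proof -
    obtain k q r where qr: "poly_over S q" "poly_over S r" "Polynomial.smult (lead_coeff P ^ k) g0 = q * P + r"
        "r = 0 \<or> degree r < degree P"
      using pseudo_division_over[OF S P'(1,2) g0(1)] by blast
    have l: "lead_coeff P ^ k \<in> S" "lead_coeff P ^ k \<noteq> 0"
      using P' subring_power[OF S] by (auto simp: poly_over_def)
    have "poly r x = poly (Polynomial.smult (lead_coeff P ^ k) g0) x" unfolding qr(3) using P'(3) by simp
    then have r: "poly r x = lead_coeff P ^ k * a" using g0 by simp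
    have "?Q r" using qr(2) r l a(2) adjoin_base[OF S] by auto
    then have "degree g \<le> degree r" by (rule min)
    moreover have "r \<noteq> 0" using \<open>?Q r\<close> by auto
    ultimately show ?thesis using qr(4) by simp
  qed
  have "degree g = 0"
  proof (rule ccontr)
    assume "degree g \<noteq> 0"
    obtain k q r where qr: "poly_over S q" "poly_over S r" "Polynomial.smult (lead_coeff g ^ k) P = q * g + r"
        "r = 0 \<or> degree r < degree g"
      using pseudo_division_over[OF S g(1) \<open>g \<noteq> 0\<close> P'(1)] by blast
    have "poly (q * g + r) x = 0" unfolding qr(3)[symmetric] using P'(3) by simp
    then have rx: "poly r x = - poly q x * w * a" using g(4) by (simp add: add_eq_0_iff mult.assoc)
    have "poly r x = 0"
    proof (rule ccontr)
      assume "poly r x \<noteq> 0"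
      moreover have "- poly q x * w \<in> adjoin S x" using adj poly_adj[OF qr(1)] g(3) by simp
      ultimately have "?Q r" using qr(2) rx by blast
      then show False using min[of r] qr(4) \<open>poly r x \<noteq> 0\<close> by auto
    qed
    then have "poly q x = 0" using rx g(2,4) by auto
    have lP: "degree (Polynomial.smult (lead_coeff g ^ k) P) = degree P" using \<open>g \<noteq> 0\<close> by simp
    have "q \<noteq> 0" using qr(3,4) lP smaller \<open>degree g \<noteq> 0\<close> by auto
    then have "degree P \<le> degree q" using P qr(1) \<open>poly q x = 0\<close> by (auto simp: min_poly_over_def)
    moreover have "degree q + degree g = degree (q * g)"
      using \<open>q \<noteq> 0\<close> \<open>g \<noteq> 0\<close> by (simp add: degree_mult_eq)
    moreover have "degree (q * g) \<le> degree P"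
    proof -
      have "q * g = Polynomial.smult (lead_coeff g ^ k) P - r" using qr(3) by simp
      moreover have "degree r \<le> degree P" using qr(4) smaller by auto
      ultimately show ?thesis using degree_diff_le[of "Polynomial.smult (lead_coeff g ^ k) P" "degree P" r] lP by simp
    qed
    ultimately show False using \<open>degree g \<noteq> 0\<close> by simp
  qed
  then obtain s where "g = [:s:]" by (meson degree_eq_zeroE)
  then show ?thesis using g by (intro bexI[of _ w]) (auto simp: poly_over_pCons)
qed

fun tower :: "'a::idom set \<Rightarrow> 'a list \<Rightarrow> 'a set" where
  "tower S [] = S"
| "tower S (x # xs) = tower (adjoin S x) xs"

fun separable_tower :: "'a::idom set \<Rightarrow> 'a list \<Rightarrow> bool" where
  "separable_tower S [] \<longleftrightarrow> True"
| "separable_tower S (x # xs) \<longleftrightarrow> separable_over S x \<and> separable_tower (adjoin S x) xs"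

lemma subring_tower: "subring_set S \<Longrightarrow> subring_set (tower S xs)"
  by (induction xs arbitrary: S) (auto simp: subring_adjoin)

lemma tower_base: "subring_set S \<Longrightarrow> S \<subseteq> tower S xs"
proof (induction xs arbitrary: S)
  case (Cons x xs)
  have "S \<subseteq> adjoin S x" using adjoin_base[OF Cons.prems] by blast
  also have "\<dots> \<subseteq> tower (adjoin S x) xs" by (rule Cons.IH[OF subring_adjoin[OF Cons.prems]])
  finally show ?case by simp
qed simp

lemma tower_mem: "subring_set S \<Longrightarrow> set xs \<subseteq> tower S xs"
proof (induction xs arbitrary: S)
  case (Cons x xs)
  have "x \<in> tower (adjoin S x) xs"
    using tower_base[OF subring_adjoin[OF Cons.prems]] adjoin_self[OF Cons.prems] by blast
  then show ?case using Cons.IH[OF subring_adjoin[OF Cons.prems]] by simp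
qed simp

lemma separable_tower_multiple:
  assumes "subring_set S" "separable_tower S xs" "a \<in> tower S xs" "a \<noteq> 0"
  shows "\<exists>w\<in>tower S xs. w * a \<in> S \<and> w * a \<noteq> 0"
  using assms
proof (induction xs arbitrary: S a)
  case Nil
  then show ?case using subring_setD(1) by (intro bexI[of _ 1]) auto
next
  case (Cons x xs)
  have adj: "subring_set (adjoin S x)" using Cons.prems(1) by (rule subring_adjoin)
  obtain w where w: "w \<in> tower S (x # xs)" "w * a \<in> adjoin S x" "w * a \<noteq> 0"
    using Cons.IH[OF adj] Cons.prems by auto
  obtain v where v: "v \<in> adjoin S x" "v * (w * a) \<in> S" "v * (w * a) \<noteq> 0"
    using separable_multiple[OF Cons.prems(1) _ w(2,3)] Cons.prems by auto
  have "v \<in> tower S (x # xs)" using tower_base[OF adj] v(1) by auto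
  then have "v * w \<in> tower S (x # xs)"
    using w(1) subring_setD(6)[OF subring_tower[OF Cons.prems(1)]] by blast
  then show ?case using v by (intro bexI[of _ "v * w"]) (auto simp: mult.assoc)
qed

section \<open>Extending homomorphisms along separable towers\<close>

text \<open>Newton's method is stated for functions with a second order expansion rather than for
  polynomials, so that \<open>\<lambda>y. ext_poly h y P\<close> can be inserted as it is. The
  clause on products says that lifts of nonzero residues are not zero divisors; it cancels the
  leading coefficients left by pseudo-division.\<close>

definition henselian :: "('b::comm_ring_1 \<Rightarrow> 'q::field) \<Rightarrow> bool" where
  "henselian \<pi> \<longleftrightarrow> hom_on UNIV \<pi> \<and> surj \<pi> \<and> (\<forall>b c. \<pi> b \<noteq> 0 \<longrightarrow> b * c = 0 \<longrightarrow> c = 0) \<and>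
    (\<forall>g g' y0. (\<forall>y z. \<exists>w. g (y + z) = g y + z * g' y + z * z * w) \<longrightarrow> (\<forall>y z. \<exists>w. g' (y + z) = g' y + z * w) \<longrightarrow>
      \<pi> (g y0) = 0 \<longrightarrow> \<pi> (g' y0) \<noteq> 0 \<longrightarrow> (\<exists>y. \<pi> y = \<pi> y0 \<and> g y = 0))"

lemma henselianD:
  assumes "henselian \<pi>"
  shows "hom_on UNIV \<pi>" "surj \<pi>" "\<pi> b \<noteq> 0 \<Longrightarrow> b * c = 0 \<Longrightarrow> c = 0"
    "(\<And>y z. \<exists>w. g (y + z) = g y + z * g' y + z * z * w) \<Longrightarrow> (\<And>y z. \<exists>w. g' (y + z) = g' y + z * w) \<Longrightarrow>
      \<pi> (g y0) = 0 \<Longrightarrow> \<pi> (g' y0) \<noteq> 0 \<Longrightarrow> \<exists>y. \<pi> y = \<pi> y0 \<and> g y = 0"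
  using assms unfolding henselian_def by blast+

definition to_frac :: "'a::idom \<Rightarrow> 'a fract" where
  "to_frac a = Fract a 1"

lemma to_frac_hom: "hom_on UNIV to_frac"
  by (simp add: hom_on_def to_frac_def One_fract_def)

lemma to_frac_simps [simp]:
  "to_frac 0 = 0" "to_frac 1 = 1" "to_frac (a + b) = to_frac a + to_frac b"
  "to_frac (a * b) = to_frac a * to_frac b" "to_frac (- a) = - to_frac a"
  "to_frac (a - b) = to_frac a - to_frac b" "to_frac a = to_frac b \<longleftrightarrow> a = b"
  "to_frac a = 0 \<longleftrightarrow> a = 0"
  by (auto simp: to_frac_def One_fract_def Zero_fract_def eq_fract)

lemma lift_ext_poly:
  assumes S: "subring_set S" and h: "hom_on S h" and \<pi>: "hom_on UNIV \<pi>"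
    and lift: "\<And>s. s \<in> S \<Longrightarrow> \<pi> (h s) = to_frac s" and y: "\<pi> y = to_frac x"
  shows "poly_over S p \<Longrightarrow> \<pi> (ext_poly h y p) = to_frac (poly p x)"
  by (induction p)
    (auto simp: ext_poly_0[OF S h] ext_poly_pCons[OF S h] poly_over_pCons hom_onD[OF \<pi>]
      hom_on_0[OF subring_UNIV \<pi>] lift y)

text \<open>Separability makes \<open>x\<close> a simple residual root of the transported
  \<open>P\<close>, and the Hensel lift of that root is the image of \<open>x\<close>. Any relation
  of \<open>x\<close> divides by \<open>P\<close> up to a power of its leading coefficient, whose
  image can be cancelled, so the lift satisfies it too.\<close>

lemma extend_hom_separable:
  assumes \<pi>: "henselian \<pi>" and S: "subring_set S" and h: "hom_on S h"
    and lift: "\<And>s. s \<in> S \<Longrightarrow> \<pi> (h s) = to_frac s" and sep: "separable_over S x"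
  shows "\<exists>h'. hom_on (adjoin S x) h' \<and> (\<forall>s\<in>S. h' s = h s) \<and> (\<forall>z\<in>adjoin S x. \<pi> (h' z) = to_frac z)"
proof -
  obtain P where P: "min_poly_over S x P" "poly (pderiv P) x \<noteq> 0" using sep by (auto simp: separable_over_def)
  have P': "poly_over S P" "P \<noteq> 0" "poly P x = 0" using P by (auto simp: min_poly_over_def)
  note hom = henselianD(1)[OF \<pi>]
  have lift': "\<pi> (ext_poly h y p) = to_frac (poly p x)" if "\<pi> y = to_frac x" "poly_over S p" for y p
    using lift_ext_poly[OF S h hom _ that] lift by blast
  obtain y0 where y0: "\<pi> y0 = to_frac x" using henselianD(2)[OF \<pi>] by (metis surjD)
  have t1: "\<exists>w. ext_poly h (y + z) P = ext_poly h y P + z * ext_poly h y (pderiv P) + z * z * w" for y z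
    by (rule ext_poly_taylor[OF S h P'(1)])
  have t2: "\<exists>w. ext_poly h (y + z) (pderiv P) = ext_poly h y (pderiv P) + z * w" for y z
  proof -
    obtain w where "ext_poly h (y + z) (pderiv P) = ext_poly h y (pderiv P) + z * ext_poly h y (pderiv (pderiv P)) + z * z * w"
      using ext_poly_taylor[OF S h poly_over_pderiv[OF S P'(1)]] by blast
    then show ?thesis by (intro exI[of _ "ext_poly h y (pderiv (pderiv P)) + z * w"]) (simp add: algebra_simps)
  qed
  have "\<pi> (ext_poly h y0 P) = 0" "\<pi> (ext_poly h y0 (pderiv P)) \<noteq> 0"
    using lift'[OF y0] P'(1,3) P(2) poly_over_pderiv[OF S P'(1)] by auto
  from henselianD(4)[OF \<pi>, of "\<lambda>y. ext_poly h y P" "\<lambda>y. ext_poly h y (pderiv P)", OF t1 t2 this]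
  obtain y where y: "\<pi> y = to_frac x" "ext_poly h y P = 0" using y0 by auto
  have "ext_poly h y g = 0" if g: "poly_over S g" "poly g x = 0" for g
  proof -
    obtain k q where q: "poly_over S q" "Polynomial.smult (lead_coeff P ^ k) g = q * P"
      using min_poly_over_dvd[OF S P(1) g] by blast
    have l: "lead_coeff P ^ k \<in> S" "lead_coeff P ^ k \<noteq> 0"
      using P' subring_power[OF S] by (auto simp: poly_over_def)
    have "h (lead_coeff P ^ k) * ext_poly h y g = ext_poly h y (q * P)"
      using ext_poly_smult[OF S h l(1) g(1)] q(2) by simp
    also have "\<dots> = 0" using ext_poly_mult[OF S h q(1) P'(1)] y(2) by simp
    finally show ?thesis using henselianD(3)[OF \<pi>, of "h (lead_coeff P ^ k)"] lift[OF l(1)] l(2) by simp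
  qed
  from hom_on_adjoin[OF S h this] obtain h' where
    h': "hom_on (adjoin S x) h'" "\<And>p. poly_over S p \<Longrightarrow> h' (poly p x) = ext_poly h y p" "\<forall>s\<in>S. h' s = h s" by blast
  have "\<pi> (h' z) = to_frac z" if "z \<in> adjoin S x" for z
    using that h'(2) lift'[OF y(1)] by (auto simp: adjoin_eq[OF S])
  then show ?thesis using h' by blast
qed

lemma extend_hom_separable_tower:
  assumes \<pi>: "henselian \<pi>" and "subring_set S" "hom_on S h"
    and "\<And>s. s \<in> S \<Longrightarrow> \<pi> (h s) = to_frac s" and "separable_tower S xs"
  shows "\<exists>h'. hom_on (tower S xs) h' \<and> (\<forall>s\<in>S. h' s = h s) \<and> (\<forall>z\<in>tower S xs. \<pi> (h' z) = to_frac z)"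
  using assms(2-)
proof (induction xs arbitrary: S h)
  case Nil
  then show ?case by auto
next
  case (Cons x xs)
  obtain h1 where h1: "hom_on (adjoin S x) h1" "\<forall>s\<in>S. h1 s = h s" "\<forall>z\<in>adjoin S x. \<pi> (h1 z) = to_frac z"
    using extend_hom_separable[OF \<pi> Cons.prems(1,2), of x] Cons.prems(3,4) by auto
  obtain h2 where h2: "hom_on (tower S (x # xs)) h2" "\<forall>s\<in>adjoin S x. h2 s = h1 s"
      "\<forall>z\<in>tower S (x # xs). \<pi> (h2 z) = to_frac z"
    using Cons.IH[OF subring_adjoin[OF Cons.prems(1)] h1(1)] h1(3) Cons.prems(4) by auto
  have "\<forall>s\<in>S. h2 s = h s" using h2(2) h1(2) adjoin_base[OF Cons.prems(1)] by simp
  then show ?case using h2 by blast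
qed

section \<open>Dual numbers and power series are Henselian\<close>

text \<open>Dual numbers, with square-zero unit \<open>Dual 0 1\<close>. A homomorphism into them
  that lifts the inclusion is a derivation in its imaginary part, so extending derivations becomes a
  case of extending homomorphisms.\<close>

datatype 'a dual = Dual (dual_re: 'a) (dual_im: 'a)

instantiation dual :: (comm_ring_1) comm_ring_1
begin

definition "0 = Dual 0 0"
definition "1 = Dual 1 0"
definition "a + b = Dual (dual_re a + dual_re b) (dual_im a + dual_im b)"
definition "- a = Dual (- dual_re a) (- dual_im a)" for a :: "'a dual"
definition "a - b = Dual (dual_re a - dual_re b) (dual_im a - dual_im b)"
definition "a * b = Dual (dual_re a * dual_re b) (dual_re a * dual_im b + dual_im a * dual_re b)"

lemmas dual_defs = zero_dual_def one_dual_def plus_dual_def uminus_dual_def minus_dual_def times_dual_def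

instance
  by standard (auto simp: dual_defs algebra_simps dual.expand)

end

lemma dual_re_hom: "hom_on UNIV dual_re"
  by (simp add: hom_on_def dual_defs)

lemma Dual_hom: "hom_on UNIV (\<lambda>a. Dual a 0)"
  by (simp add: hom_on_def dual_defs)

lemma Dual_eq: "Dual a b = Dual a 0 + Dual 0 1 * Dual b 0"
  by (simp add: dual_defs)

text \<open>A single Newton step is exact because the correction has square zero.\<close>

lemma henselian_dual: "henselian (dual_re :: 'q::field dual \<Rightarrow> 'q)"
  unfolding henselian_def
proof (intro conjI allI impI)
  show "hom_on UNIV (dual_re :: 'q dual \<Rightarrow> 'q)" by (rule dual_re_hom)
  show "surj (dual_re :: 'q dual \<Rightarrow> 'q)" by (rule surjI[of _ "\<lambda>a. Dual a 0"]) simp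
  show "c = 0" if "dual_re b \<noteq> 0" "b * c = 0" for b c :: "'q dual"
    using that by (auto simp: dual_defs dual.expand)
  fix g g' :: "'q dual \<Rightarrow> 'q dual" and y0
  assume taylor: "\<forall>y z. \<exists>w. g (y + z) = g y + z * g' y + z * z * w"
    and zero: "dual_re (g y0) = 0" and nz: "dual_re (g' y0) \<noteq> 0"
  define z where "z = Dual 0 (- dual_im (g y0) / dual_re (g' y0))"
  obtain w where w: "g (y0 + z) = g y0 + z * g' y0 + z * z * w" using taylor by blast
  have "g (y0 + z) = 0" unfolding w using zero nz by (simp add: z_def dual_defs)
  moreover have "dual_re (y0 + z) = dual_re y0" by (simp add: z_def dual_defs)
  ultimately show "\<exists>y. dual_re y = dual_re y0 \<and> g y = 0" by blast
qed

text \<open>A correction in degree \<open>k + 1\<close> repairs that coefficient of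
  \<open>g y\<close> and leaves the lower ones alone; the constant term of \<open>g' y\<close> never
  changes and stays invertible. The approximations converge coefficientwise.\<close>

lemma henselian_fps: "henselian (\<lambda>F :: 'q::field fps. fps_nth F 0)"
  unfolding henselian_def
proof (intro conjI allI impI)
  show "hom_on UNIV (\<lambda>F :: 'q fps. fps_nth F 0)" by (simp add: hom_on_def)
  show "surj (\<lambda>F :: 'q fps. fps_nth F 0)" by (rule surjI[of _ fps_const]) simp
  show "c = 0" if "fps_nth b 0 \<noteq> 0" "b * c = 0" for b c :: "'q fps" using that by auto
  fix g g' :: "'q fps \<Rightarrow> 'q fps" and y0
  assume t1: "\<forall>y z. \<exists>w. g (y + z) = g y + z * g' y + z * z * w"
    and t2: "\<forall>y z. \<exists>w. g' (y + z) = g' y + z * w"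
    and zero: "fps_nth (g y0) 0 = 0" and nz: "fps_nth (g' y0) 0 \<noteq> 0"
  define P where "P k y \<longleftrightarrow> fps_nth y 0 = fps_nth y0 0 \<and> (\<forall>i\<le>k. fps_nth (g y) i = 0)" for k :: nat and y
  define Q where "Q k y y' \<longleftrightarrow> (\<forall>i\<le>k. fps_nth y i = fps_nth y' i)" for k :: nat and y y' :: "'q fps"
  have "\<exists>y'. P (Suc k) y' \<and> Q k y y'" if y: "P k y" for k y
  proof -
    have g'y: "fps_nth (g' y) 0 = fps_nth (g' y0) 0"
    proof -
      obtain w where "g' (y0 + (y - y0)) = g' y0 + (y - y0) * w" using t2 by blast
      then show ?thesis using y by (simp add: P_def)
    qed
    define N where "N = Suc k"
    have "0 < N" by (simp add: N_def)
    define c where "c = - fps_nth (g y) N / fps_nth (g' y0) 0"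
    define z where "z = fps_X ^ N * fps_const c"
    obtain w where w: "g (y + z) = g y + z * g' y + z * z * w" using t1 by blast
    have z: "z * g' y = fps_X ^ N * (fps_const c * g' y)"
        "z * z * w = fps_X ^ (N + N) * (fps_const c * fps_const c * w)"
      by (simp_all add: z_def power_add mult_ac)
    have coef: "fps_nth (g (y + z)) i = 0" if "i \<le> N" for i
    proof (cases "i = N")
      case True
      have "fps_nth (g (y + z)) i = fps_nth (g y) N + c * fps_nth (g' y) 0"
        unfolding w z fps_add_nth fps_X_power_mult_nth using True \<open>0 < N\<close> by simp
      then show ?thesis using nz g'y by (simp add: c_def)
    next
      case False
      then have "i < N" using that by simp
      then show ?thesis
        unfolding w z fps_add_nth fps_X_power_mult_nth using y by (simp add: P_def N_def)
    qed
    have "P (Suc k) (y + z)"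
      using coef y \<open>0 < N\<close> by (simp add: P_def z_def fps_X_power_mult_nth flip: N_def)
    moreover have "Q k y (y + z)" by (auto simp: Q_def z_def fps_X_power_mult_nth N_def simp del: power_Suc)
    ultimately show ?thesis by blast
  qed
  moreover have "P 0 y0" using zero by (simp add: P_def)
  ultimately obtain Y where Y: "\<And>k. P k (Y k)" "\<And>k. Q k (Y k) (Y (Suc k))"
    using dependent_nat_choice[of P Q] by blast
  \<comment> \<open>The diagonal is the limit, since coefficient \<open>i\<close> no longer changes
    from \<open>Y i\<close> on. So \<open>y\<close> and \<open>Y k\<close> differ by a multiple of
    \<open>fps_X ^ Suc k\<close>, and the expansion of \<open>g\<close> transfers the vanishing of
    its coefficient \<open>k\<close>.\<close>
  define y where "y = Abs_fps (\<lambda>i. fps_nth (Y i) i)"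
  have stable: "fps_nth (Y l) i = fps_nth (Y k) i" if "i \<le> k" "k \<le> l" for i k l
    using that(2)
  proof (induction l rule: dec_induct)
    case (step l)
    have "fps_nth (Y l) i = fps_nth (Y (Suc l)) i" using Y(2)[of l] that(1) step.hyps(1) by (simp add: Q_def)
    then show ?case using step.IH by simp
  qed simp
  have "fps_nth (g y) k = 0" for k
  proof -
    define z where "z = fps_shift (Suc k) (y - Y k)"
    have "y - Y k = fps_X ^ Suc k * z"
    proof (rule fps_ext)
      fix i
      show "fps_nth (y - Y k) i = fps_nth (fps_X ^ Suc k * z) i"
        unfolding fps_X_power_mult_nth using stable[of i i k] by (auto simp: z_def y_def)
    qed
    moreover obtain w where "g (Y k + (y - Y k)) = g (Y k) + (y - Y k) * g' (Y k) + (y - Y k) * (y - Y k) * w"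
      using t1 by blast
    ultimately have gy: "g y = g (Y k) + fps_X ^ Suc k * (z * g' (Y k) + z * (y - Y k) * w)"
      by (simp add: algebra_simps del: power_Suc)
    show ?thesis
      unfolding gy fps_add_nth fps_X_power_mult_nth using Y(1)[of k] by (simp add: P_def)
  qed
  then have "g y = 0" by (intro fps_ext) simp
  moreover have "fps_nth y 0 = fps_nth y0 0" using Y(1)[of 0] by (simp add: y_def P_def)
  ultimately show "\<exists>y. fps_nth y 0 = fps_nth y0 0 \<and> g y = 0" by blast
qed

text \<open>Evaluation at \<open>x\<close> plus the dual unit differentiates: this is d/dx on
  \<open>adjoin S x\<close>, trivial on \<open>S\<close>.\<close>

lemma ext_poly_dual:
  assumes S: "subring_set S" and h: "hom_on S h" and triv: "\<And>s. s \<in> S \<Longrightarrow> h s = Dual (to_frac s) 0"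
  shows "poly_over S p \<Longrightarrow> ext_poly h (Dual (to_frac x) 1) p = Dual (to_frac (poly p x)) (to_frac (poly (pderiv p) x))"
proof (induction p)
  case 0
  show ?case by (simp add: ext_poly_0[OF S h] dual_defs)
next
  case (pCons a p)
  then show ?case
    by (simp add: ext_poly_pCons[OF S h] poly_over_pCons triv pderiv_pCons dual_defs)
qed

text \<open>A first inseparable or transcendental step \<open>x\<close> admits the derivation
  \<open>d/dx\<close>, which extends along the remaining separable steps.\<close>

lemma derivation_of_nonseparable_tower:
  assumes "subring_set S" "\<not> separable_tower S xs"
  shows "\<exists>h. hom_on (tower S xs) h \<and> (\<forall>z\<in>tower S xs. dual_re (h z) = to_frac z) \<and>
    (\<forall>s\<in>S. h s = Dual (to_frac s) 0) \<and> (\<exists>x\<in>set xs. h x \<noteq> Dual (to_frac x) 0)"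
  using assms
proof (induction xs arbitrary: S)
  case Nil
  then show ?case by simp
next
  case (Cons x xs)
  note S = Cons.prems(1)
  note adj = subring_adjoin[OF S, of x]
  \<comment> \<open>Splitting on the tail singles out a step that is not separable and is followed
    by separable steps only, along which the derivation can be extended.\<close>
  show ?case
  proof (cases "separable_tower (adjoin S x) xs")
    case False
    from Cons.IH[OF adj False] show ?thesis using adjoin_base[OF S] by auto
  next
    case True
    then have insep: "\<not> separable_over S x" using Cons.prems by simp
    let ?h = "\<lambda>s :: 'a. Dual (to_frac s) 0"
    have h: "hom_on S ?h" by (simp add: hom_on_def dual_defs)
    \<comment> \<open>This makes d/dx well defined. Without relations there is nothing to check;
      otherwise failing separability kills the derivative of \<open>P\<close> at \<open>x\<close>,
      and the product rule passes this on to all multiples of \<open>P\<close>.\<close>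
    have deriv: "poly (pderiv g) x = 0" if g: "poly_over S g" "poly g x = 0" for g
    proof (cases "g = 0")
      case False
      obtain P where P: "min_poly_over S x P" using min_poly_over_exists g False by blast
      then have P': "P \<noteq> 0" "poly P x = 0" "poly (pderiv P) x = 0"
        using insep by (auto simp: min_poly_over_def separable_over_def)
      obtain k q where q: "Polynomial.smult (lead_coeff P ^ k) g = q * P"
        using min_poly_over_dvd[OF S P g] by blast
      have "lead_coeff P ^ k * poly (pderiv g) x = poly (pderiv (Polynomial.smult (lead_coeff P ^ k) g)) x"
        by (simp add: pderiv_smult)
      also have "\<dots> = 0" unfolding q using P' by (simp add: pderiv_mult)
      finally show ?thesis using P' by simp
    qed simp
    have "ext_poly ?h (Dual (to_frac x) 1) p = 0" if "poly_over S p" "poly p x = 0" for p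
      using ext_poly_dual[OF S h _ that(1), of x] deriv[OF that] that(2) by (simp add: dual_defs)
    from hom_on_adjoin[OF S h this] obtain h1 where h1: "hom_on (adjoin S x) h1"
      "\<forall>p. poly_over S p \<longrightarrow> h1 (poly p x) = ext_poly ?h (Dual (to_frac x) 1) p"
      "\<forall>s\<in>S. h1 s = ?h s" "h1 x = Dual (to_frac x) 1" by blast
    have "dual_re (h1 z) = to_frac z" if "z \<in> adjoin S x" for z
      using that h1(2) ext_poly_dual[OF S h, of _ x] by (auto simp: adjoin_eq[OF S])
    from extend_hom_separable_tower[OF henselian_dual adj h1(1) this True]
    obtain h2 where h2: "hom_on (tower S (x # xs)) h2" "\<forall>s\<in>adjoin S x. h2 s = h1 s"
      "\<forall>z\<in>tower S (x # xs). dual_re (h2 z) = to_frac z" by auto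
    have "h2 x \<noteq> Dual (to_frac x) 0" using h2(2) h1(4) adjoin_self[OF S, of x] by simp
    moreover have "\<forall>s\<in>S. h2 s = ?h s" using h2(2) h1(3) adjoin_base[OF S] by simp
    ultimately show ?thesis using h2 by auto
  qed
qed

text \<open>The Taylor expansion with the dual unit as increment is exact; the imaginary part is the
  directional derivative along \<open>d\<close>.\<close>

lemma eval_dual:
  assumes \<phi>: "alg_struct \<phi>" and "finite V" "poly_vars_in V p"
  shows "eval_mpoly (\<lambda>c. Dual (\<phi> c) 0) (\<lambda>j. Dual (u j) (d j)) p =
    Dual (eval_mpoly \<phi> u p) (\<Sum>j\<in>V. eval_mpoly \<phi> u (pderiv_mpoly j p) * d j)"
proof -
  let ?\<psi> = "\<lambda>c. Dual (\<phi> c) 0" and ?u = "\<lambda>j. Dual (u j) 0"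
  have \<psi>: "alg_struct ?\<psi>" using alg_struct_comp[OF \<phi> Dual_hom] .
  have ev: "eval_mpoly ?\<psi> ?u q = Dual (eval_mpoly \<phi> u q) 0" for q
    using eval_hom[OF \<phi> Dual_hom, of u q]
    by simp
  obtain w where "eval_mpoly ?\<psi> (\<lambda>j. ?u j + Dual 0 1 * Dual (d j) 0) p =
     eval_mpoly ?\<psi> ?u p + Dual 0 1 * (\<Sum>j\<in>V. eval_mpoly ?\<psi> ?u (pderiv_mpoly j p) * Dual (d j) 0) + (Dual 0 1)\<^sup>2 * w"
    using eval_taylor[OF \<psi> assms(2,3), of ?u "Dual 0 1" "\<lambda>j. Dual (d j) 0"] by blast
  moreover have "(Dual 0 1 :: 'b dual)\<^sup>2 = 0" by (simp add: power2_eq_square dual_defs)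
  moreover have "(\<Sum>j\<in>V. eval_mpoly ?\<psi> ?u (pderiv_mpoly j p) * Dual (d j) 0) =
      Dual (\<Sum>j\<in>V. eval_mpoly \<phi> u (pderiv_mpoly j p) * d j) 0"
    by (subst hom_on_sum[OF subring_UNIV Dual_hom]) (auto simp: ev hom_onD[OF Dual_hom])
  ultimately show ?thesis by (simp add: ev flip: Dual_eq)
qed

section \<open>Algebraic independence of the free coordinates\<close>

lemma keys_sum_single: "r \<in> keys (\<Sum>t\<in>A. single (g t) (c t)) \<Longrightarrow> \<exists>t\<in>A. r = g t"
  using subsetD[OF Poly_Mapping.keys_sum, of r "\<lambda>t. single (g t) (c t)" A] by (auto split: if_splits)

lemma lookup_sum_single:
  assumes "finite A" "inj_on g A" "t \<in> A"
  shows "lookup (\<Sum>t\<in>A. single (g t) (c t)) (g t) = c t"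
proof -
  have "lookup (\<Sum>t\<in>A. single (g t) (c t)) (g t) = (\<Sum>s\<in>A. if s = t then c s else 0)"
    unfolding lookup_sum using inj_onD[OF assms(2) _ _ assms(3)]
    by (intro sum.cong) (auto simp: lookup_single when_def)
  then show ?thesis using assms by simp
qed

definition tdeg :: "(nat \<Rightarrow>\<^sub>0 nat) \<Rightarrow> nat" where
  "tdeg t = (\<Sum>j\<in>keys t. lookup t j)"

lemma tdeg_superset:
  "finite V \<Longrightarrow> keys t \<subseteq> V \<Longrightarrow> tdeg t = (\<Sum>j\<in>V. lookup t j)"
  unfolding tdeg_def by (rule sum.mono_neutral_left) (auto simp: in_keys_iff)

lemma tdeg_eq_0: "tdeg t = 0 \<Longrightarrow> t = 0"
  by (intro poly_mapping_eqI) (auto simp: tdeg_def in_keys_iff)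

lemma minus_single_add:
  "lookup t k \<noteq> 0 \<Longrightarrow> t - single k 1 + single k (1 :: nat) = t"
  by (intro poly_mapping_eqI) (auto simp: lookup_add lookup_minus lookup_single when_def)

lemma keys_minus_single: "keys (t - single k (1 :: nat)) \<subseteq> keys t"
  by (auto simp: in_keys_iff lookup_minus)

lemma tdeg_minus_single:
  assumes "lookup t k \<noteq> 0"
  shows "tdeg (t - single k 1) < tdeg t"
proof -
  let ?V = "keys t"
  have "(\<Sum>j\<in>?V. lookup (t - single k 1) j) < (\<Sum>j\<in>?V. lookup t j)"
    by (rule sum_strict_mono_ex1) (use assms in \<open>auto simp: lookup_minus in_keys_iff intro!: bexI[of _ k]\<close>)
  then show ?thesis using tdeg_superset[OF _ keys_minus_single] by (simp add: tdeg_def)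
qed

lemma keys_pderiv:
  assumes "\<beta> \<in> keys (pderiv_mpoly k p)"
  shows "\<exists>t\<in>keys p. lookup t k \<noteq> 0 \<and> \<beta> = t - single k 1"
proof -
  have "\<beta> \<in> (\<Union>t\<in>keys p. keys (if lookup t k = 0 then 0
      else single (t - single k 1) (of_nat (lookup t k) * lookup p t)))"
    by (rule subsetD[OF Poly_Mapping.keys_sum assms[unfolded pderiv_mpoly_def]])
  then show ?thesis by (auto split: if_splits)
qed

lemma poly_vars_in_pderiv:
  assumes "poly_vars_in V p"
  shows "poly_vars_in V (pderiv_mpoly k p)"
  unfolding poly_vars_in_def
proof
  fix \<beta> assume "\<beta> \<in> keys (pderiv_mpoly k p)"
  then obtain t where "t \<in> keys p" "\<beta> = t - single k 1"
    using keys_pderiv by blast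
  then show "keys \<beta> \<subseteq> V"
    using assms keys_minus_single[of t k] by (auto simp: poly_vars_in_def)
qed

lemma pderiv_eq_0:
  assumes "poly_vars_in V p" "k \<notin> V"
  shows "pderiv_mpoly k p = 0"
proof -
  have "\<beta> \<notin> keys (pderiv_mpoly k p)" for \<beta>
  proof
    assume "\<beta> \<in> keys (pderiv_mpoly k p)"
    then obtain t where "t \<in> keys p" "k \<in> keys t"
      using keys_pderiv by (metis in_keys_iff)
    then show False using assms unfolding poly_vars_in_def by blast
  qed
  then show ?thesis by (intro poly_mapping_eqI) (simp add: in_keys_iff)
qed

text \<open>Lowering the exponent of \<open>k\<close> is injective on monomials containing
  \<open>k\<close>, so no other term of the derivative contributes here.\<close>

lemma lookup_pderiv:
  assumes "lookup t k \<noteq> 0"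
  shows "lookup (pderiv_mpoly k p) (t - single k 1) =
    of_nat (lookup t k) * lookup p t"
proof -
  let ?g = "\<lambda>\<beta>. if lookup \<beta> k = 0 then 0
      else single (\<beta> - single k 1) (of_nat (lookup \<beta> k) * lookup p \<beta>)"
  have "lookup (?g \<beta>) (t - single k 1) =
      (if \<beta> = t then of_nat (lookup t k) * lookup p t else 0)" for \<beta>
  proof -
    have "\<beta> = t" if "lookup \<beta> k \<noteq> 0" "\<beta> - single k 1 = t - single k 1"
      using minus_single_add[OF assms] minus_single_add[OF that(1)] that(2) by metis
    then show ?thesis using assms by (auto simp: lookup_single when_def)
  qed
  then show ?thesis
    unfolding pderiv_mpoly_def by (simp add: lookup_sum in_keys_iff)
qed

text \<open>\<open>C\<close> holds the cofactors of the minor \<open>\<Delta>\<close> with rows \<open>I\<close> and columns \<open>J\<close>, and \<open>q j\<close> expresses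
  column \<open>j\<close> through the columns in \<open>J\<close>; together they encode that \<open>\<Delta>\<close> has the size of the rank.\<close>

locale jacobian_minor =
  fixes \<phi> :: "'k::field \<Rightarrow> 'a::idom" and x :: "nat \<Rightarrow> 'a" and n m :: nat and f :: "nat \<Rightarrow> 'k kpoly"
    and I J :: "nat set" and \<Delta> :: 'a and C :: "nat \<Rightarrow> nat \<Rightarrow> 'a" and q :: "nat \<Rightarrow> nat \<Rightarrow> 'a fract"
  assumes perfect: "perfect_field TYPE('k)"
    and alg: "alg_struct \<phi>"
    and f_Pn: "\<And>i. i < m \<Longrightarrow> in_Pn n (f i)"
    and ker: "\<And>p. in_Pn n p \<Longrightarrow> eval_mpoly \<phi> x p = 0 \<longleftrightarrow> (\<exists>g. (\<forall>i<m. in_Pn n (g i)) \<and> p = (\<Sum>i<m. g i * f i))"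
    and loc: "\<And>a. \<exists>p q. in_Pn n p \<and> in_Pn n q \<and> (\<exists>v. eval_mpoly \<phi> x q * v = 1) \<and> a * eval_mpoly \<phi> x q = eval_mpoly \<phi> x p"
    and I: "I \<subseteq> {..<m}" and J: "J \<subseteq> {..<n}" and \<Delta>: "\<Delta> \<noteq> 0"
    and cofactor: "\<And>j l. j \<in> J \<Longrightarrow> l \<in> J \<Longrightarrow>
      (\<Sum>i\<in>I. C j i * eval_mpoly \<phi> x (pderiv_mpoly l (f i))) = (if j = l then \<Delta> else 0)"
    and columns: "\<And>i j. i < m \<Longrightarrow> j < n \<Longrightarrow> to_frac (eval_mpoly \<phi> x (pderiv_mpoly j (f i))) =
      (\<Sum>l\<in>J. to_frac (eval_mpoly \<phi> x (pderiv_mpoly l (f i))) * q j l)"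
begin

abbreviation "ev \<equiv> eval_mpoly \<phi> x"

abbreviation "jac i j \<equiv> ev (pderiv_mpoly j (f i))"

definition T :: "nat set" where
  "T = {..<n} - J"

lemma finite_IJT: "finite I" "finite J" "finite T"
  using I J finite_subset by (auto simp: T_def)

lemma T_subset: "T \<subseteq> {..<n}"
  by (auto simp: T_def)

lemma sum_T_J: "(\<Sum>j<n. g j) = (\<Sum>j\<in>T. g j) + (\<Sum>j\<in>J. g j)"
proof -
  have "{..<n} = T \<union> J" "T \<inter> J = {}" using J by (auto simp: T_def)
  then show ?thesis using finite_IJT by (simp add: sum.union_disjoint)
qed

lemma f_eval: "i < m \<Longrightarrow> ev (f i) = 0"
proof -
  assume i: "i < m"
  have "f i = (\<Sum>k<m. (if k = i then 1 else 0) * f k)" using i by (simp add: if_distrib[of "\<lambda>u. u * _"] cong: if_cong)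
  moreover have "in_Pn n (if k = i then 1 else 0 :: 'k kpoly)" for k by (simp add: in_Pn_iff poly_vars_in_0 poly_vars_in_1)
  ultimately have "\<exists>g. (\<forall>i<m. in_Pn n (g i)) \<and> f i = (\<Sum>i<m. g i * f i)"
    by (intro exI[of _ "\<lambda>k. if k = i then 1 else 0"]) blast
  then show ?thesis using ker[OF f_Pn[OF i]] by blast
qed

text \<open>Cramer's rule with the cofactors \<open>C\<close>. It serves twice: to show that
  derivations vanish and to bound denominators of power series coefficients.\<close>

lemma jac_solve:
  assumes s: "\<And>i. i \<in> I \<Longrightarrow> (\<Sum>l\<in>J. to_frac (jac i l) * z l) = s i" and j: "j \<in> J"
  shows "to_frac \<Delta> * z j = (\<Sum>i\<in>I. to_frac (C j i) * s i)"
proof -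
  have "(\<Sum>i\<in>I. to_frac (C j i) * s i) = (\<Sum>i\<in>I. \<Sum>l\<in>J. to_frac (C j i * jac i l) * z l)"
    using s by (simp add: sum_distrib_left mult.assoc flip: s)
  also have "\<dots> = (\<Sum>l\<in>J. to_frac (\<Sum>i\<in>I. C j i * jac i l) * z l)"
    by (subst sum.swap) (simp add: hom_on_sum[OF subring_UNIV to_frac_hom] sum_distrib_right)
  also have "\<dots> = to_frac \<Delta> * z j"
    using j finite_IJT by (simp add: cofactor if_distrib[of to_frac] if_distrib[of "\<lambda>u. u * _"] cong: if_cong)
  finally show ?thesis by simp
qed

text \<open>The product rule is read off from multiplication of dual numbers, evaluating with the
  dual unit added to coordinate \<open>j\<close>. Terms with \<open>f i\<close> left
  undifferentiated vanish at \<open>x\<close>.\<close>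

lemma eval_pderiv_combination:
  assumes g: "\<And>i. i < m \<Longrightarrow> in_Pn n (g i)" and j: "j < n"
  shows "ev (pderiv_mpoly j (\<Sum>i<m. g i * f i)) = (\<Sum>i<m. ev (g i) * jac i j)"
proof -
  let ?\<psi> = "\<lambda>c. Dual (\<phi> c) 0" and ?y = "\<lambda>i. Dual (x i) (if i = j then 1 else 0)"
  have \<psi>: "alg_struct ?\<psi>" using alg_struct_comp[OF alg Dual_hom] .
  have im: "dual_im (eval_mpoly ?\<psi> ?y p) = ev (pderiv_mpoly j p)" if "in_Pn n p" for p
    using eval_dual[OF alg, of "{..<n}" p x "\<lambda>i. if i = j then 1 else 0"] that j
    by (simp add: in_Pn_iff if_distrib cong: if_cong)
  have re: "dual_re (eval_mpoly ?\<psi> ?y p) = ev p" if "in_Pn n p" for p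
    using eval_dual[OF alg, of "{..<n}" p x "\<lambda>i. if i = j then 1 else 0"] that by (simp add: in_Pn_iff)
  have im_hom: "dual_im (sum u A) = (\<Sum>i\<in>A. dual_im (u i))" for u :: "nat \<Rightarrow> 'a dual" and A
    by (induction A rule: infinite_finite_induct) (simp_all add: dual_defs)
  have "in_Pn n (\<Sum>i<m. g i * f i)"
    using g f_Pn unfolding in_Pn_iff by (intro poly_vars_in_sum poly_vars_in_mult) auto
  then have "ev (pderiv_mpoly j (\<Sum>i<m. g i * f i)) =
      (\<Sum>i<m. dual_im (eval_mpoly ?\<psi> ?y (g i) * eval_mpoly ?\<psi> ?y (f i)))"
    using im by (simp add: eval_sum[OF \<psi>] eval_mult[OF \<psi>] im_hom flip: im)
  also have "\<dots> = (\<Sum>i<m. ev (g i) * jac i j)"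
    by (rule sum.cong) (auto simp: times_dual_def re im g f_Pn f_eval)
  finally show ?thesis .
qed

text \<open>The gradient of a relation is a combination of rows of the Jacobi matrix, and its
  columns are combinations of those in \<open>J\<close>. Entries outside \<open>J\<close> are
  therefore determined by the entries in \<open>J\<close>.\<close>

lemma gradient_zero:
  assumes P: "in_Pn n P" "ev P = 0"
    and J0: "\<And>l. l \<in> J \<Longrightarrow> ev (pderiv_mpoly l P) = 0" and j: "j < n"
  shows "ev (pderiv_mpoly j P) = 0"
proof -
  obtain g where g: "\<And>i. i < m \<Longrightarrow> in_Pn n (g i)" "P = (\<Sum>i<m. g i * f i)" using ker P by blast
  have d: "to_frac (ev (pderiv_mpoly j P)) = (\<Sum>i<m. to_frac (ev (g i)) * to_frac (jac i j))"
    if "j < n" for j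
    unfolding g(2) using eval_pderiv_combination[OF g(1) that]
    by (simp add: hom_on_sum[OF subring_UNIV to_frac_hom])
  have "to_frac (ev (pderiv_mpoly j P)) =
      (\<Sum>i<m. \<Sum>l\<in>J. to_frac (ev (g i)) * to_frac (jac i l) * q j l)"
    unfolding d[OF j] using columns j by (simp add: sum_distrib_left mult.assoc)
  also have "\<dots> = (\<Sum>l\<in>J. to_frac (ev (pderiv_mpoly l P)) * q j l)"
    using J by (subst sum.swap) (auto simp: d sum_distrib_right intro!: sum.cong)
  also have "\<dots> = 0" using J0 by simp
  finally show ?thesis by simp
qed

text \<open>A relation of least degree has vanishing partial derivatives, hence is a \<open>p\<close>-th power
  of a smaller relation, as the field is perfect.\<close>

lemma free_coordinates_independent:
  assumes "poly_vars_in T P" "ev P = 0"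
  shows "P = 0"
proof -
  have inj: "\<phi> c = 0 \<longleftrightarrow> c = 0" for c using alg_struct_eq_0_iff[OF alg] by simp
  have const: "P = 0" if "keys P \<subseteq> {0}" "ev P = 0" for P :: "'k kpoly"
  proof -
    have "ev P = \<phi> (lookup P 0)"
      using eval_mpoly_superset[OF alg _ that(1)] by simp
    then have "0 \<notin> keys P" using that(2) inj by (simp add: in_keys_iff)
    then show ?thesis using that(1) by (metis keys_eq_empty subset_singletonD singletonI)
  qed
  have "P = 0" if "\<forall>t\<in>keys P. tdeg t \<le> N" "poly_vars_in T P" "ev P = 0" for N and P :: "'k kpoly"
    using that
  proof (induction N arbitrary: P rule: less_induct)
    case (less N)
    show ?case
    proof (cases "\<forall>t\<in>keys P. tdeg t = 0")
      case True
      then have "keys P \<subseteq> {0}" using tdeg_eq_0 by auto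
      then show ?thesis using less.prems(3) by (rule const)
    next
      case False
      then have "N > 0" using less.prems(1) by force
      have Pn: "in_Pn n P" using less.prems(2) poly_vars_in_mono[OF T_subset] by (simp add: in_Pn_iff)
      have pJ: "pderiv_mpoly l P = 0" if "l \<in> J" for l
        using less.prems(2) that by (intro pderiv_eq_0[of T]) (auto simp: T_def)
      have zero: "ev (pderiv_mpoly k P) = 0" if "k \<in> T" for k
      proof (rule gradient_zero[OF Pn less.prems(3)])
        show "ev (pderiv_mpoly l P) = 0" if "l \<in> J" for l
          by (simp only: pJ[OF that] eval_0[OF alg])
        show "k < n" using that T_subset by blast
      qed
      have dP: "pderiv_mpoly k P = 0" if "k \<in> T" for k
      proof (rule less.IH[of "N - 1"])
        show "\<forall>t\<in>keys (pderiv_mpoly k P). tdeg t \<le> N - 1"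
        proof
          fix \<beta> assume "\<beta> \<in> keys (pderiv_mpoly k P)"
          then obtain t where "t \<in> keys P" "lookup t k \<noteq> 0" "\<beta> = t - single k 1"
            using keys_pderiv by blast
          then have "tdeg \<beta> < tdeg t" "tdeg t \<le> N" using tdeg_minus_single less.prems(1) by auto
          then show "tdeg \<beta> \<le> N - 1" by simp
        qed
      qed (use \<open>N > 0\<close> less.prems(2) zero that in \<open>auto intro: poly_vars_in_pderiv\<close>)
      have ch: "CHAR('k) dvd lookup t k" if t: "t \<in> keys P" for t k
      proof (cases "lookup t k = 0")
        case False
        then have "k \<in> keys t" by (simp add: in_keys_iff)
        then have "k \<in> T" using less.prems(2) t unfolding poly_vars_in_def by blast
        have "of_nat (lookup t k) * lookup P t = 0"
          using lookup_pderiv[OF False, of P] dP[OF \<open>k \<in> T\<close>] by simp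
        then have "of_nat (lookup t k) = (0 :: 'k)" using t by (simp add: in_keys_iff)
        then show ?thesis by (simp add: of_nat_eq_0_iff_char_dvd)
      qed simp
      \<comment> \<open>In characteristic 0 the divisibility \<open>ch\<close> would make every
        exponent zero, but the present case has a nonconstant monomial.\<close>
      have "CHAR('k) \<noteq> 0"
      proof
        assume "CHAR('k) = 0"
        then have "t = 0" if "t \<in> keys P" for t
          using ch[OF that] by (intro poly_mapping_eqI) simp
        moreover have "tdeg 0 = 0" by (simp add: tdeg_def)
        ultimately show False using False by blast
      qed
      define p where "p = CHAR('k)"
      have "prime p" using \<open>CHAR('k) \<noteq> 0\<close> prime_CHAR_semidom[where 'a = 'k] by (simp add: p_def)
      then have "p > 1" by (rule prime_gt_1_nat)
      have charA: "CHAR('a) = p"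
        unfolding p_def by (rule CHAR_eqI)
          (simp_all add: inj of_nat_eq_0_iff_char_dvd flip: alg_struct_of_nat[OF alg])
      have "\<forall>y :: 'k. \<exists>z. z ^ p = y" using perfect \<open>CHAR('k) \<noteq> 0\<close> by (simp add: perfect_field_def p_def)
      then obtain rt :: "'k \<Rightarrow> 'k" where rt: "\<And>y. rt y ^ p = y" by metis
      define \<rho> where "\<rho> = (\<lambda>t :: nat \<Rightarrow>\<^sub>0 nat. Poly_Mapping.map (\<lambda>k. k div p) t)"
      have \<rho>: "lookup (\<rho> t) k = lookup t k div p" for t k
        by (simp add: \<rho>_def Poly_Mapping.map.rep_eq when_def)
      have keys_\<rho>: "keys (\<rho> t) \<subseteq> keys t" for t
        using \<rho> by (metis div_0 in_keys_iff subsetI)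
      have \<rho>_inj: "t = \<beta>" if "\<rho> t = \<rho> \<beta>" "t \<in> keys P" "\<beta> \<in> keys P" for t \<beta>
      proof (rule poly_mapping_eqI)
        fix k
        have "lookup t k div p = lookup \<beta> k div p" using that(1) \<rho> by metis
        then show "lookup t k = lookup \<beta> k"
          using ch[OF that(2), of k] ch[OF that(3), of k] by (metis p_def dvd_div_mult_self)
      qed
      \<comment> \<open>The formal p-th root of \<open>P\<close>: exponents divided by
        \<open>p\<close>, coefficients replaced by p-th roots, which exist by perfectness. Only the
        evaluated identity is needed, where additivity of Frobenius in the domain gives it.\<close>
      define G where "G = (\<Sum>t\<in>keys P. single (\<rho> t) (rt (lookup P t)))"
      have mono: "mono_val x (\<rho> t) ^ p = mono_val x t" if "t \<in> keys P" for t
      proof -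
        have "mono_val x (\<rho> t) ^ p = (\<Prod>k\<in>keys t. (x k ^ (lookup t k div p)) ^ p)"
          by (simp add: mono_val_superset[OF _ keys_\<rho>] \<rho> prod_power_distrib)
        also have "\<dots> = mono_val x t"
          unfolding mono_val_def using ch[OF that] by (intro prod.cong) (simp_all add: p_def flip: power_mult)
        finally show ?thesis .
      qed
      have "ev G ^ p = (\<Sum>t\<in>keys P. (\<phi> (rt (lookup P t)) * mono_val x (\<rho> t)) ^ p)"
        unfolding G_def eval_sum[OF alg] eval_single[OF alg]
        using freshmans_dream_sum[where 'a = 'a] \<open>prime p\<close> charA by simp
      also have "\<dots> = ev P"
        unfolding eval_mpoly_eq
      proof (rule sum.cong)
        fix t assume "t \<in> keys P"
        have "\<phi> c ^ p = \<phi> (c ^ p)" for c using hom_on_power[OF subring_UNIV alg_struct_hom_on[OF alg]] by simp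
        then show "(\<phi> (rt (lookup P t)) * mono_val x (\<rho> t)) ^ p = \<phi> (lookup P t) * mono_val x t"
          by (simp add: power_mult_distrib rt mono[OF \<open>t \<in> _\<close>])
      qed simp
      finally have G0: "ev G = 0" using less.prems(3) \<open>p > 1\<close> by simp
      note keysG = keys_sum_single[of _ \<rho> "\<lambda>t. rt (lookup P t)" "keys P", folded G_def]
      have "G = 0"
      proof (rule less.IH[of "N - 1"])
        show "N - 1 < N" using \<open>N > 0\<close> by simp
        show "\<forall>\<beta>\<in>keys G. tdeg \<beta> \<le> N - 1"
        proof
          fix \<beta> assume "\<beta> \<in> keys G"
          then obtain t where t: "t \<in> keys P" "\<beta> = \<rho> t" using keysG by blast
          have "tdeg \<beta> = (\<Sum>k\<in>keys t. lookup t k div p)"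
            using tdeg_superset[OF _ keys_\<rho>, of t] t(2) by (simp add: \<rho>)
          also have "\<dots> \<le> (\<Sum>k\<in>keys t. lookup t k) - 1"
          proof (cases "keys t = {}")
            case False
            have "(\<Sum>k\<in>keys t. lookup t k div p) < (\<Sum>k\<in>keys t. lookup t k)"
              using False \<open>p > 1\<close> by (intro sum_strict_mono) (auto simp: in_keys_iff)
            then show ?thesis by simp
          qed simp
          also have "\<dots> \<le> N - 1" using less.prems(1) t(1) by (intro diff_le_mono) (simp add: tdeg_def)
          finally show "tdeg \<beta> \<le> N - 1" .
        qed
        show "poly_vars_in T G"
          unfolding poly_vars_in_def
        proof
          fix \<beta> assume "\<beta> \<in> keys G"
          then obtain t where "t \<in> keys P" "\<beta> = \<rho> t" using keysG by blast
          then show "keys \<beta> \<subseteq> T"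
            using less.prems(2) keys_\<rho>[of t] unfolding poly_vars_in_def by blast
        qed
      qed (rule G0)
      have "lookup P t = 0" for t
      proof (rule ccontr)
        assume "lookup P t \<noteq> 0"
        then have t: "t \<in> keys P" by (simp add: in_keys_iff)
        have "inj_on \<rho> (keys P)" using \<rho>_inj by (intro inj_onI)
        from lookup_sum_single[OF _ this t, of "\<lambda>t. rt (lookup P t)"]
        have "rt (lookup P t) = 0" using \<open>G = 0\<close> by (simp add: G_def)
        then have "lookup P t = 0 ^ p" using rt[of "lookup P t"] by simp
        then have "lookup P t = 0" using \<open>p > 1\<close> by (simp add: power_0_left)
        with \<open>lookup P t \<noteq> 0\<close> show False by simp
      qed
      then show ?thesis by (intro poly_mapping_eqI) simp
    qed
  qed
  moreover have "\<forall>t\<in>keys P. tdeg t \<le> Max (tdeg ` keys P)" by simp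
  ultimately show ?thesis using assms by blast
qed

section \<open>The coordinate ring as a separable tower over the free coordinates\<close>

definition eval_ring :: "nat set \<Rightarrow> 'a set" where
  "eval_ring V = {ev p |p. poly_vars_in V p}"

lemma eval_ringI: "poly_vars_in V p \<Longrightarrow> ev p \<in> eval_ring V"
  by (auto simp: eval_ring_def)

lemma subring_eval_ring: "subring_set (eval_ring V)"
  unfolding subring_set_def
proof (intro conjI ballI)
  show "1 \<in> eval_ring V" using eval_ringI[OF poly_vars_in_1] eval_1[OF alg] by metis
  show "- a \<in> eval_ring V" if "a \<in> eval_ring V" for a
  proof -
    obtain p where "poly_vars_in V p" "a = ev p" using \<open>a \<in> _\<close> by (auto simp: eval_ring_def)
    then show ?thesis using eval_ringI[OF poly_vars_in_uminus] eval_uminus[OF alg] by metis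
  qed
  fix a b assume "a \<in> eval_ring V" "b \<in> eval_ring V"
  then obtain p q where pq: "poly_vars_in V p" "poly_vars_in V q" "a = ev p" "b = ev q"
    by (auto simp: eval_ring_def)
  show "a + b \<in> eval_ring V" "a * b \<in> eval_ring V"
    using eval_ringI[OF poly_vars_in_add[OF pq(1,2)]] eval_ringI[OF poly_vars_in_mult[OF pq(1,2)]] pq(3,4)
    by (simp_all add: eval_add[OF alg] eval_mult[OF alg])
qed

lemma const_in_eval_ring: "\<phi> c \<in> eval_ring V"
  using eval_ringI[of V "single 0 c"] by (simp add: eval_single[OF alg] poly_vars_in_single)

lemma var_in_eval_ring: "j \<in> V \<Longrightarrow> x j \<in> eval_ring V"
  using eval_ringI[of V "single (single j 1) 1"] by (simp add: eval_var[OF alg] poly_vars_in_single)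

definition dependents :: "'a list" where
  "dependents = map x (sorted_list_of_set J)"

lemma set_dependents: "set dependents = x ` J"
  using finite_IJT by (simp add: dependents_def)

text \<open>\<open>S0\<close> is the polynomial ring K[t] on the free coordinates and
  \<open>S1\<close> adds the dependent ones. Every element of the domain is a quotient of elements
  of \<open>S1\<close> with unit denominator.\<close>

abbreviation "S0 \<equiv> eval_ring T"
abbreviation "S1 \<equiv> tower S0 dependents"

lemma S1_facts: "subring_set S1" "S0 \<subseteq> S1" "\<phi> c \<in> S1" "j < n \<Longrightarrow> x j \<in> S1"
proof -
  show "subring_set S1" by (rule subring_tower[OF subring_eval_ring])
  show S0: "S0 \<subseteq> S1" by (rule tower_base[OF subring_eval_ring])
  then show "\<phi> c \<in> S1" using const_in_eval_ring by blast
  show "x j \<in> S1" if "j < n"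
  proof (cases "j \<in> J")
    case True
    then show ?thesis using tower_mem[OF subring_eval_ring, of dependents] set_dependents by blast
  next
    case False
    then show ?thesis using that S0 var_in_eval_ring[of j T] by (auto simp: T_def)
  qed
qed

lemma eval_in_S1: "in_Pn n p \<Longrightarrow> ev p \<in> S1"
  by (rule eval_in_subring[OF alg S1_facts(1), where V = "{..<n}"]) (auto simp: S1_facts in_Pn_iff)

lemma hom_S1_eval:
  assumes "hom_on S1 h" "in_Pn n p"
  shows "h (ev p) = eval_mpoly (\<lambda>c. h (\<phi> c)) (\<lambda>j. h (x j)) p"
  by (rule eval_hom_on[OF alg S1_facts(1) _ _ _ assms(1), where V = "{..<n}"])
    (use S1_facts assms(2) in \<open>auto simp: in_Pn_iff\<close>)

text \<open>A derivation trivial on \<open>S0\<close> turns the relations given by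
  \<open>f i\<close> into a homogeneous linear system for its values on the dependent coordinates.
  The determinant of that system is \<Delta>, so all these values vanish.\<close>

lemma separable: "separable_tower S0 dependents"
proof (rule ccontr)
  assume "\<not> separable_tower S0 dependents"
  from derivation_of_nonseparable_tower[OF subring_eval_ring this]
  obtain h where h: "hom_on S1 h" "\<And>z. z \<in> S1 \<Longrightarrow> dual_re (h z) = to_frac z"
    "\<And>s. s \<in> S0 \<Longrightarrow> h s = Dual (to_frac s) 0" and bad: "\<exists>y\<in>set dependents. h y \<noteq> Dual (to_frac y) 0" by blast
  define d where "d = (\<lambda>j. dual_im (h (x j)))"
  have hx: "h (x j) = Dual (to_frac (x j)) (d j)" if "j < n" for j
    using h(2)[OF S1_facts(4)[OF that]] by (simp add: d_def dual.expand)
  have dT: "d j = 0" if "j \<in> T" for j using h(3)[OF var_in_eval_ring[OF that]] by (simp add: d_def)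
  have frac: "alg_struct (\<lambda>c. to_frac (\<phi> c))" using alg_struct_comp[OF alg to_frac_hom] .
  have ev: "eval_mpoly (\<lambda>c. to_frac (\<phi> c)) (\<lambda>j. to_frac (x j)) p = to_frac (ev p)" for p
    using eval_hom[OF alg to_frac_hom, of x p] by simp
  have "(\<Sum>l\<in>J. to_frac (jac i l) * d l) = 0" if "i \<in> I" for i
  proof -
    have i: "i < m" using that I by blast
    have "h (ev (f i)) = eval_mpoly (\<lambda>c. h (\<phi> c)) (\<lambda>j. h (x j)) (f i)"
      by (rule hom_S1_eval[OF h(1) f_Pn[OF i]])
    also have "(\<lambda>c. h (\<phi> c)) = (\<lambda>c. Dual (to_frac (\<phi> c)) 0)" using h(3) const_in_eval_ring by blast
    also have "eval_mpoly (\<lambda>c. Dual (to_frac (\<phi> c)) 0) (\<lambda>j. h (x j)) (f i) =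
        eval_mpoly (\<lambda>c. Dual (to_frac (\<phi> c)) 0) (\<lambda>j. Dual (to_frac (x j)) (d j)) (f i)"
      using hx f_Pn[OF i] by (intro eval_cong[OF alg_struct_comp[OF frac Dual_hom], of "{..<n}"]) (auto simp: in_Pn_iff)
    also have "\<dots> = Dual (to_frac (ev (f i))) (\<Sum>j<n. to_frac (jac i j) * d j)"
      using eval_dual[OF frac, of "{..<n}"] f_Pn[OF i] by (simp add: in_Pn_iff ev)
    finally have "dual_im (h (ev (f i))) = (\<Sum>j<n. to_frac (jac i j) * d j)" by simp
    moreover have "h (ev (f i)) = 0"
      using f_eval[OF i] hom_on_0[OF S1_facts(1) h(1)] by simp
    ultimately show ?thesis using dT by (simp add: sum_T_J zero_dual_def)
  qed
  from jac_solve[of d "\<lambda>_. 0", OF this] have "d j = 0" if "j \<in> J" for j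
    using that \<Delta> by simp
  then show False using bad hx J by (auto simp: set_dependents)
qed

text \<open>Denominators are units, so \<open>a\<close> may be exchanged for its numerator, which
  lies in the separable tower.\<close>

lemma multiple_in_S0:
  assumes "a \<noteq> 0"
  shows "\<exists>w. w * a \<in> S0 \<and> w * a \<noteq> 0"
proof -
  obtain p r v where pr: "in_Pn n p" "in_Pn n r" "ev r * v = 1" "a * ev r = ev p"
    using loc by metis
  have "ev p \<noteq> 0" using assms pr(3) by (auto simp: pr(4)[symmetric])
  from separable_tower_multiple[OF subring_eval_ring separable eval_in_S1[OF pr(1)] this]
  obtain w where "w * ev p \<in> S0" "w * ev p \<noteq> 0" by blast
  then show ?thesis unfolding pr(4)[symmetric] by (metis mult.assoc mult.commute)
qed

end

section \<open>Hasse-Schmidt derivations\<close>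

definition fps_to_frac :: "'a::idom fps \<Rightarrow> 'a fract fps" where
  "fps_to_frac F = Abs_fps (\<lambda>k. to_frac (fps_nth F k))"

lemma fps_to_frac_nth: "fps_nth (fps_to_frac F) k = to_frac (fps_nth F k)"
  by (simp add: fps_to_frac_def)

lemma fps_to_frac_const: "fps_to_frac (fps_const a) = fps_const (to_frac a)"
  by (intro fps_ext) (simp add: fps_to_frac_nth)

lemma fps_to_frac_hom: "hom_on UNIV fps_to_frac"
  unfolding hom_on_def
proof (intro conjI ballI)
  show "fps_to_frac 1 = 1" by (intro fps_ext) (simp add: fps_to_frac_nth)
  fix F G :: "'a fps"
  show "fps_to_frac (F + G) = fps_to_frac F + fps_to_frac G"
    by (intro fps_ext) (simp add: fps_to_frac_nth)
  show "fps_to_frac (F * G) = fps_to_frac F * fps_to_frac G"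
    by (intro fps_ext) (simp add: fps_to_frac_nth fps_mult_nth hom_on_sum[OF subring_UNIV to_frac_hom])
qed

lemma fps_const_hom: "hom_on UNIV (fps_const :: 'a::comm_ring_1 \<Rightarrow> 'a fps)"
  by (simp add: hom_on_def)

lemma fps_nth_0_hom: "hom_on UNIV (\<lambda>F :: 'a::comm_ring_1 fps. fps_nth F 0)"
  by (simp add: hom_on_def)

text \<open>The top coefficient comes without a factor a!, so leading coefficients can be extracted
  in every characteristic.\<close>

lemma fps_linear_power_nth:
  fixes u c :: "'a::comm_ring_1"
  shows "a < k \<Longrightarrow> fps_nth ((fps_const u + fps_const c * fps_X) ^ a) k = 0"
    and "fps_nth ((fps_const u + fps_const c * fps_X) ^ a) a = c ^ a"
proof -
  let ?F = "fps_const u + fps_const c * fps_X"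
  have "(k > a \<longrightarrow> fps_nth (?F ^ a) k = 0) \<and> fps_nth (?F ^ a) a = c ^ a" for k
  proof (induction a arbitrary: k)
    case (Suc a)
    have "?F ^ Suc a = fps_const u * ?F ^ a + fps_const c * (fps_X * ?F ^ a)"
      by (simp add: distrib_right mult.assoc)
    then have "fps_nth (?F ^ Suc a) k = u * fps_nth (?F ^ a) k + c * (if k = 0 then 0 else fps_nth (?F ^ a) (k - 1))" for k
      by (simp only: fps_add_nth fps_mult_left_const_nth fps_X_mult_nth)
    then show ?case using Suc by simp
  qed simp
  then show "a < k \<Longrightarrow> fps_nth (?F ^ a) k = 0" "fps_nth (?F ^ a) a = c ^ a" by blast+
qed

context jacobian_minor
begin

text \<open>Representing polynomials of one element differ by a relation, which \<open>y\<close>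
  respects, so the chosen representative does not matter.\<close>

lemma eval_induced_hom:
  fixes \<psi> :: "'k \<Rightarrow> 'b::comm_ring_1"
  assumes \<psi>: "alg_struct \<psi>"
    and rel: "\<And>p. poly_vars_in V p \<Longrightarrow> ev p = 0 \<Longrightarrow> eval_mpoly \<psi> y p = 0"
  shows "\<exists>h. hom_on (eval_ring V) h \<and> (\<forall>p. poly_vars_in V p \<longrightarrow> h (ev p) = eval_mpoly \<psi> y p)"
proof -
  define h where "h = (\<lambda>z. eval_mpoly \<psi> y (SOME p. poly_vars_in V p \<and> ev p = z))"
  have h: "h (ev p) = eval_mpoly \<psi> y p" if p: "poly_vars_in V p" for p
  proof -
    define r where "r = (SOME r. poly_vars_in V r \<and> ev r = ev p)"
    have r: "poly_vars_in V r \<and> ev r = ev p"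
      unfolding r_def using p by (rule_tac someI[of _ p]) simp
    have "poly_vars_in V (r - p)"
      using poly_vars_in_add[OF conjunct1[OF r] poly_vars_in_uminus[OF p]] by simp
    then have "eval_mpoly \<psi> y (r - p) = 0" by (rule rel) (use r in \<open>simp add: eval_diff[OF alg]\<close>)
    then show ?thesis by (simp add: h_def r_def eval_diff[OF \<psi>])
  qed
  have "hom_on (eval_ring V) h"
    unfolding hom_on_def
  proof (intro conjI ballI)
    show "h 1 = 1" using h[OF poly_vars_in_1] by (simp add: eval_1[OF alg] eval_1[OF \<psi>])
    fix a b assume "a \<in> eval_ring V" "b \<in> eval_ring V"
    then obtain p r where pr: "poly_vars_in V p" "poly_vars_in V r" "a = ev p" "b = ev r"
      by (auto simp: eval_ring_def)
    show "h (a + b) = h a + h b"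
      using h[OF poly_vars_in_add[OF pr(1,2)]] by (simp add: pr h eval_add[OF alg] eval_add[OF \<psi>])
    show "h (a * b) = h a * h b"
      using h[OF poly_vars_in_mult[OF pr(1,2)]] by (simp add: pr h eval_mult[OF alg] eval_mult[OF \<psi>])
  qed
  then show ?thesis using h by blast
qed

abbreviation "constA \<equiv> (\<lambda>c. fps_const (\<phi> c))"
abbreviation "constQ \<equiv> (\<lambda>c. fps_const (to_frac (\<phi> c)))"

lemma alg_const: "alg_struct constA" "alg_struct constQ"
  using alg_struct_comp[OF alg fps_const_hom] alg_struct_comp[OF alg_struct_comp[OF alg to_frac_hom] fps_const_hom]
  by auto

text \<open>The translation \<open>t\<^sub>k \<mapsto> t\<^sub>k + \<Delta>\<^sup>2 \<epsilon>\<close> of one free coordinate extends along the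
  separable tower.\<close>

lemma translation_frac:
  assumes k0: "k0 \<in> T"
  obtains y where "\<And>j. j < n \<Longrightarrow> fps_nth (y j) 0 = to_frac (x j)"
    "\<And>k. k \<in> T \<Longrightarrow> y k = fps_const (to_frac (x k)) + (if k = k0 then fps_const (to_frac (\<Delta>\<^sup>2)) * fps_X else 0)"
    "\<And>p. in_Pn n p \<Longrightarrow> ev p = 0 \<Longrightarrow> eval_mpoly constQ y p = 0"
proof -
  define y0 where "y0 = (\<lambda>k. fps_const (to_frac (x k)) + (if k = k0 then fps_const (to_frac (\<Delta>\<^sup>2)) * fps_X else 0))"
  \<comment> \<open>By independence the zero polynomial is the only relation among the free
    coordinates, so their images can be prescribed freely.\<close>
  have "\<exists>h. hom_on S0 h \<and> (\<forall>p. poly_vars_in T p \<longrightarrow> h (ev p) = eval_mpoly constQ y0 p)"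
    using free_coordinates_independent
    by (intro eval_induced_hom alg_const) (metis eval_0[OF alg_const(2)])
  then obtain h where h: "hom_on S0 h" "\<And>p. poly_vars_in T p \<Longrightarrow> h (ev p) = eval_mpoly constQ y0 p"
    by blast
  have ev0: "fps_nth (eval_mpoly constQ y0 p) 0 = to_frac (ev p)" for p
  proof -
    have "fps_nth (eval_mpoly constQ y0 p) 0 = eval_mpoly (\<lambda>c. to_frac (\<phi> c)) (\<lambda>j. to_frac (x j)) p"
      using eval_hom[OF alg_const(2) fps_nth_0_hom, of y0 p]
      by (simp add: y0_def if_distrib[of "\<lambda>F. fps_nth F 0"] cong: if_cong)
    then show ?thesis
      using eval_hom[OF alg to_frac_hom, of x p] by simp
  qed
  have lift: "fps_nth (h s) 0 = to_frac s" if "s \<in> S0" for s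
    using that h(2) ev0 by (auto simp: eval_ring_def)
  from extend_hom_separable_tower[OF henselian_fps subring_eval_ring h(1) lift separable]
  obtain H where H: "hom_on S1 H" "\<And>s. s \<in> S0 \<Longrightarrow> H s = h s" "\<And>z. z \<in> S1 \<Longrightarrow> fps_nth (H z) 0 = to_frac z"
    by blast
  have const: "H (\<phi> c) = fps_const (to_frac (\<phi> c))" for c
    using H(2)[OF const_in_eval_ring] h(2)[of "single 0 c"]
    by (simp add: eval_single[OF alg] eval_single[OF alg_const(2)] poly_vars_in_single)
  have var: "H (x k) = y0 k" if "k \<in> T" for k
  proof -
    show ?thesis
      using H(2)[OF var_in_eval_ring[OF that]] h(2)[of "single (single k 1) 1"] that
      by (simp add: eval_var[OF alg] eval_var[OF alg_const(2)] poly_vars_in_single)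
  qed
  show thesis
  proof (rule that[of "\<lambda>j. H (x j)"])
    show "fps_nth (H (x j)) 0 = to_frac (x j)" if "j < n" for j using H(3) S1_facts(4)[OF that] by blast
    show "H (x k) = fps_const (to_frac (x k)) + (if k = k0 then fps_const (to_frac (\<Delta>\<^sup>2)) * fps_X else 0)"
      if "k \<in> T" for k using var[OF that] by (simp add: y0_def)
    show "eval_mpoly constQ (\<lambda>j. H (x j)) p = 0" if "in_Pn n p" "ev p = 0" for p
      using hom_S1_eval[OF H(1) that(1)] that(2) hom_on_0[OF S1_facts(1) H(1)] by (simp add: const)
  qed
qed

text \<open>Comparing coefficients in \<open>f\<^sub>i(y) = 0\<close>: the unknown coefficients solve a linear system with
  determinant \<open>\<Delta>\<close> whose right hand side is divisible by \<open>\<Delta>\<^sup>2\<close>.\<close>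

lemma translation_integral:
  assumes k0: "k0 \<in> T"
    and y0: "\<And>j. j < n \<Longrightarrow> fps_nth (y j) 0 = to_frac (x j)"
    and yT: "\<And>k. k \<in> T \<Longrightarrow> y k = fps_const (to_frac (x k)) + (if k = k0 then fps_const (to_frac (\<Delta>\<^sup>2)) * fps_X else 0)"
    and rel: "\<And>p. in_Pn n p \<Longrightarrow> ev p = 0 \<Longrightarrow> eval_mpoly constQ y p = 0"
  shows "k \<ge> 1 \<Longrightarrow> j < n \<Longrightarrow> \<exists>b. fps_nth (y j) k = to_frac (\<Delta> * b)"
proof (induction k arbitrary: j rule: less_induct)
  case (less k)
  \<comment> \<open>This is coefficient \<open>k\<close> of the translation divided by
    \<open>\<Delta>\<^sup>2\<close>: it is 1 for the moved coordinate in degree 1 and 0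
    otherwise.\<close>
  define e where "e = (\<lambda>j. if j = k0 \<and> k = 1 then (1 :: 'a) else 0)"
  have T_k: "fps_nth (y j) k = to_frac (\<Delta> * (\<Delta> * e j))" if "j \<in> T" for j
    using less.prems(1) by (auto simp: yT[OF that] e_def power2_eq_square fps_X_def)
  show ?case
  proof (cases "j \<in> J")
    case False
    then have "j \<in> T" using less.prems(2) by (simp add: T_def)
    then show ?thesis using T_k by blast
  next
    case jJ: True
    define B where "B = (\<lambda>j l. SOME b. fps_nth (y j) l = to_frac (\<Delta> * b))"
    have B: "fps_nth (y j) l = to_frac (\<Delta> * B j l)" if "j < n" "1 \<le> l" "l < k" for j l
      unfolding B_def by (rule someI_ex) (rule less.IH[OF that(3,2,1)])
    \<comment> \<open>\<open>E\<close> holds the known coefficients divided by \<Delta>: all those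
      below \<open>k\<close>, and at \<open>k\<close> only the free coordinates. Then
      \<open>u\<close> is an integral approximation of \<open>y\<close> that differs from it by
      \<open>fps_X ^ k * z\<close>, and the unknowns are the constant terms of \<open>z\<close> at
      the dependent coordinates.\<close>
    define E where "E = (\<lambda>j. Abs_fps (\<lambda>l. if l = 0 \<or> l > k then 0 else if l < k then B j l
      else if j \<in> T then \<Delta> * e j else 0))"
    define u where "u = (\<lambda>j. fps_const (x j) + fps_const \<Delta> * E j)"
    have E_k: "fps_nth (E j) k = (if j \<in> T then \<Delta> * e j else 0)" for j
      using less.prems(1) by (simp add: E_def)
    have E_0: "fps_nth (E j) 0 = 0" for j by (simp add: E_def)
    have u_nth: "fps_nth (u j) l = (if l = 0 then x j else \<Delta> * fps_nth (E j) l)" for j l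
      using E_0 by (simp add: u_def)
    define z where "z = (\<lambda>j. fps_shift k (y j - fps_to_frac (u j)))"
    have y_eq: "y j = fps_to_frac (u j) + fps_X ^ k * z j" if "j < n" for j
    proof (rule fps_ext)
      fix l
      consider "l = 0" | "1 \<le> l" "l < k" | "k \<le> l" by linarith
      then show "fps_nth (y j) l = fps_nth (fps_to_frac (u j) + fps_X ^ k * z j) l"
      proof cases
        case 1
        then show ?thesis using y0[OF that] less.prems(1)
          by (simp add: fps_X_power_mult_nth fps_to_frac_nth u_nth)
      next
        case 2
        then show ?thesis using B[OF that, of l]
          by (simp add: fps_X_power_mult_nth fps_to_frac_nth u_nth E_def)
      next
        case 3
        then show ?thesis by (simp add: fps_X_power_mult_nth z_def)
      qed
    qed
    have z0: "fps_nth (z j) 0 = (if j \<in> T then 0 else fps_nth (y j) k)" for j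
      using T_k[of j] less.prems(1) by (simp add: z_def fps_to_frac_nth u_nth E_k)
    have evc: "eval_mpoly constA (\<lambda>j. fps_const (x j)) p = fps_const (ev p)" for p
      using eval_hom[OF alg fps_const_hom, of x p] by simp
    have "\<exists>s. (\<Sum>l\<in>J. to_frac (jac i l) * fps_nth (y l) k) = to_frac (\<Delta> * \<Delta> * s)" if iI: "i \<in> I" for i
    proof -
      have i: "i < m" using iI I by blast
      have fi: "poly_vars_in {..<n} (f i)" using f_Pn[OF i] by (simp add: in_Pn_iff)
      \<comment> \<open>Expansion at the point \<open>x\<close> with increment \<Delta>: the
        constant term is zero and the quadratic one is divisible by \<open>\<Delta>\<^sup>2\<close>.
        At coefficient \<open>k\<close> the linear term sees only free coordinates, which bring a
        second factor \<Delta>.\<close>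
      obtain w where "eval_mpoly constA u (f i) = eval_mpoly constA (\<lambda>j. fps_const (x j)) (f i) +
          fps_const \<Delta> * (\<Sum>j<n. eval_mpoly constA (\<lambda>j. fps_const (x j)) (pderiv_mpoly j (f i)) * E j) + (fps_const \<Delta>)\<^sup>2 * w"
        using eval_taylor[OF alg_const(1) finite_lessThan fi, of "\<lambda>j. fps_const (x j)" "fps_const \<Delta>" E]
        unfolding u_def by blast
      then have w: "eval_mpoly constA u (f i) = fps_const \<Delta> * (\<Sum>j<n. fps_const (jac i j) * E j) + fps_const (\<Delta> * \<Delta>) * w"
        by (simp add: evc f_eval[OF i] power2_eq_square)
      have "fps_nth (eval_mpoly constA u (f i)) k = \<Delta> * (\<Sum>j<n. jac i j * fps_nth (E j) k) + \<Delta> * \<Delta> * fps_nth w k"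
        unfolding w by (simp add: fps_sum_nth)
      also have "(\<Sum>j<n. jac i j * fps_nth (E j) k) = \<Delta> * (\<Sum>j\<in>T. jac i j * e j)"
        unfolding sum_T_J using J by (auto simp: E_k T_def sum_distrib_left mult_ac intro!: sum.cong sum.neutral)
      finally have c1: "fps_nth (eval_mpoly constA u (f i)) k = \<Delta> * \<Delta> * ((\<Sum>j\<in>T. jac i j * e j) + fps_nth w k)"
        by (simp add: algebra_simps)
      define s where "s = (\<Sum>j\<in>T. jac i j * e j) + fps_nth w k"
      let ?u = "\<lambda>j. fps_to_frac (u j)"
      have evQ: "eval_mpoly constQ ?u p = fps_to_frac (eval_mpoly constA u p)" for p
        using eval_hom[OF alg_const(1) fps_to_frac_hom, of u p] by (simp add: fps_to_frac_const)
      have evQ0: "fps_nth (eval_mpoly constQ ?u p) 0 = to_frac (ev p)" for p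
        using eval_hom[OF alg_const(1) fps_nth_0_hom, of u p]
        by (simp add: evQ fps_to_frac_nth u_nth)
      \<comment> \<open>Expansion at \<open>u\<close> with increment \<open>fps_X ^ k\<close>: the
        quadratic part starts in degree 2k > k, so the unknowns enter coefficient \<open>k\<close>
        linearly, with the Jacobi matrix at \<open>x\<close> as coefficients.\<close>
      obtain w' where w': "eval_mpoly constQ (\<lambda>j. ?u j + fps_X ^ k * z j) (f i) = eval_mpoly constQ ?u (f i) +
          fps_X ^ k * (\<Sum>j<n. eval_mpoly constQ ?u (pderiv_mpoly j (f i)) * z j) + (fps_X ^ k)\<^sup>2 * w'"
        using eval_taylor[OF alg_const(2) finite_lessThan fi, of ?u "fps_X ^ k" z] by blast
      have "eval_mpoly constQ (\<lambda>j. ?u j + fps_X ^ k * z j) (f i) = eval_mpoly constQ y (f i)"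
        using y_eq fi by (intro eval_cong[OF alg_const(2), of "{..<n}"]) auto
      also have "\<dots> = 0" using rel f_Pn[OF i] f_eval[OF i] by blast
      finally have zero: "eval_mpoly constQ (\<lambda>j. ?u j + fps_X ^ k * z j) (f i) = 0" .
      have sq: "(fps_X ^ k)\<^sup>2 * w' = fps_X ^ (k + k) * w'" by (simp add: power2_eq_square power_add)
      have "0 = fps_nth (eval_mpoly constQ ?u (f i) +
          fps_X ^ k * (\<Sum>j<n. eval_mpoly constQ ?u (pderiv_mpoly j (f i)) * z j) + (fps_X ^ k)\<^sup>2 * w') k"
        unfolding w'[symmetric] zero by simp
      also have "\<dots> = fps_nth (eval_mpoly constQ ?u (f i)) k +
          (\<Sum>j<n. fps_nth (eval_mpoly constQ ?u (pderiv_mpoly j (f i))) 0 * fps_nth (z j) 0)"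
        unfolding sq fps_add_nth fps_X_power_mult_nth using less.prems(1) by (simp add: fps_sum_nth)
      also have "\<dots> = to_frac (\<Delta> * \<Delta> * s) + (\<Sum>j<n. to_frac (jac i j) * fps_nth (z j) 0)"
        by (simp only: evQ0) (simp only: evQ fps_to_frac_nth c1 s_def)
      also have "(\<Sum>j<n. to_frac (jac i j) * fps_nth (z j) 0) = (\<Sum>l\<in>J. to_frac (jac i l) * fps_nth (y l) k)"
        unfolding sum_T_J by (auto simp: z0 T_def intro!: sum.cong sum.neutral)
      finally have "(\<Sum>l\<in>J. to_frac (jac i l) * fps_nth (y l) k) = to_frac (\<Delta> * \<Delta> * - s)"
        by (simp add: eq_neg_iff_add_eq_0 add.commute)
      then show ?thesis by blast
    qed
    then obtain s where s: "\<And>i. i \<in> I \<Longrightarrow> (\<Sum>l\<in>J. to_frac (jac i l) * fps_nth (y l) k) = to_frac (\<Delta> * \<Delta> * s i)"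
      by metis
    \<comment> \<open>Cramer's rule leaves \<open>\<Delta>\<^sup>2\<close> on the right. Cancelling
      one \<Delta> keeps the other, which is the divisibility that the induction carries.\<close>
    have "to_frac \<Delta> * fps_nth (y j) k = (\<Sum>i\<in>I. to_frac (C j i) * to_frac (\<Delta> * \<Delta> * s i))"
      using jac_solve[of "\<lambda>l. fps_nth (y l) k" "\<lambda>i. to_frac (\<Delta> * \<Delta> * s i)", OF s jJ] by simp
    also have "\<dots> = to_frac \<Delta> * to_frac (\<Delta> * (\<Sum>i\<in>I. C j i * s i))"
      by (simp add: hom_on_sum[OF subring_UNIV to_frac_hom] sum_distrib_left mult_ac)
    finally show ?thesis using \<Delta> by auto
  qed
qed

text \<open>All coefficients of the solution are integral, so it descends from the fraction field;
  the relations descend because passing to fractions is injective on power series.\<close>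

lemma translation:
  assumes k0: "k0 \<in> T"
  obtains Y where "\<And>j. j < n \<Longrightarrow> fps_nth (Y j) 0 = x j"
    "\<And>k. k \<in> T \<Longrightarrow> Y k = fps_const (x k) + (if k = k0 then fps_const (\<Delta>\<^sup>2) * fps_X else 0)"
    "\<And>p. in_Pn n p \<Longrightarrow> ev p = 0 \<Longrightarrow> eval_mpoly constA Y p = 0"
proof -
  obtain y where y: "\<And>j. j < n \<Longrightarrow> fps_nth (y j) 0 = to_frac (x j)"
    "\<And>k. k \<in> T \<Longrightarrow> y k = fps_const (to_frac (x k)) + (if k = k0 then fps_const (to_frac (\<Delta>\<^sup>2)) * fps_X else 0)"
    "\<And>p. in_Pn n p \<Longrightarrow> ev p = 0 \<Longrightarrow> eval_mpoly constQ y p = 0"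
    using translation_frac[OF k0] by blast
  define Y where "Y = (\<lambda>j. Abs_fps (\<lambda>k. SOME b. to_frac b = fps_nth (y j) k))"
  have lift: "fps_to_frac (Y j) = y j" if "j < n" for j
  proof (rule fps_ext)
    fix k
    have "\<exists>b. to_frac b = fps_nth (y j) k"
    proof (cases "k = 0")
      case True
      then show ?thesis using y(1)[OF that] by (intro exI[of _ "x j"]) simp
    next
      case False
      then have "1 \<le> k" by simp
      have "\<exists>b. fps_nth (y j) k = to_frac (\<Delta> * b)"
        by (rule translation_integral[OF k0 y \<open>1 \<le> k\<close> that])
      then show ?thesis by (elim exE) (rule exI, rule sym)
    qed
    from someI_ex[OF this] show "fps_nth (fps_to_frac (Y j)) k = fps_nth (y j) k"
      by (simp add: Y_def fps_to_frac_nth)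
  qed
  have inj: "F = G" if "fps_to_frac F = fps_to_frac G" for F G :: "'a fps"
  proof (rule fps_ext)
    fix k
    have "fps_nth (fps_to_frac F) k = fps_nth (fps_to_frac G) k" using that by simp
    then show "fps_nth F k = fps_nth G k" by (simp add: fps_to_frac_nth)
  qed
  show thesis
  proof (rule that[of Y])
    show "fps_nth (Y j) 0 = x j" if "j < n" for j
      using y(1)[OF that] unfolding lift[OF that, symmetric] fps_to_frac_nth by simp
    show "Y k = fps_const (x k) + (if k = k0 then fps_const (\<Delta>\<^sup>2) * fps_X else 0)" if "k \<in> T" for k
    proof (rule inj)
      have "k < n" using that T_subset by blast
      show "fps_to_frac (Y k) = fps_to_frac (fps_const (x k) + (if k = k0 then fps_const (\<Delta>\<^sup>2) * fps_X else 0))"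
        unfolding lift[OF \<open>k < n\<close>] y(2)[OF that] by (intro fps_ext) (simp add: fps_to_frac_nth fps_X_def)
    qed
    show "eval_mpoly constA Y p = 0" if p: "in_Pn n p" "ev p = 0" for p
    proof (rule inj)
      have "fps_to_frac (eval_mpoly constA Y p) = eval_mpoly constQ (\<lambda>j. fps_to_frac (Y j)) p"
        using eval_hom[OF alg_const(1) fps_to_frac_hom, of Y p] by (simp add: fps_to_frac_const)
      also have "\<dots> = eval_mpoly constQ y p"
        using lift p(1) by (intro eval_cong[OF alg_const(2), of "{..<n}"]) (auto simp: in_Pn_iff)
      also have "\<dots> = 0" using y(3) p by blast
      finally show "fps_to_frac (eval_mpoly constA Y p) = fps_to_frac 0"
        using hom_on_0[OF subring_UNIV fps_to_frac_hom] by metis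
    qed
  qed
qed

end

text \<open>The value on \<open>p / r\<close> is forced, and cross-multiplication shows that it is
  unique. For power series the hypothesis \<open>unit\<close> will hold because a series with
  invertible constant term is invertible.\<close>

lemma extend_hom_localization:
  fixes h :: "'a::idom \<Rightarrow> 'b::comm_ring_1"
  assumes K: "subring_set K" and h: "hom_on K h"
    and loc: "\<And>a. \<exists>p\<in>K. \<exists>r\<in>K. (\<exists>v. r * v = 1) \<and> a * r = p"
    and unit: "\<And>r v. r \<in> K \<Longrightarrow> r * v = 1 \<Longrightarrow> \<exists>w. h r * w = 1"
  shows "\<exists>G. hom_on UNIV G \<and> (\<forall>s\<in>K. G s = h s)"
proof -
  let ?P = "\<lambda>a b. \<exists>p\<in>K. \<exists>r\<in>K. (\<exists>v. r * v = 1) \<and> a * r = p \<and> b * h r = h p"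
  define G where "G = (\<lambda>a. SOME b. ?P a b)"
  have "\<exists>b. ?P a b" for a
  proof -
    obtain p r v where pr: "p \<in> K" "r \<in> K" "r * v = 1" "a * r = p" using loc by blast
    obtain w where w: "h r * w = 1" using unit[OF pr(2,3)] by blast
    have "(h p * w) * h r = h p * (h r * w)" by (simp add: mult_ac)
    then have "(h p * w) * h r = h p" using w by simp
    then show ?thesis using pr by blast
  qed
  then have GP: "?P a (G a)" for a unfolding G_def by (rule someI_ex)
  have cancel: "b = c" if rv: "r \<in> K" "r * v = 1" and bc: "b * h r = c * h r" for b c r v
  proof -
    obtain w where w: "h r * w = 1" using unit[OF rv] by blast
    have "b * h r * w = c * h r * w" using bc by simp
    then show ?thesis using w by (simp add: mult.assoc)
  qed
  have G: "G a * h r = h p" if pr: "p \<in> K" "r \<in> K" "a * r = p" for a p r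
  proof -
    obtain p' r' v' where pr': "p' \<in> K" "r' \<in> K" "r' * v' = 1" "a * r' = p'" "G a * h r' = h p'" using GP by blast
    have "p * r' = p' * r" using pr(3) pr'(4) by (auto simp: mult_ac)
    then have "h p * h r' = h p' * h r" using hom_onD(3)[OF h] pr pr' by metis
    then have "(G a * h r) * h r' = h p * h r'" using pr'(5) by (simp add: mult_ac) (metis mult.assoc)
    then show ?thesis using cancel pr' by blast
  qed
  have base: "G s = h s" if "s \<in> K" for s
    using G[OF that subring_setD(1)[OF K]] hom_onD(1)[OF h] by simp
  have "hom_on UNIV G"
    unfolding hom_on_def
  proof (intro conjI ballI)
    show "G 1 = 1" using base[OF subring_setD(1)[OF K]] hom_onD(1)[OF h] by simp
    fix a b
    obtain p r v where pr: "p \<in> K" "r \<in> K" "r * v = 1" "a * r = p" using loc by blast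
    obtain p' r' v' where pr': "p' \<in> K" "r' \<in> K" "r' * v' = 1" "b * r' = p'" using loc by blast
    note Ga = G[OF pr(1,2,4)] and Gb = G[OF pr'(1,2,4)]
    have rr: "r * r' \<in> K" "(r * r') * (v * v') = 1" "h (r * r') = h r * h r'"
      using pr pr' subring_setD(6)[OF K] hom_onD(3)[OF h] by (auto simp: mult_ac)
    have mem: "p * r' + p' * r \<in> K" "p * p' \<in> K"
      by (intro subring_setD(4,6)[OF K] pr(1,2) pr'(1,2))+
    have "(a + b) * (r * r') = p * r' + p' * r"
      unfolding pr(4)[symmetric] pr'(4)[symmetric] by (simp add: algebra_simps)
    from G[OF mem(1) rr(1) this] have "G (a + b) * h (r * r') = h (p * r' + p' * r)" .
    also have "\<dots> = h p * h r' + h p' * h r"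
      using pr(1,2) pr'(1,2) by (simp add: hom_onD[OF h] subring_setD(6)[OF K])
    also have "\<dots> = (G a + G b) * h (r * r')" unfolding rr(3) Ga[symmetric] Gb[symmetric] by (simp add: algebra_simps)
    finally show "G (a + b) = G a + G b" by (rule cancel[OF rr(1,2)])
    have "(a * b) * (r * r') = p * p'" unfolding pr(4)[symmetric] pr'(4)[symmetric] by (simp add: mult_ac)
    from G[OF mem(2) rr(1) this] have "G (a * b) * h (r * r') = h (p * p')" .
    also have "\<dots> = h p * h p'" using pr(1) pr'(1) by (simp add: hom_onD[OF h])
    also have "\<dots> = (G a * G b) * h (r * r')" unfolding rr(3) Ga[symmetric] Gb[symmetric] by (simp add: mult_ac)
    finally show "G (a * b) = G a * G b" by (rule cancel[OF rr(1,2)])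
  qed
  then show ?thesis using base by blast
qed

text \<open>The coefficients of \<open>G\<close> form a Hasse-Schmidt derivation: K-linear maps with
  the higher Leibniz rule, beginning with the identity.\<close>

locale hasse_schmidt_hom =
  fixes \<phi> :: "'k::field \<Rightarrow> 'a::idom" and G :: "'a \<Rightarrow> 'a fps"
  assumes G: "hom_on UNIV G" and G_const: "\<And>c. G (\<phi> c) = fps_const (\<phi> c)" and G_0: "\<And>a. fps_nth (G a) 0 = a"

context jacobian_minor
begin

lemma hasse_schmidt:
  assumes k0: "k0 \<in> T"
  obtains G where "hasse_schmidt_hom \<phi> G"
    "\<And>k. k \<in> T \<Longrightarrow> G (x k) = fps_const (x k) + (if k = k0 then fps_const (\<Delta>\<^sup>2) * fps_X else 0)"
proof -
  obtain Y where Y: "\<And>j. j < n \<Longrightarrow> fps_nth (Y j) 0 = x j"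
    "\<And>k. k \<in> T \<Longrightarrow> Y k = fps_const (x k) + (if k = k0 then fps_const (\<Delta>\<^sup>2) * fps_X else 0)"
    "\<And>p. in_Pn n p \<Longrightarrow> ev p = 0 \<Longrightarrow> eval_mpoly constA Y p = 0"
    using translation[OF k0] by blast
  let ?K = "eval_ring {..<n}"
  obtain h where h: "hom_on ?K h" "\<And>p. in_Pn n p \<Longrightarrow> h (ev p) = eval_mpoly constA Y p"
    using eval_induced_hom[OF alg_const(1), of "{..<n}" Y] Y(3) unfolding in_Pn_iff by blast
  have h0: "fps_nth (h s) 0 = s" if "s \<in> ?K" for s
  proof -
    obtain p where p: "in_Pn n p" "s = ev p" using \<open>s \<in> ?K\<close> by (auto simp: eval_ring_def in_Pn_iff)
    have "fps_nth (eval_mpoly constA Y p) 0 = eval_mpoly \<phi> (\<lambda>j. fps_nth (Y j) 0) p"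
      using eval_hom[OF alg_const(1) fps_nth_0_hom, of Y p] by simp
    also have "\<dots> = s" unfolding p(2)
      using p(1) Y(1) by (intro eval_cong[OF alg, of "{..<n}"]) (auto simp: in_Pn_iff)
    finally show ?thesis using h(2) p by simp
  qed
  have "\<exists>p\<in>?K. \<exists>r\<in>?K. (\<exists>v. r * v = 1) \<and> a * r = p" for a
    using loc[of a] eval_ringI unfolding in_Pn_iff by metis
  moreover have "\<exists>w. h r * w = 1" if "r \<in> ?K" "r * v = 1" for r v
    using fps_right_inverse[of "h r" v] h0[OF that(1)] that(2) by auto
  ultimately obtain G where G: "hom_on UNIV G" "\<And>s. s \<in> ?K \<Longrightarrow> G s = h s"
    using extend_hom_localization[OF subring_eval_ring h(1)] by blast
  show thesis
  proof (rule that)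
    show "hasse_schmidt_hom \<phi> G"
    proof
      show "hom_on UNIV G" by (rule G(1))
      show "G (\<phi> c) = fps_const (\<phi> c)" for c
        using G(2)[OF const_in_eval_ring, of c] h(2)[of "single 0 c"]
        by (simp add: eval_single[OF alg] eval_single[OF alg_const(1)] poly_vars_in_single in_Pn_iff)
      show "fps_nth (G a) 0 = a" for a
      proof -
        obtain p r v where pr: "p \<in> ?K" "r \<in> ?K" "r * v = 1" "a * r = p"
          using loc[of a] eval_ringI unfolding in_Pn_iff by metis
        have "fps_nth (G (a * r)) 0 = fps_nth (G a) 0 * fps_nth (G r) 0" by (simp add: hom_onD[OF G(1)])
        then have "a * r = fps_nth (G a) 0 * r" using pr G(2) h0 by simp
        moreover have "r \<noteq> 0" using pr(3) by auto
        ultimately show ?thesis by simp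
      qed
    qed
    show "G (x k) = fps_const (x k) + (if k = k0 then fps_const (\<Delta>\<^sup>2) * fps_X else 0)" if "k \<in> T" for k
    proof -
      have "k < n" using that T_subset by blast
      then have "G (x k) = Y k"
        using G(2)[OF var_in_eval_ring, of k] h(2)[of "single (single k 1) 1"]
        by (simp add: eval_var[OF alg] eval_var[OF alg_const(1)] poly_vars_in_single in_Pn_iff)
      then show ?thesis using Y(2)[OF that] by simp
    qed
  qed
qed

end

section \<open>Powers of minors in two-sided ideals\<close>

lemma sum_in_Dops:
  assumes "\<And>l. l \<in> A \<Longrightarrow> u l \<in> Dops \<phi> i"
  shows "(\<lambda>y. \<Sum>l\<in>A. u l y) \<in> Dops \<phi> i"
  using assms
proof (induction A rule: infinite_finite_induct)
  case (insert l A)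
  have "(\<lambda>y. \<Sum>k\<in>insert l A. u k y) = op_add (u l) (\<lambda>y. \<Sum>k\<in>A. u k y)"
    using insert by (auto simp: op_simps)
  then show ?case using insert by (simp add: op_add_in_Dops)
qed (use op_zero_in_Dops[of \<phi> i] in \<open>simp_all add: op_zero_def\<close>)

lemma sum_in_ideal:
  assumes L: "two_sided_ideal R L" and "\<And>l. l \<in> A \<Longrightarrow> u l \<in> L"
  shows "(\<lambda>y. \<Sum>l\<in>A. u l y) \<in> L"
  using assms(2)
proof (induction A rule: infinite_finite_induct)
  case (insert l A)
  have "(\<lambda>y. \<Sum>k\<in>insert l A. u k y) = op_add (u l) (\<lambda>y. \<Sum>k\<in>A. u k y)"
    using insert by (auto simp: op_simps)
  then show ?case using insert L by (simp add: two_sided_ideal_def)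
qed (use L in \<open>simp_all add: two_sided_ideal_def op_zero_def\<close>)

lemma is_ideal_sum: "is_ideal Q \<Longrightarrow> (\<And>i. i \<in> A \<Longrightarrow> g i \<in> Q) \<Longrightarrow> sum g A \<in> Q"
  by (induction A rule: infinite_finite_induct) (auto simp: is_ideal_def)

lemma is_ideal_diff: "is_ideal Q \<Longrightarrow> a \<in> Q \<Longrightarrow> b \<in> Q \<Longrightarrow> a - b \<in> Q"
  using mult_minus1[of b] unfolding is_ideal_def by (metis uminus_add_conv_diff)

lemma is_ideal_mult: "is_ideal Q \<Longrightarrow> b \<in> Q \<Longrightarrow> a * b \<in> Q"
  by (simp add: is_ideal_def)

context hasse_schmidt_hom
begin

lemma G_mult_nth: "fps_nth (G (a * b)) k = (\<Sum>l\<le>k. fps_nth (G a) l * fps_nth (G b) (k - l))"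
  by (simp add: hom_onD[OF G] fps_mult_nth atLeast0AtMost)

text \<open>By the Leibniz rule the commutator of the \<open>k\<close>-th coefficient with
  \<open>r\<close> is a combination of the earlier coefficients, whose order is smaller by
  induction.\<close>

lemma coefficient_in_Dops: "(\<lambda>a. fps_nth (G a) k) \<in> Dops \<phi> k"
proof (induction k rule: less_induct)
  case (less k)
  have E: "(\<lambda>a. fps_nth (G a) k) \<in> EndK \<phi>"
    by (simp add: EndK_def hom_onD[OF G] G_const)
  show ?case
  proof (cases k)
    case 0
    have "(\<lambda>a. fps_nth (G a) 0) = lmult 1" by (auto simp: op_simps G_0)
    then show ?thesis using lmult_in_Dops_0 0 by metis
  next
    case (Suc i)
    have "commut r (\<lambda>a. fps_nth (G a) k) \<in> Dops \<phi> i" for r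
    proof -
      have eq: "commut r (\<lambda>a. fps_nth (G a) k) =
          (\<lambda>y. \<Sum>l\<in>{1..k}. (lmult (- fps_nth (G r) l) \<circ> (\<lambda>a. fps_nth (G a) (k - l))) y)"
      proof
        fix y
        have "{..k} = insert 0 {1..k}" by auto
        then have "fps_nth (G (r * y)) k = r * fps_nth (G y) k + (\<Sum>l\<in>{1..k}. fps_nth (G r) l * fps_nth (G y) (k - l))"
          unfolding G_mult_nth by (simp add: G_0)
        then show "commut r (\<lambda>a. fps_nth (G a) k) y =
          (\<Sum>l\<in>{1..k}. (lmult (- fps_nth (G r) l) \<circ> (\<lambda>a. fps_nth (G a) (k - l))) y)"
          by (simp add: op_simps sum_negf)
      qed
      have "(\<lambda>a. fps_nth (G a) (k - l)) \<in> Dops \<phi> i" if "l \<in> {1..k}" for l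
        using less.IH[of "k - l"] that Suc by (intro Dops_mono[of "k - l" i]) auto
      then show ?thesis unfolding eq by (intro sum_in_Dops lmult_comp_in_Dops)
    qed
    then show ?thesis using E Suc by (simp add: Dops_Suc_iff)
  qed
qed

text \<open>Composing the \<open>k\<close>-th coefficient with \<open>lmult a\<close> expands by
  Leibniz into multiplication by the \<open>k\<close>-th coefficient of \<open>G a\<close> plus
  terms that begin with earlier coefficients of \<open>G a\<close>, already in
  \<open>L\<close>.\<close>

lemma coefficient_stable:
  assumes L: "two_sided_ideal (Dalg \<phi>) L" and a: "lmult a \<in> L"
  shows "lmult (fps_nth (G a) k) \<in> L"
proof (induction k rule: less_induct)
  case (less k)
  have D: "(\<lambda>a. fps_nth (G a) i) \<in> Dalg \<phi>" for i using coefficient_in_Dops Dops_subset_Dalg by blast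
  have mult: "w \<circ> p \<in> L" "p \<circ> w \<in> L" if "w \<in> Dalg \<phi>" "p \<in> L" for w p
    using L that by (auto simp: two_sided_ideal_def)
  define s where "s = (\<lambda>y. \<Sum>l<k. (lmult (fps_nth (G a) l) \<circ> (\<lambda>b. fps_nth (G b) (k - l))) y)"
  have "s \<in> L" unfolding s_def by (intro sum_in_ideal[OF L] mult(2) D less.IH) simp
  have "lmult (fps_nth (G a) k) = op_add ((\<lambda>b. fps_nth (G b) k) \<circ> lmult a) (op_neg s)"
  proof
    fix y
    have "{..k} = insert k {..<k}" by auto
    then have "fps_nth (G (a * y)) k = fps_nth (G a) k * y + s y"
      unfolding G_mult_nth by (simp add: s_def op_simps G_0)
    then show "lmult (fps_nth (G a) k) y = op_add ((\<lambda>b. fps_nth (G b) k) \<circ> lmult a) (op_neg s) y"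
      by (simp add: op_simps)
  qed
  moreover have "(\<lambda>b. fps_nth (G b) k) \<circ> lmult a \<in> L" by (rule mult(1)[OF D a])
  ultimately show ?case using \<open>s \<in> L\<close> L by (simp add: two_sided_ideal_def)
qed

text \<open>Apply the \<open>k\<close>-th coefficient to \<open>d ^ N * a\<close>. One Leibniz term
  is \<open>d ^ N\<close> times the wanted element, and the rest involve earlier coefficients of
  \<open>G a\<close>, already in the saturation. Since \<open>G\<close> need not fix
  \<open>d\<close>, the exponent has to grow with \<open>k\<close>.\<close>

lemma coefficient_stable_saturation:
  assumes Q: "is_ideal Q" and stable: "\<And>a k. a \<in> Q \<Longrightarrow> fps_nth (G a) k \<in> Q"
    and a: "d ^ N * a \<in> Q"
  shows "\<exists>M. d ^ M * fps_nth (G a) k \<in> Q"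
proof (induction k rule: less_induct)
  case (less k)
  then obtain M where M: "\<And>l. l < k \<Longrightarrow> d ^ M l * fps_nth (G a) l \<in> Q" by metis
  define B where "B = (\<Sum>l<k. M l)"
  have B: "d ^ B * fps_nth (G a) l \<in> Q" if "l < k" for l
  proof -
    have "M l \<le> B" unfolding B_def using that by (intro member_le_sum) auto
    then have "d ^ B = d ^ (B - M l) * d ^ M l" by (simp flip: power_add)
    then have "d ^ B * fps_nth (G a) l = d ^ (B - M l) * (d ^ M l * fps_nth (G a) l)"
      by (simp only: mult.assoc)
    also have "\<dots> \<in> Q" by (rule is_ideal_mult[OF Q M[OF that]])
    finally show ?thesis .
  qed
  have "fps_nth (G (a * d ^ N)) k \<in> Q" using stable[OF a] by (simp add: mult.commute)
  moreover have "{..k} = insert k {..<k}" by auto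
  ultimately have *: "fps_nth (G a) k * d ^ N + (\<Sum>l<k. fps_nth (G a) l * fps_nth (G (d ^ N)) (k - l)) \<in> Q"
    unfolding G_mult_nth by (simp add: G_0)
  have "d ^ B * (\<Sum>l<k. fps_nth (G a) l * fps_nth (G (d ^ N)) (k - l)) =
      (\<Sum>l<k. fps_nth (G (d ^ N)) (k - l) * (d ^ B * fps_nth (G a) l))"
    by (simp add: sum_distrib_left mult_ac)
  also have "\<dots> \<in> Q" by (intro is_ideal_sum[OF Q] is_ideal_mult[OF Q] B) simp
  finally have "d ^ B * (\<Sum>l<k. fps_nth (G a) l * fps_nth (G (d ^ N)) (k - l)) \<in> Q" .
  from is_ideal_diff[OF Q is_ideal_mult[OF Q *, of "d ^ B"] this]
  have "d ^ (B + N) * fps_nth (G a) k \<in> Q" by (simp add: distrib_left power_add mult_ac)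
  then show ?case by blast
qed

end

context jacobian_minor
begin

text \<open>Translating one free coordinate \<open>t\<^sub>k\<close> extracts the leading coefficient of a polynomial
  in \<open>t\<^sub>k\<close>, so some power of \<open>\<Delta>\<close> is reached after finitely many steps.\<close>

lemma unit_in_saturation:
  assumes Q: "is_ideal Q"
    and stable: "\<And>G a k. hasse_schmidt_hom \<phi> G \<Longrightarrow> a \<in> Q \<Longrightarrow> fps_nth (G a) k \<in> Q"
  shows "\<lbrakk>\<forall>t\<in>keys g. tdeg t \<le> N; poly_vars_in T g; g \<noteq> 0; \<Delta> ^ M * ev g \<in> Q\<rbrakk>
    \<Longrightarrow> \<exists>M. \<Delta> ^ M \<in> Q"
proof (induction N arbitrary: g M rule: less_induct)
  case (less N)
  show ?case
  proof (cases "keys g \<subseteq> {0}")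
    case True
    define c where "c = lookup g 0"
    have "ev g = \<phi> c" using eval_mpoly_superset[OF alg _ True] by (simp add: c_def)
    moreover have "c \<noteq> 0"
    proof
      assume "c = 0"
      then have "0 \<notin> keys g" by (simp add: c_def in_keys_iff)
      then have "keys g = {}" using True by blast
      then show False using less.prems(3) by (simp only: keys_eq_empty)
    qed
    then have "\<phi> (inverse c) * \<phi> c = 1" using alg_structD(3)[OF alg, of "inverse c" c] alg_structD(1)[OF alg] by simp
    ultimately have "\<phi> (inverse c) * (\<Delta> ^ M * ev g) = \<Delta> ^ M" by (simp add: mult.left_commute)
    then show ?thesis using is_ideal_mult[OF Q less.prems(4)] by metis
  next
    case False
    then obtain t0 where t0: "t0 \<in> keys g" "t0 \<noteq> 0" by blast
    then obtain k where "k \<in> keys t0" by (metis all_not_in_conv keys_eq_empty)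
    then have kT: "k \<in> T" using less.prems(2) t0 unfolding poly_vars_in_def by blast
    define d where "d = Max ((\<lambda>t. lookup t k) ` keys g)"
    have le_d: "lookup t k \<le> d" if "t \<in> keys g" for t
      unfolding d_def using that by (intro Max_ge) auto
    have "d \<in> (\<lambda>t. lookup t k) ` keys g"
      unfolding d_def using t0(1) by (intro Max_in) auto
    then obtain t1 where t1: "t1 \<in> keys g" "lookup t1 k = d" by blast
    have "d > 0" using le_d[OF t0(1)] \<open>k \<in> keys t0\<close> by (auto simp: in_keys_iff)
    define A where "A = {t \<in> keys g. lookup t k = d}"
    have finA: "finite A" by (simp add: A_def)
    define \<rho> where "\<rho> = (\<lambda>t :: nat \<Rightarrow>\<^sub>0 nat. t - single k d)"
    have \<rho>_add: "\<rho> t + single k d = t" if "t \<in> A" for t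
      using that by (intro poly_mapping_eqI) (auto simp: A_def \<rho>_def lookup_add lookup_minus lookup_single when_def)
    have keys_\<rho>: "keys (\<rho> t) \<subseteq> keys t" for t
      by (auto simp: \<rho>_def in_keys_iff lookup_minus)
    \<comment> \<open>The leading coefficient of \<open>g\<close> as a polynomial in the coordinate
      \<open>k\<close>. The shift by \<open>single k d\<close> is injective on \<open>A\<close>, so
      nothing cancels and \<open>g1\<close> is nonzero.\<close>
    define g1 where "g1 = (\<Sum>t\<in>A. single (\<rho> t) (lookup g t))"
    note keys_g1 = keys_sum_single[of _ \<rho> "lookup g" A, folded g1_def]
    obtain G where hs: "hasse_schmidt_hom \<phi> G"
      and GT: "\<And>j. j \<in> T \<Longrightarrow> G (x j) = fps_const (x j) + (if j = k then fps_const (\<Delta>\<^sup>2) * fps_X else 0)"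
      using hasse_schmidt[OF kT] by blast
    interpret hasse_schmidt_hom \<phi> G by (rule hs)
    \<comment> \<open>Only monomials with the full exponent \<open>d\<close> reach degree
      \<open>d\<close> of the series, because the other free coordinates are fixed by
      \<open>G\<close>.\<close>
    have coef: "fps_nth (mono_val (\<lambda>j. G (x j)) t) d = (if t \<in> A then (\<Delta>\<^sup>2) ^ d * mono_val x (\<rho> t) else 0)"
      if t: "t \<in> keys g" for t
    proof -
      let ?R = "\<Prod>j\<in>T - {k}. x j ^ lookup t j"
      have tT: "keys t \<subseteq> T" using less.prems(2) t by (auto simp: poly_vars_in_def)
      have "mono_val (\<lambda>j. G (x j)) t = G (x k) ^ lookup t k * (\<Prod>j\<in>T - {k}. G (x j) ^ lookup t j)"
        unfolding mono_val_superset[OF finite_IJT(3) tT] using kT finite_IJT(3) by (simp add: prod.remove)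
      also have "(\<Prod>j\<in>T - {k}. G (x j) ^ lookup t j) = (\<Prod>j\<in>T - {k}. fps_const (x j ^ lookup t j))"
        by (rule prod.cong) (auto simp: GT)
      also have "\<dots> = fps_const ?R" by (simp add: hom_on_prod[OF subring_UNIV fps_const_hom])
      finally have 1: "fps_nth (mono_val (\<lambda>j. G (x j)) t) d =
          fps_nth ((fps_const (x k) + fps_const (\<Delta>\<^sup>2) * fps_X) ^ lookup t k) d * ?R"
        using GT[OF kT] by simp
      show ?thesis
      proof (cases "t \<in> A")
        case True
        then have lk: "lookup t k = d" by (simp add: A_def)
        have "keys (\<rho> t) \<subseteq> T" using keys_\<rho> tT by blast
        then have "mono_val x (\<rho> t) = (\<Prod>j\<in>T. x j ^ lookup (\<rho> t) j)"
          by (rule mono_val_superset[OF finite_IJT(3)])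
        also have "\<dots> = x k ^ lookup (\<rho> t) k * (\<Prod>j\<in>T - {k}. x j ^ lookup (\<rho> t) j)"
          using kT finite_IJT(3) by (simp add: prod.remove)
        also have "lookup (\<rho> t) k = 0" using lk by (simp add: \<rho>_def lookup_minus)
        also have "(\<Prod>j\<in>T - {k}. x j ^ lookup (\<rho> t) j) = ?R"
          by (rule prod.cong) (auto simp: \<rho>_def lookup_minus lookup_single when_def)
        finally show ?thesis using True 1 lk by (simp add: fps_linear_power_nth)
      next
        case False
        then have "lookup t k < d" using le_d[OF t] t by (auto simp: A_def)
        then show ?thesis using False 1 by (simp add: fps_linear_power_nth)
      qed
    qed
    have "G (ev g) = eval_mpoly constA (\<lambda>j. G (x j)) g"
      using eval_hom[OF alg G, of x g] by (simp add: G_const)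
    then have "fps_nth (G (ev g)) d =
        (\<Sum>t\<in>keys g. \<phi> (lookup g t) * fps_nth (mono_val (\<lambda>j. G (x j)) t) d)"
      by (simp add: eval_mpoly_eq fps_sum_nth)
    also have "\<dots> = (\<Sum>t\<in>keys g. if t \<in> A then \<phi> (lookup g t) * ((\<Delta>\<^sup>2) ^ d * mono_val x (\<rho> t)) else 0)"
      by (rule sum.cong) (auto simp: coef)
    also have "\<dots> = (\<Sum>t\<in>A. \<phi> (lookup g t) * ((\<Delta>\<^sup>2) ^ d * mono_val x (\<rho> t)))"
      by (simp add: A_def flip: sum.inter_filter)
    also have "\<dots> = \<Delta> ^ (2 * d) * ev g1"
      unfolding power_mult[symmetric]
      by (simp add: g1_def eval_sum[OF alg] eval_single[OF alg] sum_distrib_left mult_ac)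
    finally have lead: "fps_nth (G (ev g)) d = \<Delta> ^ (2 * d) * ev g1" .
    obtain M' where "\<Delta> ^ M' * fps_nth (G (ev g)) d \<in> Q"
      using coefficient_stable_saturation[OF Q stable[OF hs] less.prems(4)] by blast
    then have in_Q: "\<Delta> ^ (M' + 2 * d) * ev g1 \<in> Q" by (simp add: lead power_add mult.assoc)
    show ?thesis
    proof (rule less.IH[OF _ _ _ _ in_Q])
      have tdeg_\<rho>: "tdeg (\<rho> t) < tdeg t" if "t \<in> A" for t
      proof -
        have "k \<in> keys t" using that \<open>d > 0\<close> by (simp add: A_def in_keys_iff)
        then have "(\<Sum>j\<in>keys t. lookup (\<rho> t) j) < (\<Sum>j\<in>keys t. lookup t j)"
          using that \<open>d > 0\<close>
          by (intro sum_strict_mono_ex1) (auto simp: A_def \<rho>_def lookup_minus intro!: bexI[of _ k])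
        then show ?thesis using tdeg_superset[OF _ keys_\<rho>] by (simp add: tdeg_def)
      qed
      have "tdeg t1 \<le> N" using t1 less.prems(1) by blast
      moreover have "t1 \<in> A" using t1 by (simp add: A_def)
      ultimately show "N - 1 < N" using tdeg_\<rho>[of t1] by simp
      show "\<forall>\<beta>\<in>keys g1. tdeg \<beta> \<le> N - 1"
      proof
        fix \<beta> assume "\<beta> \<in> keys g1"
        then obtain t where t: "t \<in> A" "\<beta> = \<rho> t" using keys_g1 by blast
        then have "tdeg \<beta> < tdeg t" "tdeg t \<le> N" using tdeg_\<rho> less.prems(1) by (auto simp: A_def)
        then show "tdeg \<beta> \<le> N - 1" by simp
      qed
      show "poly_vars_in T g1"
        unfolding poly_vars_in_def
      proof
        fix \<beta> assume "\<beta> \<in> keys g1"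
        then obtain t where "t \<in> A" "\<beta> = \<rho> t" using keys_g1 by blast
        then show "keys \<beta> \<subseteq> T"
          using less.prems(2) keys_\<rho>[of t] unfolding poly_vars_in_def A_def by blast
      qed
      have "inj_on \<rho> A" using \<rho>_add by (metis inj_onI)
      then have "lookup g1 (\<rho> t1) = lookup g t1"
        unfolding g1_def using lookup_sum_single[OF finA _ \<open>t1 \<in> A\<close>] by blast
      then show "g1 \<noteq> 0" using t1(1) by (auto simp: in_keys_iff)
    qed
  qed
qed

lemma minor_power_in_ideal:
  assumes L: "two_sided_ideal (Dalg \<phi>) L" and "L \<noteq> {op_zero}"
  shows "\<exists>M. lmult (\<Delta> ^ M) \<in> L"
proof -
  let ?Q = "{a. lmult a \<in> L}"
  have Q: "is_ideal ?Q" by (rule ideal_lmult_preimage[OF subalg_Dalg L])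
  obtain a where a: "a \<noteq> 0" "lmult a \<in> L" using ideal_contains_lmult[OF subalg_Dalg L assms(2)] by blast
  obtain w where w: "w * a \<in> S0" "w * a \<noteq> 0" using multiple_in_S0[OF a(1)] by blast
  then obtain g where g: "poly_vars_in T g" "w * a = ev g" by (auto simp: eval_ring_def)
  have "g \<noteq> 0" using w(2) g(2) eval_0[OF alg] by metis
  have "\<Delta> ^ 0 * ev g \<in> ?Q" using is_ideal_mult[OF Q, of a w] a(2) g(2) by simp
  moreover have "fps_nth (G b) k \<in> ?Q" if "hasse_schmidt_hom \<phi> G" "b \<in> ?Q" for G b k
    using hasse_schmidt_hom.coefficient_stable[OF that(1) L] that(2) by blast
  moreover have "\<forall>t\<in>keys g. tdeg t \<le> Max (tdeg ` keys g)" by simp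
  ultimately have "\<exists>M. \<Delta> ^ M \<in> ?Q" using unit_in_saturation[OF Q] g(1) \<open>g \<noteq> 0\<close> by blast
  then show ?thesis by blast
qed

end

lemma idl_pow_eq_foldr: "idl_pow I k = foldr idl_mult (replicate k I) UNIV"
  by (induction k) (auto simp: unit_idl_def o_apply)

text \<open>By the pigeonhole principle every product of sufficiently many generators contains a
  high power of one of them.\<close>

lemma idl_pow_subset_if_nilpotent:
  fixes X :: "'a::comm_ring_1 set"
  assumes "finite X" and Q: "is_ideal Q" and nil: "\<And>z. z \<in> X \<Longrightarrow> \<exists>M. z ^ M \<in> Q"
  shows "\<exists>k\<ge>1. idl_pow (idl_gen X) k \<subseteq> Q"
proof -
  obtain M where M: "\<And>z. z \<in> X \<Longrightarrow> z ^ M z \<in> Q" using nil by metis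
  \<comment> \<open>One more than the sum of the sufficient exponents: if every generator occurred
    fewer than \<open>M z\<close> times, the total would stay below \<open>B\<close>.\<close>
  define B where "B = Suc (\<Sum>z\<in>X. M z)"
  \<comment> \<open>The exponents \<open>e\<close> record the generators already drawn from expanded
    factors, while \<open>ps\<close> holds the factors still to be expanded. Length plus total
    exponent is preserved when a factor is replaced by a generator.\<close>
  have main: "prod_list ps * (\<Prod>z\<in>X. z ^ e z) \<in> Q"
    if "set ps \<subseteq> idl_gen X" "length ps + (\<Sum>z\<in>X. e z) \<ge> B" for ps e
    using that
  proof (induction ps arbitrary: e)
    case Nil
    have "\<exists>z\<in>X. M z \<le> e z"
    proof (rule ccontr)
      assume "\<not> (\<exists>z\<in>X. M z \<le> e z)"
      then have "(\<Sum>z\<in>X. e z) \<le> (\<Sum>z\<in>X. M z)" by (intro sum_mono) auto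
      then show False using Nil by (simp add: B_def)
    qed
    then obtain z where z: "z \<in> X" "M z \<le> e z" by blast
    have "(\<Prod>z\<in>X. z ^ e z) = z ^ e z * (\<Prod>z\<in>X - {z}. z ^ e z)" using z assms(1) by (simp add: prod.remove)
    also have "z ^ e z = z ^ (e z - M z) * z ^ M z" using z(2) by (simp flip: power_add)
    finally have "(\<Prod>z\<in>X. z ^ e z) = (z ^ (e z - M z) * (\<Prod>z\<in>X - {z}. z ^ e z)) * z ^ M z" by (simp add: mult_ac)
    then show ?case using is_ideal_mult[OF Q M[OF z(1)]] by simp
  next
    case (Cons p ps)
    have "X \<subseteq> {p. (prod_list ps * (\<Prod>z\<in>X. z ^ e z)) * p \<in> Q}"
    proof
      fix y assume y: "y \<in> X"
      define e' where "e' = e(y := Suc (e y))"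
      have "(\<Sum>z\<in>X. e' z) = e' y + (\<Sum>z\<in>X - {y}. e' z)" using y assms(1) by (simp add: sum.remove)
      also have "(\<Sum>z\<in>X - {y}. e' z) = (\<Sum>z\<in>X - {y}. e z)" by (rule sum.cong) (auto simp: e'_def)
      finally have "(\<Sum>z\<in>X. e' z) = Suc (\<Sum>z\<in>X. e z)" using y assms(1) by (simp add: e'_def sum.remove)
      then have "prod_list ps * (\<Prod>z\<in>X. z ^ e' z) \<in> Q" using Cons.prems by (intro Cons.IH) auto
      moreover have "(\<Prod>z\<in>X. z ^ e' z) = (\<Prod>z\<in>X. z ^ e z) * y"
      proof -
        have "(\<Prod>z\<in>X. z ^ e' z) = y ^ e' y * (\<Prod>z\<in>X - {y}. z ^ e' z)" using y assms(1) by (simp add: prod.remove)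
        also have "(\<Prod>z\<in>X - {y}. z ^ e' z) = (\<Prod>z\<in>X - {y}. z ^ e z)" by (rule prod.cong) (auto simp: e'_def)
        finally show ?thesis using y assms(1) by (simp add: e'_def prod.remove mult_ac)
      qed
      ultimately show "y \<in> {p. (prod_list ps * (\<Prod>z\<in>X. z ^ e z)) * p \<in> Q}" by (simp add: mult.assoc)
    qed
    then have "idl_gen X \<subseteq> {p. (prod_list ps * (\<Prod>z\<in>X. z ^ e z)) * p \<in> Q}"
      by (rule idl_gen_least[OF is_ideal_quotient[OF Q]])
    then show ?case using Cons.prems(1) by (auto simp: mult_ac)
  qed
  have "idl_pow (idl_gen X) B \<subseteq> Q"
    unfolding idl_pow_eq_foldr
  proof (rule foldr_idl_mult_least[OF Q])
    fix ps and q :: 'a assume "list_all2 (\<in>) ps (replicate B (idl_gen X))"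
    then have "length ps = B" "set ps \<subseteq> idl_gen X"
      by (auto simp: list_all2_conv_all_nth set_conv_nth)
    then have "prod_list ps \<in> Q" using main[of ps "\<lambda>_. 0"] by simp
    then show "prod_list ps * q \<in> Q" using is_ideal_mult[OF Q, of "prod_list ps" q] by (simp add: mult.commute)
  qed
  then show ?thesis by (intro exI[of _ B]) (simp add: B_def)
qed

section \<open>Simplicity of the algebra of differential operators\<close>

lemma map_mat_submatrix:
  assumes A: "A \<in> carrier_mat m n" and I: "I \<subseteq> {..<m}" and J: "J \<subseteq> {..<n}"
  shows "submatrix (map_mat h A) I J = map_mat h (submatrix A I J)"
proof (rule eq_matI)
  note c = submatrix_carrier_index[OF A I J]
  have hA: "map_mat h A \<in> carrier_mat m n" using A by simp
  note c' = submatrix_carrier_index[OF hA I J]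
  show "dim_row (submatrix (map_mat h A) I J) = dim_row (map_mat h (submatrix A I J))"
    "dim_col (submatrix (map_mat h A) I J) = dim_col (map_mat h (submatrix A I J))"
    using c(1) c'(1) by auto
  fix i j assume "i < dim_row (map_mat h (submatrix A I J))" "j < dim_col (map_mat h (submatrix A I J))"
  then have ij: "i < card I" "j < card J" using c(1) by auto
  have "pick I i \<in> I" "pick J j \<in> J" using ij pick_in_set_le by auto
  then have "pick I i < m" "pick J j < n" using I J by auto
  then show "submatrix (map_mat h A) I J $$ (i, j) = map_mat h (submatrix A I J) $$ (i, j)"
    using c(1) c(2)[OF ij] c'(2)[OF ij] ij A by auto
qed

lemma det_map_to_frac: "det (map_mat to_frac A) = to_frac (det A)"
proof -
  interpret comm_ring_hom "to_frac :: 'a \<Rightarrow> 'a fract" by unfold_locales simp_all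
  show ?thesis by (rule hom_det)
qed

context
  fixes \<phi> :: "'k::field \<Rightarrow> 'a::idom" and x :: "nat \<Rightarrow> 'a" and n m :: nat and f :: "nat \<Rightarrow> 'k kpoly"
  assumes perfect: "perfect_field TYPE('k)"
    and alg: "alg_struct \<phi>"
    and f_Pn: "\<forall>i<m. in_Pn n (f i)"
    and ker: "\<forall>p. in_Pn n p \<longrightarrow>
               (eval_mpoly \<phi> x p = 0 \<longleftrightarrow> (\<exists>g. (\<forall>i<m. in_Pn n (g i)) \<and> p = (\<Sum>i<m. g i * f i)))"
    and loc: "\<forall>a. \<exists>p q. in_Pn n p \<and> in_Pn n q \<and> (\<exists>v. eval_mpoly \<phi> x q * v = 1)
                          \<and> a * eval_mpoly \<phi> x q = eval_mpoly \<phi> x p"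
begin

lemma jacobi_mat_carrier: "jacobi_mat \<phi> x n m f \<in> carrier_mat m n"
  by (simp add: jacobi_mat_def)

lemma jacobi_rank_eq: "jacobi_rank \<phi> x n m f = vec_space.rank m (map_mat to_frac (jacobi_mat \<phi> x n m f))"
proof -
  have "to_frac = (\<lambda>a :: 'a. Fract a 1)" by (auto simp: to_frac_def)
  then show ?thesis by (simp add: jacobi_rank_def)
qed

lemma det_submatrix_frac:
  assumes "I \<subseteq> {..<m}" "J \<subseteq> {..<n}"
  shows "det (submatrix (map_mat to_frac (jacobi_mat \<phi> x n m f)) I J) = to_frac (det (submatrix (jacobi_mat \<phi> x n m f) I J))"
  by (simp add: map_mat_submatrix[OF jacobi_mat_carrier assms] det_map_to_frac)

lemma jacobian_ideal_nonzero: "\<exists>a\<in>jacobian_ideal \<phi> x n m f. a \<noteq> 0"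
proof -
  have "map_mat to_frac (jacobi_mat \<phi> x n m f) \<in> carrier_mat m n" using jacobi_mat_carrier by simp
  from rank_minor[OF this] obtain I J where IJ: "I \<subseteq> {..<m}" "J \<subseteq> {..<n}"
    "card I = jacobi_rank \<phi> x n m f" "card J = jacobi_rank \<phi> x n m f"
    "det (submatrix (map_mat to_frac (jacobi_mat \<phi> x n m f)) I J) \<noteq> 0"
    unfolding jacobi_rank_eq by metis
  then have "det (submatrix (jacobi_mat \<phi> x n m f) I J) \<noteq> 0" by (simp add: det_submatrix_frac)
  moreover have "det (submatrix (jacobi_mat \<phi> x n m f) I J) \<in> jacobian_ideal \<phi> x n m f"
    unfolding jacobian_ideal_def Let_def using IJ by (intro idl_gen_base) blast
  ultimately show ?thesis by blast
qed

text \<open>The Jacobian ideal has finitely many generators, and each is zero or a minor to which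
  \<open>jacobian_minor\<close> applies, so every generator has a power in the trace of
  \<open>L\<close>; pigeonhole makes the exponent uniform.\<close>

lemma jacobian_power_in_ideal:
  assumes L: "two_sided_ideal (Dalg \<phi>) L" and "L \<noteq> {op_zero}"
  shows "\<exists>k\<ge>1. \<forall>a\<in>idl_pow (jacobian_ideal \<phi> x n m f) k. lmult a \<in> L"
proof -
  let ?A = "jacobi_mat \<phi> x n m f"
  let ?r = "jacobi_rank \<phi> x n m f"
  let ?X = "{det (submatrix ?A I J) | I J. I \<subseteq> {..<m} \<and> J \<subseteq> {..<n} \<and> card I = ?r \<and> card J = ?r}"
  have "?X \<subseteq> (\<lambda>(I, J). det (submatrix ?A I J)) ` (Pow {..<m} \<times> Pow {..<n})" by auto
  then have fin: "finite ?X" by (rule finite_subset) simp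
  have Q: "is_ideal {a. lmult a \<in> L}" by (rule ideal_lmult_preimage[OF subalg_Dalg L])
  have "\<exists>M. z ^ M \<in> {a. lmult a \<in> L}" if "z \<in> ?X" for z
  proof (cases "z = 0")
    case True
    then have "z ^ 1 \<in> {a. lmult a \<in> L}" using Q unfolding is_ideal_def by simp
    then show ?thesis by blast
  next
    case False
    obtain I J where IJ: "I \<subseteq> {..<m}" "J \<subseteq> {..<n}" "card I = ?r" "card J = ?r" "z = det (submatrix ?A I J)"
      using \<open>z \<in> ?X\<close> by blast
    have entry: "?A $$ (i, j) = eval_mpoly \<phi> x (pderiv_mpoly j (f i))" if "i < m" "j < n" for i j
      using that by (simp add: jacobi_mat_def)
    obtain C where C: "\<And>j l. j \<in> J \<Longrightarrow> l \<in> J \<Longrightarrow> (\<Sum>i\<in>I. C j i * ?A $$ (i, l)) = (if j = l then z else 0)"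
      using minor_cofactors[OF jacobi_mat_carrier IJ(1,2)] IJ(3-5) by auto
    have C': "(\<Sum>i\<in>I. C j i * eval_mpoly \<phi> x (pderiv_mpoly l (f i))) = (if j = l then z else 0)"
      if "j \<in> J" "l \<in> J" for j l
    proof -
      have "(\<Sum>i\<in>I. C j i * eval_mpoly \<phi> x (pderiv_mpoly l (f i))) = (\<Sum>i\<in>I. C j i * ?A $$ (i, l))"
        using IJ(1,2) that(2) by (intro sum.cong) (auto simp: entry subset_iff)
      then show ?thesis using C[OF that] by simp
    qed
    let ?F = "map_mat to_frac ?A"
    have F: "?F \<in> carrier_mat m n" using jacobi_mat_carrier by simp
    have "\<exists>q. \<forall>i<m. ?F $$ (i, j) = (\<Sum>l\<in>J. ?F $$ (i, l) * q l)" if "j < n" for j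
      using IJ False that
      by (intro columns_in_span_of_rank_minor[OF F IJ(1,2)]) (auto simp: det_submatrix_frac jacobi_rank_eq)
    then obtain q where q: "\<And>i j. i < m \<Longrightarrow> j < n \<Longrightarrow> ?F $$ (i, j) = (\<Sum>l\<in>J. ?F $$ (i, l) * q j l)" by metis
    have entryF: "?F $$ (i, j) = to_frac (eval_mpoly \<phi> x (pderiv_mpoly j (f i)))" if "i < m" "j < n" for i j
      using that jacobi_mat_carrier by (simp add: entry)
    have q': "to_frac (eval_mpoly \<phi> x (pderiv_mpoly j (f i))) =
        (\<Sum>l\<in>J. to_frac (eval_mpoly \<phi> x (pderiv_mpoly l (f i))) * q j l)" if "i < m" "j < n" for i j
    proof -
      have "to_frac (eval_mpoly \<phi> x (pderiv_mpoly j (f i))) = (\<Sum>l\<in>J. ?F $$ (i, l) * q j l)"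
        using q[OF that] entryF[OF that] by simp
      also have "\<dots> = (\<Sum>l\<in>J. to_frac (eval_mpoly \<phi> x (pderiv_mpoly l (f i))) * q j l)"
        using IJ(2) that(1) entryF by (intro sum.cong) auto
      finally show ?thesis .
    qed
    interpret jacobian_minor \<phi> x n m f I J z C q
      by unfold_locales (use perfect alg f_Pn ker loc IJ(1,2) False C' q' in \<open>simp_all\<close>)
    show ?thesis using minor_power_in_ideal[OF assms] by blast
  qed
  from idl_pow_subset_if_nilpotent[OF fin Q this] show ?thesis
    unfolding jacobian_ideal_def Let_def by blast
qed

text \<open>A nonzero ideal is only known to contain some power of the Jacobian ideal, hence the
  condition is imposed on all powers.\<close>

lemma Dalg_simple_iff:
  "simple_ring (Dalg \<phi>) \<longleftrightarrow> (\<forall>i\<ge>1. sandwich (Dalg \<phi>) (idl_pow (jacobian_ideal \<phi> x n m f) i) = Dalg \<phi>)"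
proof (intro iffI allI impI)
  fix i :: nat assume "simple_ring (Dalg \<phi>)"
  then show "sandwich (Dalg \<phi>) (idl_pow (jacobian_ideal \<phi> x n m f) i) = Dalg \<phi>"
    using idl_pow_nonzero[OF jacobian_ideal_nonzero, of i] simple_sandwich[OF subalg_Dalg] by blast
next
  assume *: "\<forall>i\<ge>1. sandwich (Dalg \<phi>) (idl_pow (jacobian_ideal \<phi> x n m f) i) = Dalg \<phi>"
  show "simple_ring (Dalg \<phi>)"
  proof (rule simple_ringI[OF subalg_Dalg])
    fix L assume L: "two_sided_ideal (Dalg \<phi>) L" "L \<noteq> {op_zero}"
    obtain k where k: "k \<ge> 1" "\<forall>a\<in>idl_pow (jacobian_ideal \<phi> x n m f) k. lmult a \<in> L"
      using jacobian_power_in_ideal[OF L] by blast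
    show "L = Dalg \<phi>"
      using ideal_eq_if_sandwich[OF subalg_Dalg L(1), of "idl_pow (jacobian_ideal \<phi> x n m f) k"] * k by blast
  qed
qed

end

section \<open>The seven equivalent conditions\<close>

theorem theorem1p10:
  fixes \<phi> :: "'k::field \<Rightarrow> 'a::idom"
    and x :: "nat \<Rightarrow> 'a" and n m :: nat and f :: "nat \<Rightarrow> 'k kpoly"
    and R :: "('a \<Rightarrow> 'a) set"
  assumes perfect: "perfect_field TYPE('k)"
    and alg: "alg_struct \<phi>"
    and f_Pn: "\<forall>i<m. in_Pn n (f i)"
    and ker: "\<forall>p. in_Pn n p \<longrightarrow>
               (eval_mpoly \<phi> x p = 0 \<longleftrightarrow> (\<exists>g. (\<forall>i<m. in_Pn n (g i)) \<and> p = (\<Sum>i<m. g i * f i)))"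
    and loc: "\<forall>a. \<exists>p q. in_Pn n p \<and> in_Pn n q \<and> (\<exists>v. eval_mpoly \<phi> x q * v = 1)
                          \<and> a * eval_mpoly \<phi> x q = eval_mpoly \<phi> x p"
    and R_sub: "subalg_containing_A \<phi> R"
    and R_ess: "essential_left_A_submodule (Dalg \<phi>) R"
  shows
   "let D = Dalg \<phi>; ar = jacobian_ideal \<phi> x n m f;
        b = bideal \<phi> R; c = cideal \<phi> R;
        s1 = simple_ring R;
        s2 = (\<forall>i\<ge>1. sandwich D (idl_pow ar i) = D \<and> sandwich R (idl_mult (b i) (c i)) = R);
        s3 = (simple_ring D \<and> (\<forall>i\<ge>1. sandwich R (idl_mult (b i) (c i)) = R));
        s4 = ((\<forall>i\<ge>1. sandwich D (idl_pow ar i) = D) \<and> sandwich R (idl_pow (b 1) 2) = R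
               \<and> (\<forall>i\<ge>2. sandwich R (chain_prod b i) = R));
        s5 = (simple_ring D \<and> sandwich R (idl_pow (b 1) 2) = R
               \<and> (\<forall>i\<ge>2. sandwich R (chain_prod b i) = R));
        s6 = ((\<forall>i\<ge>1. sandwich D (idl_pow ar i) = D) \<and> sandwich R (idl_pow (c 1) 2) = R
               \<and> (\<forall>i\<ge>2. sandwich R (chain_prod c i) = R));
        s7 = (simple_ring D \<and> sandwich R (idl_pow (c 1) 2) = R
               \<and> (\<forall>i\<ge>2. sandwich R (chain_prod c i) = R))
    in (s1 \<longleftrightarrow> s2) \<and> (s1 \<longleftrightarrow> s3) \<and> (s1 \<longleftrightarrow> s4) \<and> (s1 \<longleftrightarrow> s5)
       \<and> (s1 \<longleftrightarrow> s6) \<and> (s1 \<longleftrightarrow> s7)"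
proof -
  let ?D = "Dalg \<phi>" and ?b = "bideal \<phi> R" and ?c = "cideal \<phi> R"
  let ?ar = "jacobian_ideal \<phi> x n m f"
  have b: "\<exists>a\<in>?b i. a \<noteq> 0" for i by (rule bideal_nonzero[OF alg loc R_sub R_ess])
  have c: "\<exists>a\<in>?c i. a \<noteq> 0" for i
    using b[of i] cideal_nonzero_if_bideal_nonzero[OF R_sub] by blast
  have D: "simple_ring ?D \<longleftrightarrow> (\<forall>i\<ge>1. sandwich ?D (idl_pow ?ar i) = ?D)"
    by (rule Dalg_simple_iff[OF perfect alg f_Pn ker loc])
  \<comment> \<open>The list \<open>[1..<1]\<close> is empty, so the separate condition on the
    square is the case \<open>i = 1\<close> of the chain condition.\<close>
  have chain1: "idl_pow (I 1) 2 = chain_prod I 1" for I :: "nat \<Rightarrow> 'a set"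
    by (simp add: chain_prod_def)
  have up: "simple_ring ?D" if "simple_ring R" by (rule Dalg_simple_if_simple[OF R_sub R_ess that])
  have sw: "sandwich R X = R" if "simple_ring R" "\<exists>a\<in>X. a \<noteq> 0" for X
    using simple_sandwich[OF R_sub that(1)] that(2) by blast
  have chain_all: "(\<forall>i\<ge>1. sandwich R (chain_prod I i) = R) \<longleftrightarrow>
      sandwich R (idl_pow (I 1) 2) = R \<and> (\<forall>i\<ge>2. sandwich R (chain_prod I i) = R)" for I
  proof -
    have "(i \<ge> (1 :: nat)) \<longleftrightarrow> i = 1 \<or> i \<ge> 2" for i by auto
    then show ?thesis unfolding chain1 by auto
  qed
  \<comment> \<open>Going down to \<open>D\<close> uses essentiality and nonzero members of
    \<open>X i\<close>; coming back uses that \<open>X i\<close> lies in the product of the b- and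
    c-ideals. All three families in the theorem satisfy both.\<close>
  have 1: "simple_ring R \<longleftrightarrow> simple_ring ?D \<and> (\<forall>i\<ge>1. sandwich R (X i) = R)"
    if "\<And>i. i \<ge> 1 \<Longrightarrow> \<exists>a\<in>X i. a \<noteq> 0" "\<And>i. i \<ge> 1 \<Longrightarrow> X i \<subseteq> idl_mult (?b i) (?c i)" for X
    using up sw that simple_if_Dalg_simple[OF R_sub, of X] by blast
  have bc: "simple_ring R \<longleftrightarrow> simple_ring ?D \<and> (\<forall>i\<ge>1. sandwich R (idl_mult (?b i) (?c i)) = R)"
    by (rule 1) (auto intro: idl_mult_nonzero b c)
  have bb: "simple_ring R \<longleftrightarrow> simple_ring ?D \<and> sandwich R (idl_pow (?b 1) 2) = R \<and> (\<forall>i\<ge>2. sandwich R (chain_prod ?b i) = R)"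
    unfolding chain_all[symmetric] by (rule 1) (use chain_prod_nonzero[of ?b] b chain_prod_bideal_subset[OF R_sub] in blast)+
  have cc: "simple_ring R \<longleftrightarrow> simple_ring ?D \<and> sandwich R (idl_pow (?c 1) 2) = R \<and> (\<forall>i\<ge>2. sandwich R (chain_prod ?c i) = R)"
    unfolding chain_all[symmetric] by (rule 1) (use chain_prod_nonzero[of ?c] c chain_prod_cideal_subset[OF R_sub] in blast)+
  have bc': "simple_ring R \<longleftrightarrow> (\<forall>i\<ge>1. sandwich ?D (idl_pow ?ar i) = ?D \<and> sandwich R (idl_mult (?b i) (?c i)) = R)"
    unfolding bc D by blast
  note bb' = bb[unfolded D] and cc' = cc[unfolded D]
  show ?thesis
    unfolding Let_def by (intro conjI bc' bc bb' bb cc' cc)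
qed

end
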